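(* Let $p\in\mathcal P^{\log}(\Omega)$ with $p^->1$ and let $z\in H^{\gamma,p'(\cdot)}(\Omega)$ with $\gamma\in(0,1]$, with (minimal) Hajłasz gradient $|\nabla^\gamma z|:=\operatorname{argmin}_{g\in\mathrm{Gr}(z)}\|g\|_{p'(\cdot),\Omega}\in L^{p'(\cdot)}(\Omega)$. Then, for every $T\in\mathcal T_h$, it holds that $$\|z-\Pi_h^Qz\|_{p'(\cdot),T}\lesssim h_T^\gamma\,\||\nabla^\gamma z|\|_{p'(\cdot),\omega_T},$$ where the constant hidden in $\lesssim$ depends only on $d,\ell,p^-,p^+,c_{\log}(p)$, and $\omega_0$. In particular, it holds that $$\|z-\Pi_h^Qz\|_{p'(\cdot),\Omega}\lesssim h^\gamma\,\||\nabla^\gamma z|\|_{p'(\cdot),\Omega}.$$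
   Context: $\Omega\subseteq\mathbb R^d$, $d\in\{2,3\}$, is a bounded simplicial (polygonal/polyhedral) Lipschitz domain. $\{\mathcal T_h\}_{h\in(0,1]}$ is a family of conforming triangulations of $\Omega$ into $d$-simplices; $h_T:=\mathrm{diam}(T)$, $h=\max_{T\in\mathcal T_h}h_T$, $\rho_T$ is the supremum of diameters of balls inscribed in $T$, and $\omega_0$ (chunkiness) is the smallest constant, independent of $h$, with $\max_Th_T\rho_T^{-1}\le\omega_0$. $\omega_T:=\bigcup\{T'\in\mathcal T_h:T'\cap T\neq\emptyset\}$. $\langle f\rangle_M$ is the integral mean of $f$ over $M$. $f\lesssim g$ means $f\le c\,g$ with a constant $c>0$. For a bounded measurable exponent $p:\Omega\to[1,\infty)$: $p^-=\operatorname{ess\,inf}p$, $p^+=\operatorname{ess\,sup}p$, $p'=p/(p-1)$, and $\|v\|_{p(\cdot),M}=\inf\{\lambda>0:\int_M|v/\lambda|^{p(x)}dx\le1\}$ is the norm of $L^{p(\cdot)}(M)$. $p\in\mathcal P^{\log}(\Omega)$ means that $p$ is bounded and there are $c_1,c_2>0$, $p_\infty\in\mathbb R$ with $|p(x)-p(y)|\le c_1/\log(e+1/|x-y|)$ and $|p(x)-p_\infty|\le c_2/\log(e+|x|)$ for all $x,y\in\Omega$; $c_{\log}(p):=\max\{c_1,c_2\}$. For $\gamma\in(0,1]$ and $v\in L^{p'(\cdot)}(\Omega)$, $\mathrm{Gr}(v)$ is the set of $g\in L^{p'(\cdot)}(\Omega;\mathbb R_{\ge0})$ with $|v(x)-v(y)|\le(g(x)+g(y))|x-y|^\gamma$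 for a.e. $x,y\in\Omega$, and $H^{\gamma,p'(\cdot)}(\Omega):=\{v\in L^{p'(\cdot)}(\Omega):\mathrm{Gr}(v)\ne\emptyset\}$; the minimizer defining $|\nabla^\gamma v|$ exists uniquely. $\mathbb P^\ell(\mathcal T_h)$ ($\ell\in\mathbb N_0$) is the space of elementwise polynomials of degree at most $\ell$; $Q:=L^{p'(\cdot)}(\Omega)$, $Q_h\subseteq\mathbb P^\ell(\mathcal T_h)$ is a finite element space with $\mathbb R\subseteq Q_h$, and $\Pi_h^Q:Q\to Q_h$ is a linear projection that is locally $L^1$-stable, i.e. $\langle|\Pi_h^Qz|\rangle_T\lesssim\langle|z|\rangle_{\omega_T}$ for all $z\in Q$, $T\in\mathcal T_h$, with a constant uniform in $h,T,z$, regarded as fixed (hidden constants may depend on it). *)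

theory Defs
  imports "HOL-Analysis.Analysis" "HOL-Probability.Essential_Supremum"
begin

section \<open>Triangulated Lipschitz domains\<close>

text \<open>In suitable orthogonal coordinates the domain is, near each boundary point,
  the strict epigraph of a Lipschitz function \<open>\<phi>\<close>; the vector \<open>e\<close> is the vertical direction
  and \<open>y - (y \<bullet> e) *\<^sub>R e\<close> is the horizontal component of \<open>y\<close>.\<close>

definition lipschitz_domain :: "'a::euclidean_space set \<Rightarrow> bool" where
  "lipschitz_domain \<Omega> \<longleftrightarrow> open \<Omega> \<and> connected \<Omega> \<and> \<Omega> \<noteq> {} \<and>
     (\<forall>x\<in>frontier \<Omega>. \<exists>U e \<phi> L. open U \<and> x \<in> U \<and> norm e = 1 \<and>
        L-lipschitz_on {y. y \<bullet> e = 0} \<phi> \<and>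
        \<Omega> \<inter> U = {y\<in>U. \<phi> (y - (y \<bullet> e) *\<^sub>R e) < y \<bullet> e})"

text \<open>Conformity (two elements meet in a common face, possibly empty) is part of the library's
  \<open>triangulation\<close>. The elements are closed, hence they cover the closure of \<open>\<Omega>\<close>.\<close>

definition conforming_triangulation :: "'a::euclidean_space set \<Rightarrow> 'a set set \<Rightarrow> bool" where
  "conforming_triangulation \<Omega> \<T> \<longleftrightarrow> triangulation \<T> \<and>
     (\<forall>T\<in>\<T>. int DIM('a) simplex T) \<and> \<Union>\<T> = closure \<Omega>"

definition simplicial_lipschitz_domain :: "'a::euclidean_space set \<Rightarrow> bool" where
  "simplicial_lipschitz_domain \<Omega> \<longleftrightarrow> bounded \<Omega> \<and> lipschitz_domain \<Omega> \<and>
     (\<exists>\<T>. conforming_triangulation \<Omega> \<T>)"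

text \<open>The family is indexed by its mesh size. Only a set \<open>H\<close> of mesh sizes in \<open>(0,1]\<close> need occur.\<close>

definition triangulation_family ::
    "'a::euclidean_space set \<Rightarrow> real set \<Rightarrow> (real \<Rightarrow> 'a set set) \<Rightarrow> bool" where
  "triangulation_family \<Omega> H \<T> \<longleftrightarrow> H \<subseteq> {0<..1} \<and>
     (\<forall>h\<in>H. conforming_triangulation \<Omega> (\<T> h) \<and> h = Max (diameter ` \<T> h))"

definition inball_diameter :: "'a::euclidean_space set \<Rightarrow> real" where
  "inball_diameter T = Sup {diameter (ball x r) | x r. ball x r \<subseteq> T}"

definition is_chunkiness :: "real set \<Rightarrow> (real \<Rightarrow> 'a::euclidean_space set set) \<Rightarrow> real \<Rightarrow> bool" where
  "is_chunkiness H \<T> \<omega> \<longleftrightarrow>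
     (\<forall>h\<in>H. \<forall>T\<in>\<T> h. diameter T / inball_diameter T \<le> \<omega>) \<and>
     (\<forall>\<omega>'. (\<forall>h\<in>H. \<forall>T\<in>\<T> h. diameter T / inball_diameter T \<le> \<omega>') \<longrightarrow> \<omega> \<le> \<omega>')"

definition patch :: "'a set set \<Rightarrow> 'a set \<Rightarrow> 'a set" where
  "patch \<T> T = \<Union>{T'\<in>\<T>. T' \<inter> T \<noteq> {}}"

definition integral_mean :: "'a::euclidean_space set \<Rightarrow> ('a \<Rightarrow> real) \<Rightarrow> real" where
  "integral_mean M f = (LINT x:M|lebesgue. f x) / measure lebesgue M"

section \<open>Variable exponent Lebesgue spaces\<close>

text \<open>All function spaces below are sets of representatives, defined on the whole space with
  irrelevant values outside \<open>\<Omega>\<close> (in particular on its null boundary, which the closed elements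
  may touch).\<close>

text \<open>With values in \<open>ennreal\<close>, the infimum over the empty set is \<open>\<infinity>\<close>, so that the norm is
  finite exactly on the Lebesgue space.\<close>

definition luxemburg_norm :: "('a::euclidean_space \<Rightarrow> real) \<Rightarrow> 'a set \<Rightarrow> ('a \<Rightarrow> real) \<Rightarrow> ennreal" where
  "luxemburg_norm p M v =
     (INF t\<in>{t::real. 0 < t \<and> (\<integral>\<^sup>+x\<in>M. ennreal (\<bar>v x / t\<bar> powr p x) \<partial>lebesgue) \<le> 1}. ennreal t)"

definition Lp_var :: "('a::euclidean_space \<Rightarrow> real) \<Rightarrow> 'a set \<Rightarrow> ('a \<Rightarrow> real) set" where
  "Lp_var p M = {v \<in> borel_measurable (lebesgue_on M). luxemburg_norm p M v < \<infinity>}"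

definition conj_exponent :: "('a \<Rightarrow> real) \<Rightarrow> 'a \<Rightarrow> real" where
  "conj_exponent p x = p x / (p x - 1)"

definition exponent_sup :: "'a::euclidean_space set \<Rightarrow> ('a \<Rightarrow> real) \<Rightarrow> ereal" where
  "exponent_sup \<Omega> p = esssup (lebesgue_on \<Omega>) (\<lambda>x. ereal (p x))"

definition exponent_inf :: "'a::euclidean_space set \<Rightarrow> ('a \<Rightarrow> real) \<Rightarrow> ereal" where
  "exponent_inf \<Omega> p = - esssup (lebesgue_on \<Omega>) (\<lambda>x. - ereal (p x))"

text \<open>Membership in the class of globally log-Hoelder continuous exponents, with
  \<open>c = max {c\<^sub>1, c\<^sub>2}\<close> the associated constant. For \<open>x = y\<close> the term \<open>1 / 0\<close> is \<open>0\<close> in HOL, which is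
  harmless since the left-hand side vanishes.\<close>

definition Plog :: "'a::euclidean_space set \<Rightarrow> ('a \<Rightarrow> real) \<Rightarrow> real \<Rightarrow> bool" where
  "Plog \<Omega> p c \<longleftrightarrow> p \<in> borel_measurable (lebesgue_on \<Omega>) \<and>
     (\<forall>x\<in>\<Omega>. 1 \<le> p x) \<and> bounded (p ` \<Omega>) \<and>
     (\<exists>c1 c2 p_inf. 0 < c1 \<and> 0 < c2 \<and> c = max c1 c2 \<and>
        (\<forall>x\<in>\<Omega>. \<forall>y\<in>\<Omega>. \<bar>p x - p y\<bar> \<le> c1 / ln (exp 1 + 1 / norm (x - y))) \<and>
        (\<forall>x\<in>\<Omega>. \<bar>p x - p_inf\<bar> \<le> c2 / ln (exp 1 + norm x)))"

section \<open>Hajlasz gradients\<close>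

text \<open>In the following definitions \<open>q\<close> is the integrability exponent itself.\<close>

definition hajlasz_gradients ::
    "real \<Rightarrow> ('a::euclidean_space \<Rightarrow> real) \<Rightarrow> 'a set \<Rightarrow> ('a \<Rightarrow> real) \<Rightarrow> ('a \<Rightarrow> real) set" where
  "hajlasz_gradients \<gamma> q \<Omega> v = {g \<in> Lp_var q \<Omega>. (\<forall>x\<in>\<Omega>. 0 \<le> g x) \<and>
     (AE x in lebesgue_on \<Omega>. AE y in lebesgue_on \<Omega>.
        \<bar>v x - v y\<bar> \<le> (g x + g y) * norm (x - y) powr \<gamma>)}"

definition hajlasz_space ::
    "real \<Rightarrow> ('a::euclidean_space \<Rightarrow> real) \<Rightarrow> 'a set \<Rightarrow> ('a \<Rightarrow> real) set" where
  "hajlasz_space \<gamma> q \<Omega> = {v \<in> Lp_var q \<Omega>. hajlasz_gradients \<gamma> q \<Omega> v \<noteq> {}}"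

definition is_minimal_hajlasz_gradient ::
    "real \<Rightarrow> ('a::euclidean_space \<Rightarrow> real) \<Rightarrow> 'a set \<Rightarrow> ('a \<Rightarrow> real) \<Rightarrow> ('a \<Rightarrow> real) \<Rightarrow> bool" where
  "is_minimal_hajlasz_gradient \<gamma> q \<Omega> v g \<longleftrightarrow>
     is_arg_min (luxemburg_norm q \<Omega>) (\<lambda>g. g \<in> hajlasz_gradients \<gamma> q \<Omega> v) g"

section \<open>Finite element spaces and projections\<close>

text \<open>Polynomials of total degree at most \<open>l\<close>; \<open>\<alpha>\<close> ranges over multi-indices.\<close>

definition polynomials_upto :: "nat \<Rightarrow> (real ^ 'n \<Rightarrow> real) set" where
  "polynomials_upto l =
     {q. \<exists>c :: ('n \<Rightarrow> nat) \<Rightarrow> real. \<forall>x.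
        q x = (\<Sum>\<alpha> | sum \<alpha> UNIV \<le> l. c \<alpha> * (\<Prod>i\<in>UNIV. x $ i ^ \<alpha> i))}"

definition piecewise_polynomials :: "nat \<Rightarrow> (real ^ 'n) set set \<Rightarrow> (real ^ 'n \<Rightarrow> real) set" where
  "piecewise_polynomials l \<T> =
     {v. \<forall>T\<in>\<T>. \<exists>q\<in>polynomials_upto l. AE x in lebesgue_on T. v x = q x}"

definition fe_space :: "nat \<Rightarrow> (real ^ 'n) set set \<Rightarrow> (real ^ 'n \<Rightarrow> real) set \<Rightarrow> bool" where
  "fe_space l \<T> V \<longleftrightarrow> V \<subseteq> piecewise_polynomials l \<T> \<and>
     (\<forall>u\<in>V. \<forall>v\<in>V. \<forall>a b. (\<lambda>x. a * u x + b * v x) \<in> V) \<and> (\<forall>a. (\<lambda>x. a) \<in> V)"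

text \<open>A linear projection of the space of classes of \<open>Q\<close> onto the classes of \<open>V\<close>, acting on
  representatives: the first condition below says that it respects equality almost everywhere.\<close>

definition linear_projection ::
    "'a::euclidean_space set \<Rightarrow> ('a \<Rightarrow> real) set \<Rightarrow> ('a \<Rightarrow> real) set \<Rightarrow>
     (('a \<Rightarrow> real) \<Rightarrow> 'a \<Rightarrow> real) \<Rightarrow> bool" where
  "linear_projection \<Omega> Q V P \<longleftrightarrow>
     (\<forall>u\<in>Q. \<forall>v\<in>Q. (AE x in lebesgue_on \<Omega>. u x = v x) \<longrightarrow>
        (AE x in lebesgue_on \<Omega>. P u x = P v x)) \<and>
     (\<forall>v\<in>Q. P v \<in> V) \<and>
     (\<forall>u\<in>Q. \<forall>v\<in>Q. \<forall>a b. AE x in lebesgue_on \<Omega>.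
        P (\<lambda>y. a * u y + b * v y) x = a * P u x + b * P v x) \<and>
     (\<forall>v\<in>V. AE x in lebesgue_on \<Omega>. P v x = v x)"

definition locally_L1_stable ::
    "'a::euclidean_space set set \<Rightarrow> ('a \<Rightarrow> real) set \<Rightarrow> (('a \<Rightarrow> real) \<Rightarrow> 'a \<Rightarrow> real) \<Rightarrow> real \<Rightarrow> bool" where
  "locally_L1_stable \<T> Q P c \<longleftrightarrow> (\<forall>z\<in>Q. \<forall>T\<in>\<T>.
     integral_mean T (\<lambda>x. \<bar>P z x\<bar>) \<le> c * integral_mean (patch \<T> T) (\<lambda>x. \<bar>z x\<bar>))"

end

theory Submission
  imports Defs "HOL-Computational_Algebra.Polynomial"
begin

text \<open>Write \<open>q\<close> for the conjugate exponent, \<open>h\<close> for the diameter of an element \<open>T\<close>, and \<open>M\<close> for its patch.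

The projection reproduces constants, so \<open>z - P z = (z - m) - P (z - m)\<close> for every constant \<open>m\<close>.
Take \<open>m = z y\<^sub>0\<close>, where \<open>y\<^sub>0\<close> is a point of the patch at which the Hajlasz gradient \<open>g\<close> does not exceed its
mean over \<open>M\<close>. The Hajlasz inequality then bounds \<open>z - m\<close> on \<open>M\<close> by \<open>h powr \<gamma>\<close> times \<open>g\<close> plus its mean
(\<open>hajlasz_patch_oscillation\<close>). On \<open>T\<close> the function \<open>P (z - m)\<close> is a polynomial, so its supremum is
controlled by its mean (\<open>polynomial_inverse_estimate\<close>), and this mean is controlled by the mean of \<open>z - m\<close>
over \<open>M\<close> because of the local stability. Together this gives the pointwise bound
\<open>projection_error_pointwise\<close>: almost everywhere on \<open>T\<close>, the error is at most a constant times
\<open>h powr \<gamma>\<close> times the sum of \<open>g\<close> and its mean over \<open>M\<close>.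

What remains is that passing from \<open>g\<close> to its patch means is bounded in the Luxemburg norm, with a constant
that does not see the domain. For a constant exponent this is Jensen's inequality. In general, let
\<open>u \<ge> 0\<close> have modular at most one on \<open>M\<close> and let \<open>s\<close> be half of its mean. Since the part of \<open>u\<close> below \<open>s\<close>
accounts for at most half of the mean, \<open>s powr q x\<close> is at most the mean over \<open>y\<close> of
\<open>u y powr q y * s powr (q x - q y)\<close> (\<open>half_mean_powr_le\<close>). The second factor is bounded as long as \<open>s\<close>
lies between a negative power of \<open>e + |x|\<close> and a multiple of a negative power of \<open>h\<close>, by the two
conditions of log-Hoelder continuity (\<open>log_hoelder_scale_bound\<close>). The upper restriction on \<open>s\<close> holds
because the modular is at most one; and if the lower one fails, \<open>s powr q x\<close> is below the weight
\<open>decay_weight x\<close>, which is integrable over the whole space. Summing over all elements, the finite overlap of the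
patches turns these bounds into one for the modular on the domain, and then for the norm
(\<open>luxemburg_norm_domain_le\<close>).

Both the diameter of a patch and the overlap of the patches depend on the fact that touching elements have comparable
diameters. If two elements share at least two points, they share an edge, whose length is at least the inscribed
diameter of either and at most the diameter of either. Elements that share only a point \<open>v\<close> are
connected through a chain of elements at \<open>v\<close> of this kind: near \<open>v\<close>, a Lipschitz domain remains connected when \<open>v\<close>
is removed, so the elements at \<open>v\<close> cannot be divided into two groups which meet only in \<open>v\<close>. The length of the chain
is bounded because the number of elements at \<open>v\<close> is, by comparison of volumes (\<open>touching_diameter_le\<close>).\<close>

section \<open>Simplices and inscribed balls\<close>

text \<open>The barycentric coordinate of the vertex \<open>a\<close> is an affine function with values in \<open>[0,1]\<close> on the
  simplex. It changes by one along the edge from \<open>b\<close> to \<open>a\<close>, so its gradient has norm at least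
  \<open>1 / norm (a - b)\<close>; on a ball of radius \<open>r\<close> it varies by \<open>2 * r\<close> times that norm.\<close>

lemma ball_in_simplex_radius_le:
  fixes S :: "'a::euclidean_space set"
  assumes ind: "\<not> affine_dependent S" and ab: "a \<in> S" "b \<in> S" "a \<noteq> b"
    and ball: "ball x r \<subseteq> convex hull S"
  shows "2 * r \<le> norm (a - b)"
proof (cases "r > 0")
  case False
  then show ?thesis using norm_ge_zero[of "a - b"] by linarith
next
  case True
  have indep: "independent ((\<lambda>s. s - b) ` (S - {b}))"
    using ind ab affine_dependent_iff_dependent2[of b S] by (simp add: image_def insert_absorb) 
  define k where "k = (\<lambda>v. if v = a - b then 1 else (0::real))"
  obtain f where f: "linear f" "\<forall>v\<in>(\<lambda>s. s - b) ` (S - {b}). f v = k v"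
    using linear_independent_extend[OF indep, of k] by blast
  define u where "u = adjoint f 1"
  have fu: "f v = v \<bullet> u" for v
    using adjoint_works[OF f(1), of v 1] by (simp add: u_def)
  have fs: "f (s - b) = (if s = a then 1 else 0)" if "s \<in> S" for s
  proof (cases "s = b")
    case True then show ?thesis using ab linear_0[OF f(1)] by simp
  next
    case False then show ?thesis using f(2) that by (simp add: k_def)
  qed
  \<comment> \<open>The coordinate is within \<open>[0,1]\<close> at the vertices, and the slab is convex.\<close>
  have hull: "convex hull S \<subseteq> {v. 0 \<le> f (v - b) \<and> f (v - b) \<le> 1}"
  proof (rule hull_minimal)
    show "S \<subseteq> {v. 0 \<le> f (v - b) \<and> f (v - b) \<le> 1}" using fs by auto
    have "{v. 0 \<le> f (v - b) \<and> f (v - b) \<le> 1} = {v. u \<bullet> v \<ge> u \<bullet> b} \<inter> {v. u \<bullet> v \<le> 1 + u \<bullet> b}"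
      unfolding fu by (auto simp: inner_diff_left inner_diff_right inner_commute)
    then show "convex {v. 0 \<le> f (v - b) \<and> f (v - b) \<le> 1}"
      by (simp add: convex_halfspace_le convex_halfspace_ge convex_Int)
  qed
  have one: "(a - b) \<bullet> u = 1" using fs[OF ab(1)] fu by simp
  then have u0: "u \<noteq> 0" by auto
  have le: "2 * r * norm u \<le> 1"
  proof (rule field_le_epsilon)
    fix e :: real assume e: "e > 0"
    \<comment> \<open>The ball is open, so the extreme points are approached only up to the error \<open>e\<close>.\<close>
    define t where "t = max 0 (r - e / (2 * norm u))"
    have t: "0 \<le> t" "t < r" using True u0 e by (auto simp: t_def)
    define w where "w = (t / norm u) *\<^sub>R u"
    have nw: "norm w = t" using t u0 by (simp add: w_def)
    have "x + w \<in> ball x r" "x - w \<in> ball x r" using nw t by (auto simp: dist_norm)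
    then have "x + w \<in> convex hull S" "x - w \<in> convex hull S" using ball by blast+
    then have "f (x + w - b) \<le> 1" "0 \<le> f (x - w - b)" using hull by auto
    then have "2 * (w \<bullet> u) \<le> 1" unfolding fu by (simp add: inner_diff_left inner_add_left)
    moreover have "w \<bullet> u = t * norm u"
      using u0 by (simp add: w_def dot_square_norm power2_eq_square)
    ultimately have "2 * (t * norm u) \<le> 1" by simp
    moreover have "r * norm u \<le> t * norm u + e / 2"
    proof -
      have "r - e / (2 * norm u) \<le> t" by (simp add: t_def)
      then have "(r - e / (2 * norm u)) * norm u \<le> t * norm u" by (intro mult_right_mono) auto
      then show ?thesis using u0 by (simp add: algebra_simps)
    qed
    ultimately show "2 * r * norm u \<le> 1 + e" by simp
  qed
  have "1 \<le> norm (a - b) * norm u" using one norm_cauchy_schwarz[of "a - b" u] by simp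
  then have "2 * r * norm u \<le> norm (a - b) * norm u" using le by linarith
  then show ?thesis using u0 by simp
qed

lemma simplex_interior_nonempty:
  fixes T :: "'a::euclidean_space set"
  assumes "int DIM('a) simplex T"
  shows "interior T \<noteq> {}"
  using assms interior_rel_interior_gen rel_interior_eq_empty
  by (metis aff_dim_simplex convex_simplex of_nat_0_le_iff aff_dim_empty 
     add.commute neg_0_le_iff_le not_one_le_zero)

lemma closure_interior_simplex:
  fixes T :: "'a::euclidean_space set"
  assumes "int DIM('a) simplex T"
  shows "closure (interior T) = T"
  using convex_closure_interior[OF convex_simplex[OF assms] simplex_interior_nonempty[OF assms]]
    closed_simplex[OF assms] by (simp add: closure_closed)

lemma inball_diameter_bdd:
  fixes T :: "'a::euclidean_space set"
  assumes "bounded T"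
  shows "bdd_above {diameter (ball x r) | x r. ball x r \<subseteq> T}"
  using assms diameter_subset by (intro bdd_aboveI[of _ "diameter T"]) blast

lemma inball_diameter_pos:
  fixes T :: "'a::euclidean_space set"
  assumes "bounded T" "interior T \<noteq> {}"
  shows "inball_diameter T > 0"
proof -
  obtain x r where r: "r > 0" "ball x r \<subseteq> T" using assms(2) by (metis all_not_in_conv mem_interior)
  have "2 * r \<le> inball_diameter T" unfolding inball_diameter_def
    using r by (intro cSup_upper inball_diameter_bdd assms) (auto intro!: exI[of _ x] exI[of _ r])
  then show ?thesis using r by simp
qed

text \<open>Some ball exceeds half of the supremum that defines the inscribed diameter; hence the factor \<open>4\<close>
  in place of the optimal \<open>2\<close>.\<close>

lemma chunky_simplex_contains_ball:
  fixes T :: "'a::euclidean_space set"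
  assumes "bounded T" "interior T \<noteq> {}" "diameter T / inball_diameter T \<le> w"
  obtains x r where "0 < r" "ball x r \<subseteq> T" "diameter T \<le> 4 * w * r"
proof -
  let ?D = "inball_diameter T"
  have D: "?D > 0" using inball_diameter_pos assms by blast
  then have "?D / 2 < Sup {diameter (ball x r) | x r. ball x r \<subseteq> T}"
    unfolding inball_diameter_def[symmetric] by simp
  then obtain x r where xr: "ball x r \<subseteq> T" "?D / 2 < diameter (ball x r)"
    using less_cSupE[of "?D/2" "{diameter (ball x r) | x r. ball x r \<subseteq> T}"]
    by (smt (verit, best) ball_empty empty_subsetI mem_Collect_eq empty_iff)
  then have r: "r > 0" "?D / 2 < 2 * r" using D by (auto split: if_splits)
  have w: "0 \<le> w" using assms D diameter_ge_0[OF assms(1)] by (meson divide_nonneg_pos order_trans)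
  have "diameter T \<le> w * ?D" using assms(3) D by (simp add: field_simps)
  also have "\<dots> \<le> w * (4 * r)" using r w by (intro mult_left_mono) auto
  finally show ?thesis using that r xr by (simp add: mult_ac)
qed

lemma inball_diameter_le_edge:
  fixes S :: "'a::euclidean_space set"
  assumes ind: "\<not> affine_dependent S" and ab: "a \<in> S" "b \<in> S" "a \<noteq> b"
  shows "inball_diameter (convex hull S) \<le> norm (a - b)"
  unfolding inball_diameter_def
proof (rule cSup_least)
  show "{diameter (ball x r) |x r. ball x r \<subseteq> convex hull S} \<noteq> {}"
    using ball_empty[of 0 "0 :: 'a"] by (auto intro!: exI[of _ "0 :: 'a"] exI[of _ "0 :: real"])
  show "y \<le> norm (a - b)" if "y \<in> {diameter (ball x r) |x r. ball x r \<subseteq> convex hull S}" for y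
    using that ball_in_simplex_radius_le[OF assms] by (auto split: if_splits)
qed

text \<open>A face with two distinct points contains an edge, and the length of that edge lies between the
  inscribed diameter of the first simplex and the diameter of the second.\<close>

lemma diameter_le_of_common_face:
  fixes T1 T2 :: "'a::euclidean_space set"
  assumes T1: "int DIM('a) simplex T1" and T2: "bounded T2"
    and face: "(T1 \<inter> T2) face_of T1" and xy: "x \<in> T1 \<inter> T2" "y \<in> T1 \<inter> T2" "x \<noteq> y"
    and w: "diameter T1 / inball_diameter T1 \<le> w"
  shows "diameter T1 \<le> w * diameter T2"
proof -
  obtain S where S: "\<not> affine_dependent S" "T1 = convex hull S"
    using T1 by (auto simp: simplex_def)
  obtain c where c: "c \<subseteq> S" "T1 \<inter> T2 = convex hull c"
    using face face_of_convex_hull_affine_independent[OF S(1)] S(2) by auto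
  have "\<exists>a b. a \<in> c \<and> b \<in> c \<and> a \<noteq> b"
  proof (rule ccontr)
    assume "\<not> ?thesis"
    then have "c = {} \<or> (\<exists>a. c = {a})" by blast
    then show False using xy unfolding c(2) by auto
  qed
  then obtain a b where ab: "a \<in> c" "b \<in> c" "a \<noteq> b" by blast
  have "a \<in> T2" "b \<in> T2" using ab hull_inc[of _ c convex] c by auto
  then have d: "norm (a - b) \<le> diameter T2" using diameter_bounded_bound[OF T2] by (simp add: dist_norm)
  have bd: "bounded T1" using compact_imp_bounded compact_simplex T1 by blast
  have pos: "inball_diameter T1 > 0"
    using inball_diameter_pos[OF bd] simplex_interior_nonempty T1 by blast
  have i: "inball_diameter T1 \<le> diameter T2"
    using inball_diameter_le_edge[OF S(1), of a b] ab c S d by force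
  have w0: "0 \<le> w" using w pos diameter_ge_0[OF bd] by (meson divide_nonneg_pos order_trans)
  have "diameter T1 \<le> w * inball_diameter T1" using w pos by (simp add: field_simps)
  also have "\<dots> \<le> w * diameter T2" using i w0 by (rule mult_left_mono)
  finally show ?thesis .
qed

text \<open>Two distinct simplices cannot both coincide with their common face, which therefore has lower
  dimension.\<close>

lemma negligible_Int_simplices:
  fixes T1 T2 :: "'a::euclidean_space set"
  assumes T1: "int DIM('a) simplex T1" and T2: "int DIM('a) simplex T2" and "T1 \<noteq> T2"
    and "(T1 \<inter> T2) face_of T1" "(T1 \<inter> T2) face_of T2"
  shows "negligible (T1 \<inter> T2)"
proof -
  have "T1 \<inter> T2 \<noteq> T1 \<or> T1 \<inter> T2 \<noteq> T2" using assms by blast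
  then have "aff_dim (T1 \<inter> T2) < int DIM('a)"
    using face_of_aff_dim_lt[OF convex_simplex[OF T1] assms(4)]
      face_of_aff_dim_lt[OF convex_simplex[OF T2] assms(5)] aff_dim_simplex[OF T1] aff_dim_simplex[OF T2]
    by auto
  then have "interior (T1 \<inter> T2) = {}" using low_dim_interior[of "T1 \<inter> T2"] by simp
  then show ?thesis
    using negligible_convex_interior[of "T1 \<inter> T2"] convex_simplex[OF T1] convex_simplex[OF T2] convex_Int by blast
qed

section \<open>Disjoint balls in convex sets\<close>

text \<open>Dilation about a common point \<open>v\<close> brings the balls inscribed in several elements at \<open>v\<close> to the
  same size, however different the diameters of these elements may be.\<close>

lemma ball_dilation_subset:
  fixes T :: "'a::euclidean_space set"
  assumes T: "convex T" "bounded T" "v \<in> T" and x: "ball x r \<subseteq> T" and t: "0 < t" "t \<le> 1"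
  shows "ball (v + t *\<^sub>R (x - v)) (t * r) \<subseteq> T \<inter> cball v (t * diameter T)"
proof
  fix y assume y: "y \<in> ball (v + t *\<^sub>R (x - v)) (t * r)"
  define y' where "y' = v + (1 / t) *\<^sub>R (y - v)"
  have yy: "y = (1 - t) *\<^sub>R v + t *\<^sub>R y'"
    using t by (simp add: y'_def algebra_simps)
  have "x - y' = (1 / t) *\<^sub>R (v + t *\<^sub>R (x - v) - y)"
    using t by (simp add: y'_def algebra_simps)
  then have "dist x y' = dist (v + t *\<^sub>R (x - v)) y / t"
    using t by (simp add: dist_norm)
  then have "dist x y' < r" using y t by (simp add: divide_less_eq mult.commute)
  then have y'T: "y' \<in> T" using x by auto
  have "y \<in> T" unfolding yy using T(1,3) y'T t by (intro convexD) auto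
  moreover have "v - y = t *\<^sub>R (v - y')" unfolding yy by (simp add: algebra_simps)
  then have "dist v y = t * dist v y'" using t by (simp add: dist_norm)
  moreover have "dist v y' \<le> diameter T" using T y'T diameter_bounded_bound by blast
  ultimately show "y \<in> T \<inter> cball v (t * diameter T)" using t by simp
qed

text \<open>Balls of equal radius inside sets that overlap in null sets are disjoint, so their total volume is
  at most that of the ball containing them all.\<close>

lemma card_disjoint_balls_le:
  fixes \<S> :: "'a::euclidean_space set set"
  assumes fin: "finite \<S>"
    and null: "\<And>S T. S \<in> \<S> \<Longrightarrow> T \<in> \<S> \<Longrightarrow> S \<noteq> T \<Longrightarrow> negligible (S \<inter> T)"
    and rho: "0 < \<rho>" "0 \<le> R"
    and ball: "\<And>T. T \<in> \<S> \<Longrightarrow> \<exists>c. ball c \<rho> \<subseteq> T \<inter> ball v R"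
  shows "real (card \<S>) \<le> (R / \<rho>) ^ DIM('a)"
proof -
  obtain c where c: "\<And>T. T \<in> \<S> \<Longrightarrow> ball (c T) \<rho> \<subseteq> T \<inter> ball v R"
    using ball by metis
  have disj: "disjoint_family_on (\<lambda>T. ball (c T) \<rho>) \<S>"
    unfolding disjoint_family_on_def
  proof (intro ballI impI)
    fix S T assume ST: "S \<in> \<S>" "T \<in> \<S>" "S \<noteq> T"
    have "negligible (ball (c S) \<rho> \<inter> ball (c T) \<rho>)"
      using null[OF ST] c[OF ST(1)] c[OF ST(2)] by (auto intro: negligible_subset[of "S \<inter> T"])
    then show "ball (c S) \<rho> \<inter> ball (c T) \<rho> = {}"
      using open_not_negligible[of "ball (c S) \<rho> \<inter> ball (c T) \<rho>"] by blast
  qed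
  have vol: "measure lborel (ball (a :: 'a) s) = unit_ball_vol (real DIM('a)) * s ^ DIM('a)" if "0 \<le> s" for a s
    using content_ball[OF that, of a] by simp
  have "measure lborel (\<Union>T\<in>\<S>. ball (c T) \<rho>) = (\<Sum>T\<in>\<S>. measure lborel (ball (c T) \<rho>))"
    using fin disj by (intro measure_finite_Union) (auto dest: arg_cong[of _ _ "\<lambda>x. x < top"] simp: emeasure_lborel_ball_finite[unfolded infinity_ennreal_def])
  also have "\<dots> = card \<S> * (unit_ball_vol (real DIM('a)) * \<rho> ^ DIM('a))"
    using rho by (simp add: vol)
  finally have "card \<S> * (unit_ball_vol (real DIM('a)) * \<rho> ^ DIM('a)) = measure lborel (\<Union>T\<in>\<S>. ball (c T) \<rho>)" ..
  also have "measure lborel (\<Union>T\<in>\<S>. ball (c T) \<rho>) \<le> measure lborel (ball v R)"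
  proof (rule measure_mono_fmeasurable)
    show "(\<Union>T\<in>\<S>. ball (c T) \<rho>) \<subseteq> ball v R" using c by blast
    show "ball v R \<in> fmeasurable lborel"
      using emeasure_lborel_ball_finite[of v R] by (intro fmeasurableI) auto
    show "(\<Union>T\<in>\<S>. ball (c T) \<rho>) \<in> sets lborel" by (auto intro!: borel_open open_UN)
  qed
  finally have "card \<S> * (unit_ball_vol (real DIM('a)) * \<rho> ^ DIM('a)) \<le> measure lborel (ball v R)" .
  then have "unit_ball_vol (real DIM('a)) * (card \<S> * \<rho> ^ DIM('a)) \<le> unit_ball_vol (real DIM('a)) * R ^ DIM('a)"
    using rho by (simp add: vol mult_ac)
  moreover have "unit_ball_vol (real DIM('a)) > 0" by simp
  ultimately have "card \<S> * \<rho> ^ DIM('a) \<le> R ^ DIM('a)" by (simp only: mult_le_cancel_left_pos)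
  then show ?thesis using rho by (simp add: power_divide field_simps)
qed

section \<open>Lipschitz domains near a point\<close>

text \<open>The shear that subtracts the graph function from the vertical component maps the epigraph to a half
  space. A small ball about the image of \<open>x\<close> meets that half space in a convex set \<open>K\<close>, and \<open>F\<close> is the inverse
  shear.\<close>

lemma lipschitz_graph_chart:
  fixes e x :: "'a::euclidean_space"
  assumes e: "norm e = 1" and lip: "L-lipschitz_on {y. y \<bullet> e = 0} \<phi>" and U: "open U" "x \<in> U"
    and Om: "\<Omega> \<inter> U = {y\<in>U. \<phi> (y - (y \<bullet> e) *\<^sub>R e) < y \<bullet> e}" and eps: "0 < \<epsilon>"
  shows "\<exists>V (K :: 'a set) F. open V \<and> x \<in> V \<and> V \<subseteq> ball x \<epsilon> \<and> convex K \<and> continuous_on K F \<and> \<Omega> \<inter> V = F ` K"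
proof -
  define hor where "hor = (\<lambda>y. y - (y \<bullet> e) *\<^sub>R e)"
  define F where "F = (\<lambda>w. w + \<phi> (hor w) *\<^sub>R e)"
  define G where "G = (\<lambda>y. y - \<phi> (hor y) *\<^sub>R e)"
  have ee: "e \<bullet> e = 1" using e by (simp add: dot_square_norm)
  have hor0: "hor y \<bullet> e = 0" for y by (simp add: hor_def inner_diff_left ee)
  have horadd: "hor (y + t *\<^sub>R e) = hor y" "hor (y - t *\<^sub>R e) = hor y" for y t
    by (simp_all add: hor_def inner_add_left inner_diff_left ee algebra_simps)
  have FG: "F (G y) = y" "G (F y) = y" for y by (simp_all add: F_def G_def horadd)
  have "continuous_on {y. y \<bullet> e = 0} \<phi>" using lip by (rule lipschitz_on_continuous_on)
  then have "continuous_on UNIV (\<lambda>y. \<phi> (hor y))"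
    by (rule continuous_on_compose2) (auto simp: hor0, auto simp: hor_def intro!: continuous_intros)
  then have contF: "continuous_on UNIV F" and contG: "continuous_on UNIV G"
    unfolding F_def G_def by (auto intro!: continuous_intros)
  have "open (F -` (U \<inter> ball x \<epsilon>))" using contF U by (simp add: open_vimage open_Int)
  moreover have "G x \<in> F -` (U \<inter> ball x \<epsilon>)" using U eps by (simp add: FG)
  ultimately obtain r where r: "r > 0" "ball (G x) r \<subseteq> F -` (U \<inter> ball x \<epsilon>)"
    by (meson open_contains_ball)
  define V where "V = G -` ball (G x) r"
  have VF: "V = F ` ball (G x) r"
  proof
    show "V \<subseteq> F ` ball (G x) r"
    proof
      fix y assume "y \<in> V"
      then show "y \<in> F ` ball (G x) r" using FG(1)[of y] by (intro image_eqI[of _ _ "G y"]) (auto simp: V_def)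
    qed
    show "F ` ball (G x) r \<subseteq> V" by (auto simp: V_def FG(2))
  qed
  have V: "open V" "x \<in> V" "V \<subseteq> U \<inter> ball x \<epsilon>"
    using r VF open_vimage[OF open_ball contG, of "G x" r] by (auto simp: V_def[symmetric]) (auto simp: V_def)
  have ypos: "\<phi> (hor y) < y \<bullet> e \<longleftrightarrow> 0 < G y \<bullet> e" for y by (simp add: G_def inner_diff_left ee)
  have "\<Omega> \<inter> V = F ` (ball (G x) r \<inter> {w. 0 < e \<bullet> w})"
  proof safe
    fix y assume y: "y \<in> \<Omega>" "y \<in> V"
    then have "y \<in> \<Omega> \<inter> U" using V by blast
    then have "0 < G y \<bullet> e" unfolding Om ypos[symmetric] hor_def by simp
    then show "y \<in> F ` (ball (G x) r \<inter> {w. 0 < e \<bullet> w})"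
      using y FG(1)[of y] by (auto simp: V_def inner_commute intro!: image_eqI[of _ _ "G y"])
  next
    fix w assume w: "w \<in> ball (G x) r" "0 < e \<bullet> w"
    then have wV: "F w \<in> V" using VF by blast
    then have "F w \<in> U" using V by blast
    moreover have "0 < G (F w) \<bullet> e" using w by (simp add: FG inner_commute)
    ultimately have "F w \<in> \<Omega> \<inter> U" unfolding Om using ypos[of "F w"] by (simp add: hor_def)
    then show "F w \<in> \<Omega>" "F w \<in> V" using wV by auto
  qed
  moreover have "convex (ball (G x) r \<inter> {w. 0 < e \<bullet> w})"
    using convex_Int convex_ball convex_halfspace_gt by blast
  moreover have "continuous_on (ball (G x) r \<inter> {w. 0 < e \<bullet> w}) F"
    using contF by (rule continuous_on_subset) simp
  ultimately show ?thesis
    using V by (intro exI[of _ V] exI[of _ "ball (G x) r \<inter> {w. 0 < e \<bullet> w}"] exI[of _ F]) simp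
qed

text \<open>At a boundary point the removal of \<open>v\<close> has no effect, and the graph chart gives connectedness. At an
  interior point the domain is a ball nearby, whose punctured version is connected in dimension two or more.\<close>

lemma lipschitz_domain_connected_near:
  fixes \<Omega> :: "'a::euclidean_space set"
  assumes Om: "lipschitz_domain \<Omega>" and v: "v \<in> closure \<Omega>" and dim: "2 \<le> DIM('a)" and eps: "0 < \<epsilon>"
  obtains V where "open V" "v \<in> V" "V \<subseteq> ball v \<epsilon>" "connected (\<Omega> \<inter> V - {v})"
proof (cases "v \<in> \<Omega>")
  case True
  then obtain r where r: "r > 0" "ball v r \<subseteq> \<Omega>" using Om by (meson lipschitz_domain_def open_contains_ball)
  define V where "V = ball v (min r \<epsilon>)"
  have "aff_dim V = int DIM('a)" using r eps by (simp add: V_def aff_dim_open)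
  then have "connected (V - {v})" using dim by (intro connected_punctured_convex) (auto simp: V_def)
  moreover have "\<Omega> \<inter> V = V" using r by (auto simp: V_def)
  ultimately show ?thesis using r eps by (intro that[of V]) (auto simp: V_def)
next
  case False
  then have "v \<in> frontier \<Omega>" using v interior_subset by (auto simp: frontier_def)
  then obtain U e \<phi> L where "open U" "v \<in> U" "norm e = 1" "L-lipschitz_on {y. y \<bullet> e = 0} \<phi>"
    "\<Omega> \<inter> U = {y\<in>U. \<phi> (y - (y \<bullet> e) *\<^sub>R e) < y \<bullet> e}"
    using Om unfolding lipschitz_domain_def by meson
  from lipschitz_graph_chart[OF this(3,4,1,2,5) eps]
  obtain V and K :: "'a set" and F where V: "open V" "v \<in> V" "V \<subseteq> ball v \<epsilon>"
    and KF: "convex K" "continuous_on K F" "\<Omega> \<inter> V = F ` K" by blast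
  have "\<Omega> \<inter> V - {v} = F ` K" unfolding KF(3)[symmetric] using False by auto
  moreover have "connected (F ` K)" by (rule connected_continuous_image[OF KF(2) convex_connected]) (rule KF(1))
  ultimately have "connected (\<Omega> \<inter> V - {v})" by simp
  then show ?thesis by (rule that[OF V])
qed

text \<open>Near a boundary point there are points strictly below the graph, which have a neighbourhood free of
  points of the domain. For a mesh this means that the interior of each element lies in the domain, so that
  elements leave the domain only in a null set.\<close>

lemma lipschitz_domain_regular_open:
  fixes \<Omega> :: "'a::euclidean_space set"
  assumes Om: "lipschitz_domain \<Omega>"
  shows "interior (closure \<Omega>) = \<Omega>"
proof
  have op: "open \<Omega>" using Om by (simp add: lipschitz_domain_def)
  then show "\<Omega> \<subseteq> interior (closure \<Omega>)" by (simp add: closure_subset interior_maximal)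
  show "interior (closure \<Omega>) \<subseteq> \<Omega>"
  proof (rule ccontr)
    assume "\<not> ?thesis"
    then obtain x where x: "x \<in> interior (closure \<Omega>)" "x \<notin> \<Omega>" by blast
    then have "x \<in> frontier \<Omega>" using interior_subset op by (auto simp: frontier_def interior_open)
    then obtain U e \<phi> L where U: "open U" "x \<in> U" and e: "norm e = 1"
      and lip: "L-lipschitz_on {y. y \<bullet> e = 0} \<phi>"
      and Om': "\<Omega> \<inter> U = {y\<in>U. \<phi> (y - (y \<bullet> e) *\<^sub>R e) < y \<bullet> e}"
      using Om unfolding lipschitz_domain_def by meson
    define hor where "hor = (\<lambda>y. y - (y \<bullet> e) *\<^sub>R e)"
    have ee: "e \<bullet> e = 1" using e by (simp add: dot_square_norm)
    have hor0: "hor y \<bullet> e = 0" for y by (simp add: hor_def inner_diff_left ee)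
    have "continuous_on {y. y \<bullet> e = 0} \<phi>" using lip by (rule lipschitz_on_continuous_on)
    then have cont: "continuous_on UNIV (\<lambda>y. \<phi> (hor y))"
      by (rule continuous_on_compose2) (auto simp: hor0, auto simp: hor_def intro!: continuous_intros)
    have xge: "x \<bullet> e \<le> \<phi> (hor x)" 
    proof -
      have "x \<notin> \<Omega> \<inter> U" using x by blast
      then show ?thesis unfolding Om' using U by (simp add: hor_def not_less)
    qed
    obtain r where r: "r > 0" "ball x r \<subseteq> U \<inter> interior (closure \<Omega>)"
      using open_contains_ball_eq[OF open_Int[OF U(1) open_interior[of "closure \<Omega>"]], of x] U x by auto
    \<comment> \<open>A step downwards from the boundary point leads strictly below the graph.\<close>
    define y where "y = x - (r / 2) *\<^sub>R e"
    have y: "y \<in> U" "y \<in> closure \<Omega>"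
    proof -
      have "y \<in> ball x r" using r e by (simp add: y_def dist_norm)
      then show "y \<in> U" "y \<in> closure \<Omega>" using r interior_subset by blast+
    qed
    have "hor y = hor x" by (simp add: y_def hor_def inner_diff_left ee algebra_simps)
    then have yW: "y \<in> U \<inter> {y. y \<bullet> e < \<phi> (hor y)}"
      using y xge r by (simp add: y_def inner_diff_left ee)
    have "open (U \<inter> {y. y \<bullet> e < \<phi> (hor y)})"
      by (intro open_Int U open_Collect_less[OF _ cont]) (intro continuous_intros)
    then obtain z where "z \<in> \<Omega>" "z \<in> U \<inter> {y. y \<bullet> e < \<phi> (hor y)}"
      using y(2) yW by (auto simp: closure_iff_nhds_not_empty)
    then have "z \<in> \<Omega> \<inter> U" "z \<bullet> e < \<phi> (hor z)" by auto
    then show False unfolding Om' by (simp add: hor_def)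
  qed
qed

section \<open>Shape-regular meshes\<close>

text \<open>One mesh of the family. The bound \<open>w\<close> is any number that dominates both the chunkiness and \<open>1\<close>; all
  geometric constants below are functions of \<open>w\<close> and the dimension.\<close>

locale shape_regular_mesh =
  fixes \<Omega> :: "'a::euclidean_space set" and \<T> :: "'a set set" and w :: real
  assumes domain: "lipschitz_domain \<Omega>" and dim: "2 \<le> DIM('a)"
    and triang: "conforming_triangulation \<Omega> \<T>"
    and chunky: "\<And>T. T \<in> \<T> \<Longrightarrow> diameter T / inball_diameter T \<le> w"
    and w_ge_1: "1 \<le> w"
begin

lemma finite_mesh: "finite \<T>"
  and element_simplex: "T \<in> \<T> \<Longrightarrow> int DIM('a) simplex T"
  and element_face: "T \<in> \<T> \<Longrightarrow> T' \<in> \<T> \<Longrightarrow> (T \<inter> T') face_of T \<and> (T \<inter> T') face_of T'"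
  and Union_mesh: "\<Union>\<T> = closure \<Omega>"
  using triang Int_commute[of T T'] unfolding conforming_triangulation_def triangulation_def by metis+

lemma element_compact: "T \<in> \<T> \<Longrightarrow> compact T"
  and element_closed: "T \<in> \<T> \<Longrightarrow> closed T"
  and element_bounded: "T \<in> \<T> \<Longrightarrow> bounded T"
  and element_convex: "T \<in> \<T> \<Longrightarrow> convex T"
  and element_interior: "T \<in> \<T> \<Longrightarrow> interior T \<noteq> {}"
  and element_closure_interior: "T \<in> \<T> \<Longrightarrow> closure (interior T) = T"
  using element_simplex compact_simplex closed_simplex compact_imp_bounded convex_simplex
    simplex_interior_nonempty closure_interior_simplex by metis+

lemma element_nonempty: "T \<in> \<T> \<Longrightarrow> T \<noteq> {}"
  using element_interior by force

lemma element_contains_ball: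
  assumes "T \<in> \<T>"
  obtains x r where "0 < r" "ball x r \<subseteq> T" "diameter T \<le> 4 * w * r"
  using chunky_simplex_contains_ball element_bounded element_interior chunky assms by metis

lemma element_diameter_pos:
  assumes "T \<in> \<T>" shows "0 < diameter T"
proof -
  obtain x r where r: "0 < r" "ball x r \<subseteq> T" using element_contains_ball[OF assms] by metis
  then have "2 * r \<le> diameter T"
    using diameter_subset[OF r(2) element_bounded[OF assms]] by simp
  then show ?thesis using r by simp
qed

lemma interior_element_subset:
  assumes "T \<in> \<T>" shows "interior T \<subseteq> \<Omega>"
  using interior_mono[of T "closure \<Omega>"] assms Union_mesh lipschitz_domain_regular_open[OF domain] by auto

lemma negligible_element_diff:
  assumes "T \<in> \<T>" shows "negligible (T - \<Omega>)"
proof (rule negligible_subset)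
  show "negligible (frontier T)" using negligible_convex_frontier element_convex assms by blast
  show "T - \<Omega> \<subseteq> frontier T"
    using interior_element_subset[OF assms] closure_subset[of T] by (auto simp: frontier_def)
qed

lemma negligible_Int_elements:
  assumes "S \<in> \<T>" "T \<in> \<T>" "S \<noteq> T" shows "negligible (S \<inter> T)"
  using negligible_Int_simplices element_simplex element_face assms by blast

text \<open>Each element at \<open>v\<close>, shrunk towards \<open>v\<close> to the smallest of the occurring diameters \<open>R\<close>, still contains a
  ball of radius \<open>R / (4 * w)\<close>; these balls are disjoint and lie within distance \<open>R\<close> of \<open>v\<close>.\<close>

lemma card_elements_at_point_le:
  "real (card {T \<in> \<T>. v \<in> T}) \<le> (8 * w) ^ DIM('a)"
proof (cases "{T \<in> \<T>. v \<in> T} = {}")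
  case True then show ?thesis using w_ge_1 by (simp only: card.empty) simp
next
  case False
  let ?S = "{T \<in> \<T>. v \<in> T}"
  define R where "R = Min (diameter ` ?S)"
  have fin: "finite ?S" using finite_mesh by simp
  have R: "R \<le> diameter T" if "T \<in> ?S" for T using that fin by (simp add: R_def)
  have "R \<in> diameter ` ?S" unfolding R_def using fin False by (intro Min_in) auto
  then have R0: "R > 0" using element_diameter_pos by auto
  have "real (card ?S) \<le> (2 * R / (R / (4 * w))) ^ DIM('a)"
  proof (rule card_disjoint_balls_le[OF fin])
    show "negligible (S \<inter> T)" if "S \<in> ?S" "T \<in> ?S" "S \<noteq> T" for S T
      using that negligible_Int_elements by blast
    show "0 < R / (4 * w)" "0 \<le> 2 * R" using R0 w_ge_1 by auto
    fix T assume T: "T \<in> ?S"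
    obtain x r where xr: "0 < r" "ball x r \<subseteq> T" "diameter T \<le> 4 * w * r"
      using element_contains_ball T by blast
    define t where "t = R / diameter T"
    have d: "diameter T > 0" using T element_diameter_pos by blast
    have t: "0 < t" "t \<le> 1" using R0 R[OF T] d by (auto simp: t_def)
    have "t * diameter T \<le> t * (4 * w * r)" using xr t by (intro mult_left_mono) auto
    then have "R / (4 * w) \<le> t * r" using w_ge_1 d by (simp add: t_def field_simps)
    then have "ball (v + t *\<^sub>R (x - v)) (R / (4 * w)) \<subseteq> ball (v + t *\<^sub>R (x - v)) (t * r)"
      by (rule subset_ball)
    also have "\<dots> \<subseteq> T \<inter> cball v (t * diameter T)"
      using T xr t element_convex element_bounded by (intro ball_dilation_subset) auto
    also have "\<dots> \<subseteq> T \<inter> ball v (2 * R)" using d R0 by (auto simp: t_def)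
    finally show "\<exists>c. ball c (R / (4 * w)) \<subseteq> T \<inter> ball v (2 * R)" by blast
  qed
  also have "2 * R / (R / (4 * w)) = 8 * w" using R0 w_ge_1 by (simp add: field_simps)
  finally show ?thesis .
qed

text \<open>Close to \<open>v\<close>, the punctured domain is connected and is covered by the elements at \<open>v\<close>, each of
  which meets it. Hence the union of the elements in \<open>\<A>\<close> and the union of the others, both closed, have a common
  point besides \<open>v\<close>, and the two elements containing that point share an edge.\<close>

lemma elements_at_point_linked:
  assumes v: "v \<in> closure \<Omega>" and A: "\<A> \<subseteq> {T \<in> \<T>. v \<in> T}" "\<A> \<noteq> {}" "\<A> \<noteq> {T \<in> \<T>. v \<in> T}"
  obtains T1 T2 where "T1 \<in> \<A>" "T2 \<in> \<T>" "v \<in> T2" "T2 \<notin> \<A>" "diameter T2 \<le> w * diameter T1"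
proof -
  let ?S = "{T \<in> \<T>. v \<in> T}"
  have "closed (\<Union>{T \<in> \<T>. v \<notin> T})" using finite_mesh element_closed by (intro closed_Union) auto
  then have "open (- \<Union>{T \<in> \<T>. v \<notin> T})" by (rule open_Compl)
  \<comment> \<open>The elements avoiding \<open>v\<close> are finitely many closed sets, hence stay away from \<open>v\<close>.\<close>
  then obtain \<epsilon> where eps: "\<epsilon> > 0" "ball v \<epsilon> \<subseteq> - \<Union>{T \<in> \<T>. v \<notin> T}"
    using open_contains_ball_eq[of "- \<Union>{T \<in> \<T>. v \<notin> T}" v] by auto
  obtain V where V: "open V" "v \<in> V" "V \<subseteq> ball v \<epsilon>" and conn: "connected (\<Omega> \<inter> V - {v})"
    using lipschitz_domain_connected_near[OF domain v dim eps(1)] .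
  let ?X = "\<Omega> \<inter> V - {v}"
  have meets: "T \<inter> ?X \<noteq> {}" if T: "T \<in> ?S" for T
  proof -
    have "v \<in> closure (interior T)" using T element_closure_interior by simp
    then have "interior T \<inter> V \<noteq> {}" using V closure_iff_nhds_not_empty[of v "interior T"] by auto
    moreover have "open (interior T \<inter> V)" using V by auto
    ultimately have "interior T \<inter> V - {v} \<noteq> {}" using not_open_singleton[of v] by (metis Diff_eq_empty_iff subset_singleton_iff)
    then show ?thesis using interior_element_subset[of T] interior_subset[of T] T by blast
  qed
  have cover: "?X \<subseteq> \<Union>\<A> \<union> \<Union>(?S - \<A>)"
  proof
    fix x assume x: "x \<in> ?X"
    then have "x \<in> \<Union>\<T>" using Union_mesh closure_subset by blast
    moreover have "x \<notin> \<Union>{T \<in> \<T>. v \<notin> T}" using x V eps by blast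
    ultimately show "x \<in> \<Union>\<A> \<union> \<Union>(?S - \<A>)" by blast
  qed
  have c1: "closed (\<Union>\<A>)" "closed (\<Union>(?S - \<A>))"
    using finite_mesh element_closed A(1) by (auto intro!: closed_Union intro: finite_subset)
  have "\<Union>\<A> \<inter> ?X \<noteq> {}" "\<Union>(?S - \<A>) \<inter> ?X \<noteq> {}" using A meets by blast+
  then have "\<Union>\<A> \<inter> \<Union>(?S - \<A>) \<inter> ?X \<noteq> {}"
    using conn c1 cover unfolding connected_closed by blast
  then obtain y T1 T2 where y: "y \<in> T1" "y \<in> T2" "y \<noteq> v" and T: "T1 \<in> \<A>" "T2 \<in> ?S" "T2 \<notin> \<A>" by blast
  have T1: "T1 \<in> \<T>" "v \<in> T1" using T A by auto
  have "diameter T2 \<le> w * diameter T1"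
    using diameter_le_of_common_face[of T2 T1 v y w] T T1 y element_simplex element_bounded element_face chunky
    by blast
  then show ?thesis using that T by blast
qed

text \<open>The factor \<open>w\<close> for each step of a chain of elements around one point; the number of steps is bounded by
  the number of elements at that point.\<close>

definition patch_ratio :: real where
  "patch_ratio = w ^ nat \<lceil>(8 * w) ^ DIM('a)\<rceil>"

lemma patch_ratio_ge_1: "1 \<le> patch_ratio"
  using w_ge_1 by (simp add: patch_ratio_def)

text \<open>Let \<open>L k\<close> consist of the elements at the common point whose diameter is at most \<open>w ^ k\<close> times that of \<open>T\<close>.
  By the linking lemma these sets grow strictly until they comprise all elements at the point, which happens
  at the latest when \<open>k\<close> reaches their number.\<close>

lemma touching_diameter_le:
  assumes T: "T \<in> \<T>" "T' \<in> \<T>" "T \<inter> T' \<noteq> {}"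
  shows "diameter T' \<le> patch_ratio * diameter T"
proof -
  obtain v where v: "v \<in> T" "v \<in> T'" using T by blast
  let ?S = "{T \<in> \<T>. v \<in> T}"
  define L where "L = (\<lambda>k. {S \<in> ?S. diameter S \<le> w ^ k * diameter T})"
  have fin: "finite ?S" using finite_mesh by simp
  have vcl: "v \<in> closure \<Omega>" using v T Union_mesh by blast
  have d0: "0 \<le> diameter T" using diameter_ge_0 element_bounded T by blast
  have mono: "L k \<subseteq> L (Suc k)" for k
  proof -
    have "w ^ k * diameter T \<le> w ^ Suc k * diameter T"
      using w_ge_1 d0 by (intro mult_right_mono power_increasing) auto
    then show ?thesis by (auto simp: L_def)
  qed
  have grow: "L k = ?S \<or> k < card (L k)" for k
  proof (induction k)
    case 0
    have "T \<in> L 0" using T v by (simp add: L_def)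
    moreover have "finite (L 0)" using finite_mesh by (simp add: L_def)
    ultimately show ?case by (auto simp: card_gt_0_iff)
  next
    case (Suc k)
    have finL: "finite (L j)" for j using finite_mesh by (simp add: L_def)
    show ?case
    proof (cases "L k = ?S")
      case True then show ?thesis using mono[of k] by (auto simp: L_def)
    next
      case False
      have "L k \<noteq> {}" using Suc False by auto
      then obtain T1 T2 where T12: "T1 \<in> L k" "T2 \<in> \<T>" "v \<in> T2" "T2 \<notin> L k" "diameter T2 \<le> w * diameter T1"
        using elements_at_point_linked[OF vcl, of "L k"] False by (auto simp: L_def)
      have "w * diameter T1 \<le> w * (w ^ k * diameter T)"
        using T12(1) w_ge_1 by (intro mult_left_mono) (auto simp: L_def)
      then have "T2 \<in> L (Suc k)" using T12 by (auto simp: L_def)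
      then have "L k \<subset> L (Suc k)" using mono T12 by blast
      then have "card (L k) < card (L (Suc k))" using finL by (rule psubset_card_mono[rotated])
      then show ?thesis using Suc False by linarith
    qed
  qed
  define N where "N = nat \<lceil>(8 * w) ^ DIM('a)\<rceil>"
  have "card (L N) \<le> card ?S" using fin by (intro card_mono) (auto simp: L_def)
  also have "card ?S \<le> N"
    using card_elements_at_point_le[of v] unfolding N_def by linarith
  finally have "L N = ?S" using grow[of N] by linarith
  then have "T' \<in> L N" using v T by blast
  then show ?thesis by (simp add: L_def patch_ratio_def N_def)
qed

lemma patch_dist_le:
  assumes T: "T \<in> \<T>" and xy: "x \<in> patch \<T> T" "y \<in> patch \<T> T"
  shows "dist x y \<le> 3 * patch_ratio * diameter T"
proof -
  have near: "\<exists>u\<in>T. dist x u \<le> patch_ratio * diameter T" if x: "x \<in> patch \<T> T" for x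
  proof -
    obtain T' u where u: "T' \<in> \<T>" "x \<in> T'" "u \<in> T'" "u \<in> T" using x unfolding patch_def by blast
    then have "dist x u \<le> diameter T'" using diameter_bounded_bound element_bounded by blast
    also have "\<dots> \<le> patch_ratio * diameter T" using touching_diameter_le[OF T, of T'] u by blast
    finally show ?thesis using u by blast
  qed
  obtain u u' where u: "u \<in> T" "u' \<in> T" "dist x u \<le> patch_ratio * diameter T" "dist y u' \<le> patch_ratio * diameter T"
    using near xy by metis
  have "dist u u' \<le> diameter T" using u T diameter_bounded_bound element_bounded by blast
  also have "\<dots> \<le> patch_ratio * diameter T"
    using patch_ratio_ge_1 element_diameter_pos[OF T] by simp
  finally have "dist u u' \<le> patch_ratio * diameter T" .
  then show ?thesis using u dist_triangle[of x y u] dist_triangle[of u y u'] by (simp add: dist_commute)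
qed

lemma subset_patch: "T \<in> \<T> \<Longrightarrow> T \<subseteq> patch \<T> T"
  using element_nonempty by (auto simp: patch_def)

lemma compact_patch: "compact (patch \<T> T)"
  unfolding patch_def using finite_mesh element_compact by (intro compact_Union) auto

lemma negligible_patch_diff: "negligible (patch \<T> T - \<Omega>)"
proof -
  have "patch \<T> T - \<Omega> = (\<Union>T'\<in>{T'\<in>\<T>. T' \<inter> T \<noteq> {}}. T' - \<Omega>)" by (auto simp: patch_def)
  also have "negligible \<dots>" using finite_mesh negligible_element_diff by (intro negligible_Union) auto
  finally show ?thesis .
qed

text \<open>The elements touching \<open>T\<close> lie in one ball of radius comparable to the diameter of \<open>T\<close> and contain balls of
  comparable radius.\<close>

lemma card_patch_le:
  assumes T: "T \<in> \<T>"
  shows "real (card {T' \<in> \<T>. T' \<inter> T \<noteq> {}}) \<le> (16 * w * patch_ratio ^ 2) ^ DIM('a)"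
proof -
  let ?S = "{T' \<in> \<T>. T' \<inter> T \<noteq> {}}" and ?W = patch_ratio
  define \<rho> where "\<rho> = diameter T / (4 * w * ?W)"
  have d: "diameter T > 0" using T element_diameter_pos by blast
  have W: "1 \<le> ?W" by (rule patch_ratio_ge_1)
  obtain v where v: "v \<in> T" using element_nonempty T by blast
  have "real (card ?S) \<le> (4 * ?W * diameter T / \<rho>) ^ DIM('a)"
  proof (rule card_disjoint_balls_le)
    show "finite ?S" using finite_mesh by simp
    show "negligible (S \<inter> T)" if "S \<in> ?S" "T \<in> ?S" "S \<noteq> T" for S T
      using that negligible_Int_elements by blast
    show "0 < \<rho>" "0 \<le> 4 * ?W * diameter T" using d w_ge_1 W by (auto simp: \<rho>_def)
    fix T' assume T': "T' \<in> ?S"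
    obtain x r where xr: "0 < r" "ball x r \<subseteq> T'" "diameter T' \<le> 4 * w * r"
      using element_contains_ball T' by blast
    have "diameter T \<le> ?W * diameter T'" using touching_diameter_le[of T' T] T T' by blast
    also have "\<dots> \<le> ?W * (4 * w * r)" using xr W by (intro mult_left_mono) auto
    finally have "\<rho> \<le> r" using w_ge_1 W by (simp add: \<rho>_def field_simps)
    then have "ball x \<rho> \<subseteq> T'" using xr subset_ball by blast
    moreover have "T' \<subseteq> ball v (4 * ?W * diameter T)"
    proof
      fix y assume "y \<in> T'"
      then have "y \<in> patch \<T> T" "v \<in> patch \<T> T" using T' T v subset_patch by (auto simp: patch_def)
      then have "dist v y \<le> 3 * ?W * diameter T" using patch_dist_le T by blast
      moreover have "0 < ?W * diameter T" using d W by simp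
      ultimately show "y \<in> ball v (4 * ?W * diameter T)" unfolding mem_ball by linarith
    qed
    ultimately show "\<exists>c. ball c \<rho> \<subseteq> T' \<inter> ball v (4 * ?W * diameter T)" by blast
  qed
  also have "4 * ?W * diameter T / \<rho> = 16 * w * ?W ^ 2"
    using d w_ge_1 W by (simp add: \<rho>_def field_simps power2_eq_square)
  finally show ?thesis .
qed

lemma lmeasurable_element: "T \<in> \<T> \<Longrightarrow> T \<in> lmeasurable"
  using element_compact lmeasurable_compact by blast

lemma element_measure_ge:
  assumes T: "T \<in> \<T>"
  shows "measure lebesgue T \<ge> unit_ball_vol (real DIM('a)) * (diameter T / (4 * w)) ^ DIM('a)"
proof -
  obtain x r where xr: "0 < r" "ball x r \<subseteq> T" "diameter T \<le> 4 * w * r"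
    using element_contains_ball T by blast
  have "diameter T / (4 * w) \<le> r" using xr w_ge_1 by (simp add: field_simps)
  then have "(diameter T / (4 * w)) ^ DIM('a) \<le> r ^ DIM('a)"
    using w_ge_1 element_diameter_pos[OF T] by (intro power_mono) auto
  then have "unit_ball_vol (real DIM('a)) * (diameter T / (4 * w)) ^ DIM('a) \<le> unit_ball_vol (real DIM('a)) * r ^ DIM('a)"
    by (intro mult_left_mono) auto
  also have "\<dots> = measure lebesgue (ball x r)" using content_ball[of r x] xr by simp
  also have "\<dots> \<le> measure lebesgue T"
    using xr lmeasurable_element[OF T] by (intro measure_mono_fmeasurable) auto
  finally show ?thesis .
qed

lemma element_measure_pos: "T \<in> \<T> \<Longrightarrow> 0 < measure lebesgue T"
proof -
  assume T: "T \<in> \<T>"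
  have "0 < unit_ball_vol (real DIM('a)) * (diameter T / (4 * w)) ^ DIM('a)"
    using element_diameter_pos[OF T] w_ge_1 by (intro mult_pos_pos) auto
  then show "0 < measure lebesgue T" using element_measure_ge[OF T] by linarith
qed

lemma element_measure_le_patch: "T \<in> \<T> \<Longrightarrow> measure lebesgue T \<le> measure lebesgue (patch \<T> T)"
  using subset_patch lmeasurable_element lmeasurable_compact[OF compact_patch]
  by (intro measure_mono_fmeasurable) auto

end

section \<open>The inverse estimate for polynomials\<close>

text \<open>Absorbing one factor \<open>i\<close> into the binomial coefficient lowers both the power and \<open>n\<close> by one, at the price of
  a shift of \<open>i\<close> that the binomial theorem expands into lower powers.\<close>

lemma alternating_binomial_power_sum:
  assumes "k < n"
  shows "(\<Sum>i\<le>n. (-1) ^ i * real (n choose i) * real i ^ k) = 0"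
  using assms
proof (induction n arbitrary: k)
  case (Suc n)
  show ?case
  proof (cases k)
    case 0
    then show ?thesis using choose_alternating_sum[of "Suc n", where 'a = real] by simp
  next
    case (Suc j)
    have j: "j < n" using Suc Suc.prems by simp
    have "(\<Sum>i\<le>Suc n. (-1) ^ i * real (Suc n choose i) * real i ^ k)
        = (\<Sum>i\<le>n. (-1) ^ Suc i * real (Suc n choose Suc i) * real (Suc i) ^ Suc j)"
      unfolding Suc by (subst sum.atMost_Suc_shift) simp
    also have "\<dots> = (\<Sum>i\<le>n. \<Sum>m\<le>j. - real (Suc n) * real (j choose m) * ((-1) ^ i * real (n choose i) * real i ^ m))"
    proof (rule sum.cong[OF refl])
      fix i
      have a: "real (Suc n choose Suc i) * real (Suc i) = real (Suc n) * real (n choose i)"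
        using Suc_times_binomial[of i n] by (metis mult.commute of_nat_mult)
      have b: "real (Suc i) ^ j = (\<Sum>m\<le>j. real (j choose m) * real i ^ m)"
        using binomial_ring[of "real i" 1 j] by (simp add: add.commute)
      have "(-1) ^ Suc i * real (Suc n choose Suc i) * real (Suc i) ^ Suc j
          = - ((-1) ^ i * (real (Suc n choose Suc i) * real (Suc i)) * real (Suc i) ^ j)"
        by (simp add: mult_ac)
      also have "\<dots> = - ((-1) ^ i * (real (Suc n) * real (n choose i)) * (\<Sum>m\<le>j. real (j choose m) * real i ^ m))"
        unfolding a b ..
      also have "\<dots> = (\<Sum>m\<le>j. - real (Suc n) * real (j choose m) * ((-1) ^ i * real (n choose i) * real i ^ m))"
        by (simp del: of_nat_Suc add: sum_distrib_left sum_negf[symmetric] mult_ac)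
      finally show "(-1) ^ Suc i * real (Suc n choose Suc i) * real (Suc i) ^ Suc j = \<dots>" .
    qed
    also have "\<dots> = (\<Sum>m\<le>j. - real (Suc n) * real (j choose m) * (\<Sum>i\<le>n. (-1) ^ i * real (n choose i) * real i ^ m))"
      by (subst sum.swap) (simp add: sum_distrib_left)
    also have "\<dots> = 0" using Suc.IH j by (intro sum.neutral) auto
    finally show ?thesis .
  qed
qed simp

lemma finite_difference_poly_eq_0:
  fixes p :: "real poly"
  assumes "degree p < n"
  shows "(\<Sum>i\<le>n. (-1) ^ i * real (n choose i) * poly p (real i)) = 0"
proof -
  have "(\<Sum>i\<le>n. (-1) ^ i * real (n choose i) * poly p (real i))
      = (\<Sum>k\<le>degree p. coeff p k * (\<Sum>i\<le>n. (-1) ^ i * real (n choose i) * real i ^ k))"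
    unfolding poly_altdef sum_distrib_left by (subst sum.swap) (simp add: mult_ac)
  also have "\<dots> = 0" using assms alternating_binomial_power_sum by (intro sum.neutral) auto
  finally show ?thesis .
qed

lemma polynomial_on_line:
  fixes q :: "real ^ 'n \<Rightarrow> real"
  assumes "q \<in> polynomials_upto l"
  obtains p :: "real poly" where "degree p \<le> l" "\<And>t. poly p t = q (x + t *\<^sub>R v)"
proof -
  obtain c where c: "\<And>x. q x = (\<Sum>\<alpha> | sum \<alpha> UNIV \<le> l. c \<alpha> * (\<Prod>i\<in>UNIV. x $ i ^ \<alpha> i))"
    using assms unfolding polynomials_upto_def by blast
  \<comment> \<open>Each monomial restricted to the line is a product of powers of linear polynomials.\<close>
  define m where "m = (\<lambda>\<alpha> :: 'n \<Rightarrow> nat. \<Prod>i\<in>UNIV. [:x $ i, v $ i:] ^ \<alpha> i)"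
  define p where "p = (\<Sum>\<alpha> | sum \<alpha> UNIV \<le> l. smult (c \<alpha>) (m \<alpha>))"
  have deg1: "degree (smult (c \<alpha>) (m \<alpha>)) \<le> l" if \<alpha>: "sum \<alpha> UNIV \<le> l" for \<alpha>
  proof -
    have "degree (smult (c \<alpha>) (m \<alpha>)) \<le> degree (m \<alpha>)" by simp
    also have "\<dots> \<le> (\<Sum>i\<in>UNIV. degree ([:x $ i, v $ i:] ^ \<alpha> i))"
      unfolding m_def using degree_prod_sum_le[of UNIV "\<lambda>i. [:x $ i, v $ i:] ^ \<alpha> i"] by simp
    also have "\<dots> \<le> (\<Sum>i\<in>UNIV. \<alpha> i)"
    proof (rule sum_mono)
      fix i
      have "degree ([:x $ i, v $ i:] ^ \<alpha> i) \<le> degree [:x $ i, v $ i:] * \<alpha> i" by (rule degree_power_le)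
      also have "\<dots> \<le> 1 * \<alpha> i" by (intro mult_right_mono) auto
      finally show "degree ([:x $ i, v $ i:] ^ \<alpha> i) \<le> \<alpha> i" by simp
    qed
    finally show ?thesis using \<alpha> by simp
  qed
  have "degree p \<le> l"
  proof (cases "finite {\<alpha> :: 'n \<Rightarrow> nat. sum \<alpha> UNIV \<le> l}")
    case True then show ?thesis unfolding p_def using deg1 by (intro degree_sum_le) auto
  next
    case False then show ?thesis by (simp add: p_def)
  qed
  moreover have "poly p t = q (x + t *\<^sub>R v)" for t
    by (simp add: p_def c poly_sum m_def poly_prod)
  ultimately show ?thesis using that by blast
qed

lemma continuous_on_polynomials_upto:
  assumes "q \<in> polynomials_upto l"
  shows "continuous_on A q"
proof -
  obtain c where c: "\<And>x. q x = (\<Sum>\<alpha> | sum \<alpha> UNIV \<le> l. c \<alpha> * (\<Prod>i\<in>UNIV. x $ i ^ \<alpha> i))"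
    using assms unfolding polynomials_upto_def by blast
  show ?thesis unfolding c[abs_def] by (intro continuous_intros)
qed

text \<open>The difference of order \<open>l + 1\<close> annihilates polynomials of degree \<open>l\<close>. Along the segment from \<open>x\<close> to \<open>y\<close>
  it expresses the value at \<open>x\<close> by the values at equidistant nodes away from \<open>x\<close>, with weights that depend on \<open>l\<close>
  only.\<close>

lemma polynomial_abs_le_nodes:
  fixes q :: "real ^ 'n \<Rightarrow> real"
  assumes "q \<in> polynomials_upto l"
  shows "\<bar>q x\<bar> \<le> (\<Sum>i\<in>{1..l+1}. real ((l + 1) choose i) * \<bar>q (x + (real i / real (l + 1)) *\<^sub>R (y - x))\<bar>)"
proof -
  let ?n = "l + 1"
  define f where "f = (\<lambda>i. q (x + (real i / real ?n) *\<^sub>R (y - x)))"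
  obtain p where p: "degree p \<le> l" "\<And>t. poly p t = q (x + t *\<^sub>R ((1 / real ?n) *\<^sub>R (y - x)))"
    using polynomial_on_line[OF assms] by metis
  have "(\<Sum>i\<le>?n. (-1) ^ i * real (?n choose i) * poly p (real i)) = 0"
    using p by (intro finite_difference_poly_eq_0) simp
  then have "0 = (\<Sum>i\<le>?n. (-1) ^ i * real (?n choose i) * f i)"
    by (simp add: p(2) f_def)
  also have "\<dots> = q x + (\<Sum>i\<in>{1..?n}. (-1) ^ i * real (?n choose i) * f i)"
    by (subst atMost_atLeast0, subst sum.atLeast_Suc_atMost) (simp_all add: f_def)
  finally have "\<bar>q x\<bar> = \<bar>\<Sum>i\<in>{1..?n}. (-1) ^ i * real (?n choose i) * f i\<bar>" by linarith
  also have "\<dots> \<le> (\<Sum>i\<in>{1..?n}. \<bar>(-1) ^ i * real (?n choose i) * f i\<bar>)" by (rule sum_abs)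
  also have "\<dots> = (\<Sum>i\<in>{1..?n}. real (?n choose i) * \<bar>f i\<bar>)"
    by (simp add: abs_mult power_abs)
  finally show ?thesis by (simp add: f_def)
qed

lemma nn_integral_affine_lborel:
  fixes f :: "'a::euclidean_space \<Rightarrow> ennreal"
  assumes [measurable]: "f \<in> borel_measurable borel" and t: "0 < t"
  shows "(\<integral>\<^sup>+y. f (a + t *\<^sub>R y) \<partial>lborel) = ennreal ((1 / t) ^ DIM('a)) * (\<integral>\<^sup>+y. f y \<partial>lborel)"
proof -
  have "(\<integral>\<^sup>+y. f y \<partial>lborel) = ennreal (t ^ DIM('a)) * (\<integral>\<^sup>+y. f (a + t *\<^sub>R y) \<partial>lborel)"
    using t by (subst lborel_affine[of t a]) (auto simp: nn_integral_density nn_integral_distr nn_integral_cmult)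
  then have "ennreal ((1 / t) ^ DIM('a)) * (\<integral>\<^sup>+y. f y \<partial>lborel)
     = ennreal ((1 / t) ^ DIM('a) * t ^ DIM('a)) * (\<integral>\<^sup>+y. f (a + t *\<^sub>R y) \<partial>lborel)"
    using t by (simp add: ennreal_mult mult.assoc)
  also have "(1 / t) ^ DIM('a) * t ^ DIM('a) = 1" using t by (simp add: power_mult_distrib[symmetric])
  finally show ?thesis by simp
qed

text \<open>Integrate the bound by nodes over \<open>y\<close> in the ball. For the node parameter \<open>t\<close>, the map that sends \<open>y\<close> to
  \<open>x + t *\<^sub>R (y - x)\<close> takes the ball into \<open>T\<close> by convexity and has the Jacobian \<open>t ^ CARD('n)\<close> with \<open>t \<ge> 1 / (l + 1)\<close>,
  so each node contributes at most a multiple of the integral over \<open>T\<close>.\<close>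

lemma polynomial_inverse_estimate:
  fixes q :: "real ^ 'n \<Rightarrow> real"
  assumes q: "q \<in> polynomials_upto l" and T: "compact T" "convex T" "x \<in> T"
    and ball: "ball c r \<subseteq> T" "0 < r"
  shows "\<bar>q x\<bar> * measure lebesgue (ball c r)
      \<le> 2 ^ (l + 1) * real (l + 1) ^ CARD('n) * (LINT y:T|lebesgue. \<bar>q y\<bar>)"
proof -
  let ?n = "l + 1" and ?B = "ball c r"
  have cont: "continuous_on A q" for A using continuous_on_polynomials_upto[OF q] .
  have qm[measurable]: "q \<in> borel_measurable borel" using cont by (rule borel_measurable_continuous_onI)
  have Tm[measurable]: "T \<in> sets borel" using compact_imp_closed[OF T(1)] by (rule borel_closed)
  define g where "g = (\<lambda>y. ennreal \<bar>q y\<bar> * indicator T y)"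
  have gm[measurable]: "g \<in> borel_measurable borel" unfolding g_def by measurable
  define I where "I = (LINT y:T|lebesgue. \<bar>q y\<bar>)"
  have I0: "0 \<le> I" unfolding I_def set_lebesgue_integral_def by (intro integral_nonneg_AE) auto
  have int: "integrable lborel (\<lambda>y. indicator T y *\<^sub>R \<bar>q y\<bar>)"
    using T cont by (intro borel_integrable_compact continuous_intros) auto
  have Ig: "(\<integral>\<^sup>+y. g y \<partial>lborel) = ennreal I"
  proof -
    have "(\<integral>\<^sup>+y. g y \<partial>lborel) = (\<integral>\<^sup>+y. ennreal (indicator T y *\<^sub>R \<bar>q y\<bar>) \<partial>lborel)"
      by (intro nn_integral_cong) (auto simp: g_def indicator_def)
    also have "\<dots> = ennreal (\<integral>y. indicator T y *\<^sub>R \<bar>q y\<bar> \<partial>lborel)"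
      using int by (intro nn_integral_eq_integral) auto
    also have "(\<integral>y. indicator T y *\<^sub>R \<bar>q y\<bar> \<partial>lborel) = I"
      unfolding I_def set_lebesgue_integral_def by (rule integral_completion[symmetric]) measurable
    finally show ?thesis .
  qed
  have node: "(\<integral>\<^sup>+y\<in>?B. ennreal \<bar>q (x + (real i / real ?n) *\<^sub>R (y - x))\<bar> \<partial>lborel)
      \<le> ennreal (real ?n ^ CARD('n) * I)" if i: "i \<in> {1..?n}" for i
  proof -
    let ?t = "real i / real ?n"
    have t: "0 < ?t" "?t \<le> 1" using i by auto
    have "(\<integral>\<^sup>+y\<in>?B. ennreal \<bar>q (x + ?t *\<^sub>R (y - x))\<bar> \<partial>lborel) \<le> (\<integral>\<^sup>+y. g ((x - ?t *\<^sub>R x) + ?t *\<^sub>R y) \<partial>lborel)"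
    proof (rule nn_integral_mono)
      fix y
      have e: "x + ?t *\<^sub>R (y - x) = (x - ?t *\<^sub>R x) + ?t *\<^sub>R y" by (simp add: algebra_simps)
      have e': "x + ?t *\<^sub>R (y - x) = (1 - ?t) *\<^sub>R x + ?t *\<^sub>R y" by (simp add: algebra_simps)
      show "ennreal \<bar>q (x + ?t *\<^sub>R (y - x))\<bar> * indicator ?B y \<le> g ((x - ?t *\<^sub>R x) + ?t *\<^sub>R y)"
      proof (cases "y \<in> ?B")
        case True
        then have "y \<in> T" using ball by blast
        then have "x + ?t *\<^sub>R (y - x) \<in> T" unfolding e' using T t by (intro convexD) auto
        then show ?thesis using True unfolding e[symmetric] by (simp add: g_def)
      qed simp
    qed
    also have "\<dots> = ennreal ((1 / ?t) ^ CARD('n)) * ennreal I"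
      using nn_integral_affine_lborel[OF gm t(1)] Ig by simp
    also have "\<dots> \<le> ennreal (real ?n ^ CARD('n)) * ennreal I"
    proof (intro mult_right_mono ennreal_leI power_mono)
      have "1 / ?t = real ?n / real i" by simp
      also have "\<dots> \<le> real ?n / 1" using i by (intro divide_left_mono) auto
      finally show "1 / ?t \<le> real ?n" by simp
    qed (use t in auto)
    also have "\<dots> = ennreal (real ?n ^ CARD('n) * I)" using I0 by (simp add: ennreal_mult)
    finally show ?thesis .
  qed
  have "ennreal \<bar>q x\<bar> * emeasure lborel ?B = (\<integral>\<^sup>+y\<in>?B. ennreal \<bar>q x\<bar> \<partial>lborel)"
    by (simp add: nn_integral_cmult_indicator)
  also have "\<dots> \<le> (\<integral>\<^sup>+y. (\<Sum>i\<in>{1..?n}. ennreal (real (?n choose i)) *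
       (ennreal \<bar>q (x + (real i / real ?n) *\<^sub>R (y - x))\<bar> * indicator ?B y)) \<partial>lborel)"
  proof (rule nn_integral_mono)
    fix y
    have "ennreal \<bar>q x\<bar> \<le> (\<Sum>i\<in>{1..?n}. ennreal (real (?n choose i)) * ennreal \<bar>q (x + (real i / real ?n) *\<^sub>R (y - x))\<bar>)"
      using ennreal_leI[OF polynomial_abs_le_nodes[OF q, of x y]]
      by (subst ennreal_mult[symmetric], simp, simp, subst sum_ennreal) auto
    then show "ennreal \<bar>q x\<bar> * indicator ?B y \<le> (\<Sum>i\<in>{1..?n}. ennreal (real (?n choose i)) *
       (ennreal \<bar>q (x + (real i / real ?n) *\<^sub>R (y - x))\<bar> * indicator ?B y))"
      by (cases "y \<in> ?B") auto
  qed
  also have "\<dots> = (\<Sum>i\<in>{1..?n}. ennreal (real (?n choose i)) *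
       (\<integral>\<^sup>+y\<in>?B. ennreal \<bar>q (x + (real i / real ?n) *\<^sub>R (y - x))\<bar> \<partial>lborel))"
  proof (subst nn_integral_sum)
    have [measurable]: "?B \<in> sets borel" by simp
    have [measurable]: "(\<lambda>y. ennreal \<bar>q (x + t *\<^sub>R (y - x))\<bar> * indicator ?B y) \<in> borel_measurable lborel" for t
      by measurable
    show "(\<lambda>y. ennreal (real (?n choose i)) * (ennreal \<bar>q (x + (real i / real ?n) *\<^sub>R (y - x))\<bar> * indicator ?B y))
       \<in> borel_measurable lborel" for i by measurable
    show "(\<Sum>i\<in>{1..?n}. \<integral>\<^sup>+y. ennreal (real (?n choose i)) * (ennreal \<bar>q (x + (real i / real ?n) *\<^sub>R (y - x))\<bar> * indicator ?B y) \<partial>lborel)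
      = (\<Sum>i\<in>{1..?n}. ennreal (real (?n choose i)) *
       (\<integral>\<^sup>+y\<in>?B. ennreal \<bar>q (x + (real i / real ?n) *\<^sub>R (y - x))\<bar> \<partial>lborel))"
      by (intro sum.cong refl nn_integral_cmult) measurable
  qed
  also have "\<dots> \<le> (\<Sum>i\<in>{1..?n}. ennreal (real (?n choose i)) * ennreal (real ?n ^ CARD('n) * I))"
    using node by (intro sum_mono mult_left_mono) auto
  also have "\<dots> = ennreal (\<Sum>i\<in>{1..?n}. real (?n choose i) * (real ?n ^ CARD('n) * I))"
    using I0 by (subst ennreal_mult[symmetric], simp, simp, subst sum_ennreal) auto
  also have "\<dots> \<le> ennreal (2 ^ ?n * real ?n ^ CARD('n) * I)"
  proof (rule ennreal_leI)
    have "(\<Sum>i\<in>{1..?n}. real (?n choose i)) \<le> (\<Sum>i\<le>?n. real (?n choose i))"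
      by (intro sum_mono2) auto
    also have "\<dots> = 2 ^ ?n" using choose_row_sum[of ?n] by (metis of_nat_sum of_nat_numeral of_nat_power)
    finally have "(\<Sum>i\<in>{1..?n}. real (?n choose i)) * (real ?n ^ CARD('n) * I) \<le> 2 ^ ?n * (real ?n ^ CARD('n) * I)"
      using I0 by (intro mult_right_mono) auto
    then show "(\<Sum>i\<in>{1..?n}. real (?n choose i) * (real ?n ^ CARD('n) * I)) \<le> 2 ^ ?n * real ?n ^ CARD('n) * I"
      by (simp only: sum_distrib_right mult.assoc)
  qed
  finally have "ennreal (\<bar>q x\<bar> * measure lborel ?B) \<le> ennreal (2 ^ ?n * real ?n ^ CARD('n) * I)"
    using emeasure_lborel_ball_finite[of c r]
    by (simp add: ennreal_mult emeasure_eq_ennreal_measure less_top)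
  then have "\<bar>q x\<bar> * measure lborel ?B \<le> 2 ^ ?n * real ?n ^ CARD('n) * I"
    using I0 by (subst (asm) ennreal_le_iff) auto
  then show ?thesis unfolding I_def by simp
qed

section \<open>Means and log-Hoelder continuous exponents\<close>

text \<open>Replacement for Jensen's inequality when the exponent varies. Where \<open>u > s\<close>, one has
  \<open>u \<le> u powr q * s powr (1 - q)\<close>; elsewhere \<open>u \<le> s\<close>, which accounts for at most half of the mean \<open>2 * s\<close>. Multiplying
  by \<open>s powr (r - 1)\<close> and integrating leaves the claim.\<close>

lemma half_mean_powr_le:
  fixes u q :: "'a::euclidean_space \<Rightarrow> real"
  assumes M: "M \<in> lmeasurable" "0 < measure lebesgue M"
    and u0: "\<And>y. 0 \<le> u y"
    and u: "set_integrable lebesgue M u" and uq: "set_integrable lebesgue M (\<lambda>y. u y powr q y)"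
    and s: "s = (LINT y:M|lebesgue. u y) / measure lebesgue M / 2" "0 < s"
    and q: "AE y in lebesgue. y \<in> M \<longrightarrow> 1 \<le> q y \<and> s powr (r - q y) \<le> C"
  shows "s powr r \<le> C * ((LINT y:M|lebesgue. u y powr q y) / measure lebesgue M)"
proof -
  let ?m = "measure lebesgue M"
  have pt: "u y * s powr (r - 1) \<le> s powr r + C * u y powr q y"
    if y: "1 \<le> q y" "s powr (r - q y) \<le> C" for y
  proof (cases "u y \<le> s")
    case True
    have C0: "0 \<le> C" using y(2) powr_ge_zero[of s "r - q y"] by linarith
    have "u y * s powr (r - 1) \<le> s * s powr (r - 1)" using True by (intro mult_right_mono) auto
    also have "\<dots> = s powr r" using s(2) by (simp add: powr_diff)
    finally show ?thesis using C0 by (smt (verit) mult_nonneg_nonneg powr_ge_zero)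
  next
    case False
    then have up: "0 < u y" using s(2) by linarith
    have "u y = u y powr q y * u y powr (1 - q y)" using up by (simp add: powr_add[symmetric])
    also have "\<dots> \<le> u y powr q y * s powr (1 - q y)"
      using False s(2) y(1) by (intro mult_left_mono powr_mono2') auto
    finally have "u y * s powr (r - 1) \<le> u y powr q y * s powr (1 - q y) * s powr (r - 1)"
      by (intro mult_right_mono) auto
    also have "\<dots> = u y powr q y * s powr (r - q y)" by (simp add: mult.assoc powr_add[symmetric])
    also have "\<dots> \<le> u y powr q y * C" using y(2) by (intro mult_left_mono) auto
    also have "\<dots> \<le> s powr r + C * u y powr q y" by (simp add: mult.commute)
    finally show ?thesis .
  qed
  have const: "set_integrable lebesgue M (\<lambda>_. s powr r)"
    using M(1) by (simp add: set_integrable_def lmeasurable_iff_integrable)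
  have Cuq: "set_integrable lebesgue M (\<lambda>y. C * u y powr q y)" using uq by simp
  have "(LINT y:M|lebesgue. u y * s powr (r - 1)) \<le> (LINT y:M|lebesgue. s powr r + C * u y powr q y)"
    unfolding set_lebesgue_integral_def
  proof (rule integral_mono_AE)
    show "integrable lebesgue (\<lambda>y. indicator M y *\<^sub>R (u y * s powr (r - 1)))"
      using u by (simp add: set_integrable_def mult.assoc[symmetric])
    show "integrable lebesgue (\<lambda>y. indicator M y *\<^sub>R (s powr r + C * u y powr q y))"
      using set_integral_add(1)[OF const Cuq] by (simp add: set_integrable_def)
    show "AE y in lebesgue. indicator M y *\<^sub>R (u y * s powr (r - 1))
       \<le> indicator M y *\<^sub>R (s powr r + C * u y powr q y)"
      using q by eventually_elim (auto simp: indicator_def pt)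
  qed
  also have "\<dots> = s powr r * ?m + C * (LINT y:M|lebesgue. u y powr q y)"
    using set_integral_add(2)[OF const Cuq] M(1)
    by (simp add: set_lebesgue_integral_def lmeasurable_iff_integrable fmeasurableD mult.commute)
  also have "(LINT y:M|lebesgue. u y * s powr (r - 1)) = 2 * s * ?m * s powr (r - 1)"
    using s(1) M(2) by simp
  also have "\<dots> = 2 * (s powr r * ?m)" using s(2) by (simp add: powr_diff)
  finally show ?thesis using M(2) by (simp add: field_simps)
qed

lemma conj_exponent_diff_le:
  assumes "1 < m" "m \<le> p x" "m \<le> p y"
  shows "\<bar>conj_exponent p x - conj_exponent p y\<bar> \<le> \<bar>p x - p y\<bar> / (m - 1)\<^sup>2"
proof -
  have "conj_exponent p x - conj_exponent p y = (p y - p x) / ((p x - 1) * (p y - 1))"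
    using assms by (simp add: conj_exponent_def field_simps)
  then have "\<bar>conj_exponent p x - conj_exponent p y\<bar> = \<bar>p x - p y\<bar> / ((p x - 1) * (p y - 1))"
    using assms by (simp add: abs_mult abs_minus_commute)
  also have "\<dots> \<le> \<bar>p x - p y\<bar> / (m - 1)\<^sup>2"
    unfolding power2_eq_square using assms
    by (intro divide_left_mono mult_mono mult_pos_pos) auto
  finally show ?thesis .
qed

lemma conj_exponent_ge_1: "1 < p x \<Longrightarrow> 1 \<le> conj_exponent p x"
  by (simp add: conj_exponent_def le_divide_eq)

lemma one_le_ln_exp_add:
  fixes t :: real
  assumes "0 \<le> t"
  shows "1 \<le> ln (exp 1 + t)"
  using ln_mono[of "exp 1" "exp 1 + t"] assms by (simp add: add_pos_nonneg)

text \<open>Two regimes. For \<open>s \<ge> 1\<close>, \<open>ln s\<close> is at most a multiple of \<open>ln (1 / h)\<close> up to a constant, and the local condition compensates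
  for it because \<open>x\<close> and \<open>y\<close> have distance of order \<open>h\<close>. For \<open>s < 1\<close>, \<open>\<bar>ln s\<bar>\<close> is at most \<open>m * ln (e + norm x)\<close>, and
  the decay condition at \<open>x\<close> and \<open>y\<close> compensates for that; the two points have comparable size since \<open>h \<le> 1\<close>.\<close>

lemma log_hoelder_scale_bound:
  fixes x y :: "'a::euclidean_space"
  assumes c: "0 \<le> c" and local: "\<bar>p x - p y\<bar> \<le> c / ln (exp 1 + 1 / norm (x - y))"
    and decay: "\<bar>p x - p_inf\<bar> \<le> c / ln (exp 1 + norm x)" "\<bar>p y - p_inf\<bar> \<le> c / ln (exp 1 + norm y)"
    and h: "0 < h" "h \<le> 1" and D: "1 \<le> D" and xy: "norm (x - y) \<le> D * h"
    and K: "1 \<le> K" and s: "0 < s" "s \<le> K / h ^ d" "1 / (exp 1 + norm x) ^ m \<le> s"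
  shows "\<bar>ln s\<bar> * \<bar>p x - p y\<bar> \<le> c * (ln K + d * (1 + ln D) + m * (2 + ln (1 + D)))"
proof (cases "1 \<le> s")
  case True
  define \<Lambda> where "\<Lambda> = ln (exp 1 + 1 / (D * h))"
  have Dh: "0 < D * h" using D h by simp
  have L1: "1 \<le> \<Lambda>" unfolding \<Lambda>_def using Dh by (simp add: one_le_ln_exp_add)
  have diff: "\<bar>p x - p y\<bar> \<le> c / \<Lambda>"
  proof (cases "x = y")
    case True then show ?thesis using c L1 by simp
  next
    case False
    then have n: "0 < norm (x - y)" by simp
    have "exp 1 + 1 / (D * h) \<le> exp 1 + 1 / norm (x - y)"
      using xy n Dh by (intro add_left_mono divide_left_mono) auto
    then have "\<Lambda> \<le> ln (exp 1 + 1 / norm (x - y))"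
      unfolding \<Lambda>_def using Dh by (intro ln_mono) (auto intro: add_pos_pos)
    then have "c / ln (exp 1 + 1 / norm (x - y)) \<le> c / \<Lambda>"
      using c L1 by (intro divide_left_mono) auto
    then show ?thesis using local by linarith
  qed
  have "ln (1 / h) = ln (1 / (D * h)) + ln D" using D h by (simp add: ln_div ln_mult)
  moreover have "ln (1 / (D * h)) \<le> \<Lambda>" unfolding \<Lambda>_def using Dh by (intro ln_mono) (auto intro: add_nonneg_pos)
  moreover have lD: "0 \<le> ln D" using D by simp
  moreover have "ln D \<le> ln D * \<Lambda>" using lD L1 by (simp add: mult_le_cancel_left1)
  ultimately have lh: "ln (1 / h) \<le> \<Lambda> * (1 + ln D)" by (simp add: algebra_simps)
  have "ln s \<le> ln (K / h ^ d)" using s K h by (intro ln_mono) auto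
  also have "\<dots> = ln K + d * ln (1 / h)" using K h by (simp add: ln_div ln_realpow)
  also have "\<dots> \<le> ln K * \<Lambda> + d * (\<Lambda> * (1 + ln D))"
    using lh L1 K by (intro add_mono mult_left_mono) (auto simp: mult_le_cancel_left1)
  finally have lns: "ln s \<le> \<Lambda> * (ln K + d * (1 + ln D))" by (simp add: algebra_simps)
  have "\<bar>ln s\<bar> * \<bar>p x - p y\<bar> \<le> (\<Lambda> * (ln K + d * (1 + ln D))) * (c / \<Lambda>)"
  proof (intro mult_mono)
    show "\<bar>ln s\<bar> \<le> \<Lambda> * (ln K + d * (1 + ln D))" using lns True by simp
    then show "0 \<le> \<Lambda> * (ln K + d * (1 + ln D))" by linarith
  qed (use diff in auto)
  also have "\<dots> = c * (ln K + d * (1 + ln D))" using L1 by simp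
  also have "\<dots> \<le> c * (ln K + d * (1 + ln D) + m * (2 + ln (1 + D)))"
    using c D by (intro mult_left_mono) auto
  finally show ?thesis .
next
  case False
  have ep: "0 < exp 1 + norm x" "0 < exp 1 + norm y" by (simp_all add: add_pos_nonneg)
  define X Y where "X = ln (exp 1 + norm x)" and "Y = ln (exp 1 + norm y)"
  have XY: "1 \<le> X" "1 \<le> Y" unfolding X_def Y_def by (simp_all add: one_le_ln_exp_add)
  have lD: "0 \<le> ln (1 + D)" using D by simp
  have "norm x \<le> norm y + norm (x - y)" by (metis add.commute diff_add_cancel norm_triangle_ineq)
  also have "norm (x - y) \<le> D" using xy h D by (meson mult_left_le order_trans zero_le_one)
  also have "norm y + D \<le> norm y + D * (exp 1 + norm y)"
    using D by (intro add_left_mono) (simp add: mult_le_cancel_left1 add_increasing2)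
  finally have "exp 1 + norm x \<le> (exp 1 + norm y) * (1 + D)" by (simp add: algebra_simps)
  then have "X \<le> ln ((exp 1 + norm y) * (1 + D))"
    unfolding X_def using ep by (intro ln_mono) auto
  also have "\<dots> = Y + ln (1 + D)" unfolding Y_def using D ep by (subst ln_mult) auto
  also have "\<dots> \<le> Y + ln (1 + D) * Y" using XY lD by (simp add: mult_le_cancel_left1)
  finally have "X \<le> Y * (1 + ln (1 + D))" by (simp add: algebra_simps)
  then have XdY: "X / Y \<le> 1 + ln (1 + D)" using XY by (simp add: field_simps)
  have diff: "\<bar>p x - p y\<bar> \<le> c / X + c / Y" using decay unfolding X_def Y_def by linarith
  have "X * \<bar>p x - p y\<bar> \<le> X * (c / X + c / Y)" using diff XY by (intro mult_left_mono) auto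
  also have "\<dots> = c + c * (X / Y)" using XY by (simp add: field_simps)
  also have "\<dots> \<le> c + c * (1 + ln (1 + D))" using XdY c by (intro add_left_mono mult_left_mono) auto
  finally have Xd: "X * \<bar>p x - p y\<bar> \<le> c * (2 + ln (1 + D))" by (simp add: algebra_simps)
  have "ln (1 / (exp 1 + norm x) ^ m) \<le> ln s" using s ep by (intro ln_mono) auto
  moreover have "ln (1 / (exp 1 + norm x) ^ m) = - (m * X)"
    unfolding X_def using ep by (subst ln_div) (auto simp: ln_realpow)
  ultimately have "\<bar>ln s\<bar> \<le> m * X" using False s by simp
  then have "\<bar>ln s\<bar> * \<bar>p x - p y\<bar> \<le> m * X * \<bar>p x - p y\<bar>" by (intro mult_right_mono) auto
  also have "\<dots> \<le> m * (c * (2 + ln (1 + D)))" using Xd by (simp add: mult.assoc mult_left_mono)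
  also have "\<dots> = c * (m * (2 + ln (1 + D)))" by simp
  also have "\<dots> \<le> c * (ln K + d * (1 + ln D) + m * (2 + ln (1 + D)))"
    using c D K by (intro mult_left_mono) auto
  finally show ?thesis .
qed

text \<open>The threshold below which a half mean is absorbed by an additive error. The power exceeds the dimension by
  two so that the sum over balls of integer radius converges.\<close>

definition decay_weight :: "'a::euclidean_space \<Rightarrow> real" where
  "decay_weight x = 1 / (exp 1 + norm x) ^ (DIM('a) + 2)"

lemma decay_weight_bounds: "0 < decay_weight x" "decay_weight x \<le> 1"
proof -
  have "(1::real) \<le> exp 1 + norm x" by (simp add: add_increasing2)
  then have "1 \<le> (exp 1 + norm x) ^ (DIM('a) + 2)" by (rule one_le_power)
  then show "decay_weight x \<le> 1" unfolding decay_weight_def by simp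
  show "0 < decay_weight x" by (simp add: decay_weight_def add_pos_nonneg)
qed

text \<open>On the ball of radius \<open>k + 1\<close>, the weight at points of norm at least \<open>k\<close> is at most \<open>(k + 1)\<close> to the power
  \<open>- (d + 2)\<close>, while the volume of that ball is of order \<open>(k + 1) ^ d\<close>.\<close>

lemma nn_integral_decay_weight_finite:
  "(\<integral>\<^sup>+x. ennreal (decay_weight (x :: 'a::euclidean_space)) \<partial>lebesgue) < \<infinity>"
proof -
  let ?d = "DIM('a)"
  define a where "a = (\<lambda>k x. ennreal (1 / real (Suc k) ^ (?d + 2)) * indicator (ball (0 :: 'a) (real (Suc k))) x)"
  have "(\<integral>\<^sup>+x. ennreal (decay_weight (x :: 'a)) \<partial>lebesgue) \<le> (\<integral>\<^sup>+x. (\<Sum>k. a k x) \<partial>lebesgue)"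
  proof (rule nn_integral_mono)
    fix x :: 'a
    define k where "k = nat \<lfloor>norm x\<rfloor>"
    have k: "real k \<le> norm x" "norm x < real (Suc k)"
      unfolding k_def using norm_ge_zero[of x] by linarith+
    have "real (Suc k) \<le> exp 1 + norm x" using k exp_ge_add_one_self[of 1] by simp
    then have "real (Suc k) ^ (?d + 2) \<le> (exp 1 + norm x) ^ (?d + 2)" by (intro power_mono) auto
    then have "decay_weight x \<le> 1 / real (Suc k) ^ (?d + 2)"
      unfolding decay_weight_def by (intro divide_left_mono) (auto intro!: mult_pos_pos zero_less_power add_pos_nonneg)
    then have "ennreal (decay_weight x) \<le> a k x" using k by (simp add: a_def ennreal_leI)
    also have "\<dots> = (\<Sum>j\<in>{k}. a j x)" by simp
    also have "\<dots> \<le> (\<Sum>k. a k x)" by (intro sum_le_suminf) auto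
    finally show "ennreal (decay_weight x) \<le> (\<Sum>k. a k x)" .
  qed
  also have "\<dots> = (\<Sum>k. \<integral>\<^sup>+x. a k x \<partial>lebesgue)"
    unfolding a_def by (intro nn_integral_suminf borel_measurable_times_ennreal borel_measurable_indicator) auto
  also have "\<dots> = (\<Sum>k. ennreal (unit_ball_vol (real ?d) * (1 / real (Suc k) ^ 2)))"
  proof (intro suminf_cong)
    fix k
    have "(\<integral>\<^sup>+x. a k x \<partial>lebesgue) = ennreal (1 / real (Suc k) ^ (?d + 2)) * emeasure lebesgue (ball (0 :: 'a) (real (Suc k)))"
      unfolding a_def by (intro nn_integral_cmult_indicator) auto
    also have "\<dots> = ennreal (1 / real (Suc k) ^ (?d + 2) * (unit_ball_vol (real ?d) * real (Suc k) ^ ?d))"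
    proof -
      have "emeasure lebesgue (ball (0 :: 'a) (real (Suc k))) = ennreal (unit_ball_vol (real ?d) * real (Suc k) ^ ?d)"
        using emeasure_ball[of "real (Suc k)" "0 :: 'a"] by simp
      then show ?thesis by (simp only:) (subst ennreal_mult[symmetric], auto)
    qed
    also have "1 / real (Suc k) ^ (?d + 2) * (unit_ball_vol (real ?d) * real (Suc k) ^ ?d)
       = unit_ball_vol (real ?d) * (1 / real (Suc k) ^ 2)"
      by (simp add: power_add field_simps power2_eq_square del: of_nat_Suc)
    finally show "(\<integral>\<^sup>+x. a k x \<partial>lebesgue) = ennreal (unit_ball_vol (real ?d) * (1 / real (Suc k) ^ 2))" .
  qed
  also have "\<dots> < \<infinity>"
  proof -
    have "summable (\<lambda>k. 1 / real (Suc k) ^ 2)"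
      using inverse_power_summable[of 2, where 'a = real] by (subst summable_Suc_iff) (simp add: field_simps)
    then have "summable (\<lambda>k. unit_ball_vol (real ?d) * (1 / real (Suc k) ^ 2))" by (rule summable_mult)
    then have "(\<Sum>k. ennreal (unit_ball_vol (real ?d) * (1 / real (Suc k) ^ 2))) \<noteq> top"
      by (rule ennreal_suminf_neq_top) (auto intro!: mult_nonneg_nonneg)
    then show ?thesis by (simp only: less_top infinity_ennreal_def)
  qed
  finally show ?thesis .
qed

text \<open>If \<open>s\<close> is below the decay weight at \<open>x\<close>, that weight bounds \<open>s powr q x\<close> since \<open>s \<le> 1 \<le> q x\<close>. Otherwise
  \<open>u \<le> 1 + u powr q\<close> bounds the mean by a multiple of \<open>1 / h ^ d\<close>, so \<open>s\<close> is in the range in which log-Hoelder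
  continuity controls \<open>s powr (q x - q y)\<close>.\<close>

lemma half_mean_powr_log_hoelder:
  fixes u p :: "'a::euclidean_space \<Rightarrow> real"
  defines "q \<equiv> conj_exponent p"
  assumes M: "M \<in> lmeasurable" and kap: "0 < \<kappa>" "\<kappa> * h ^ DIM('a) \<le> measure lebesgue M"
    and h: "0 < h" "h \<le> 1" and D: "1 \<le> D" and c: "0 \<le> c" and pm: "1 < p_minus"
    and x: "p_minus \<le> p x" "\<bar>p x - p_inf\<bar> \<le> c / ln (exp 1 + norm x)"
    and y: "AE y in lebesgue. y \<in> M \<longrightarrow> p_minus \<le> p y \<and> \<bar>p x - p y\<bar> \<le> c / ln (exp 1 + 1 / norm (x - y))
       \<and> \<bar>p y - p_inf\<bar> \<le> c / ln (exp 1 + norm y) \<and> norm (x - y) \<le> D * h"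
    and u0: "\<And>y. 0 \<le> u y"
    and u: "set_integrable lebesgue M u" and uq: "set_integrable lebesgue M (\<lambda>y. u y powr q y)"
    and mod_le_1: "(LINT y:M|lebesgue. u y powr q y) \<le> 1"
    and s: "s = (LINT y:M|lebesgue. u y) / measure lebesgue M / 2"
    and A: "A = ln (1 + 1 / \<kappa>) + DIM('a) * (1 + ln D) + (DIM('a) + 2) * (2 + ln (1 + D))"
  shows "s powr q x \<le> exp (c * A / (p_minus - 1)\<^sup>2) * ((LINT y:M|lebesgue. u y powr q y) / measure lebesgue M)
     + decay_weight x"
proof -
  let ?m = "measure lebesgue M" and ?I = "LINT y:M|lebesgue. u y powr q y"
  have m0: "0 < ?m"
    using kap h by (meson less_le_trans mult_pos_pos zero_less_power)
  have I0: "0 \<le> ?I" unfolding set_lebesgue_integral_def by (intro integral_nonneg_AE) auto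
  have s0: "0 \<le> s" unfolding s set_lebesgue_integral_def
    using u0 by (intro divide_nonneg_nonneg integral_nonneg_AE) auto
  have qx: "1 \<le> q x" using x pm by (simp add: q_def conj_exponent_ge_1)
  have rhs0: "0 \<le> exp (c * A / (p_minus - 1)\<^sup>2) * (?I / ?m)" using I0 m0 by simp
  consider "s = 0" | "0 < s" "s < decay_weight x" | "0 < s" "decay_weight x \<le> s" using s0 by linarith
  then show ?thesis
  proof cases
    case 1
    then show ?thesis using rhs0 decay_weight_bounds[of x] by simp
  next
    case 2
    then have "s \<le> 1" using decay_weight_bounds[of x] by linarith
    then have "s powr q x \<le> s powr 1" using qx 2 by (intro powr_mono') auto
    then show ?thesis using 2 rhs0 by simp
  next
    case 3
    have sle: "s \<le> (1 + 1 / \<kappa>) / h ^ DIM('a)"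
    proof -
      have const: "set_integrable lebesgue M (\<lambda>_. 1 :: real)"
        using M by (simp add: set_integrable_def lmeasurable_iff_integrable)
      have "(LINT y:M|lebesgue. u y) \<le> (LINT y:M|lebesgue. 1 + u y powr q y)"
        unfolding set_lebesgue_integral_def
      proof (rule integral_mono_AE)
        show "integrable lebesgue (\<lambda>y. indicator M y *\<^sub>R u y)" using u by (simp add: set_integrable_def)
        show "integrable lebesgue (\<lambda>y. indicator M y *\<^sub>R (1 + u y powr q y))"
          using set_integral_add(1)[OF const uq] by (simp add: set_integrable_def)
        show "AE z in lebesgue. indicator M z *\<^sub>R u z \<le> indicator M z *\<^sub>R (1 + u z powr q z)"
          using y
        proof eventually_elim
          case (elim z)
          show ?case
          proof (cases "z \<in> M")
            case True
            then have q1: "1 \<le> q z" using elim pm by (simp add: q_def conj_exponent_ge_1)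
            have "u z \<le> 1 + u z powr q z"
            proof (cases "u z \<le> 1")
              case True then show ?thesis using powr_ge_zero[of "u z" "q z"] by linarith
            next
              case False
              then have "u z powr 1 \<le> u z powr q z" using q1 by (intro powr_mono) auto
              then show ?thesis using False by simp
            qed
            then show ?thesis using True by simp
          qed simp
        qed
      qed
      also have "\<dots> = ?m + ?I" using set_integral_add(2)[OF const uq] M
        by (simp add: set_lebesgue_integral_def lmeasurable_iff_integrable fmeasurableD)
      also have "\<dots> \<le> ?m + 1" using mod_le_1 by simp
      finally have "(LINT y:M|lebesgue. u y) / ?m \<le> (?m + 1) / ?m" using m0 by (intro divide_right_mono) auto
      then have "s \<le> 1 + 1 / ?m" using s s0 m0 by (simp add: add_divide_distrib)
      also have "1 / ?m \<le> 1 / (\<kappa> * h ^ DIM('a))"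
        using kap h m0 by (intro divide_left_mono mult_pos_pos zero_less_power) auto
      also have "1 + 1 / (\<kappa> * h ^ DIM('a)) \<le> (1 + 1 / \<kappa>) / h ^ DIM('a)"
      proof -
        have "h ^ DIM('a) \<le> 1" using h by (intro power_le_one) auto
        then show ?thesis using h kap by (simp add: field_simps)
      qed
      finally show ?thesis by simp
    qed
    have "AE z in lebesgue. z \<in> M \<longrightarrow> 1 \<le> q z \<and> s powr (q x - q z) \<le> exp (c * A / (p_minus - 1)\<^sup>2)"
      using y
    proof eventually_elim
      case (elim z)
      show ?case
      proof
        assume "z \<in> M"
        with elim have z: "p_minus \<le> p z" "\<bar>p x - p z\<bar> \<le> c / ln (exp 1 + 1 / norm (x - z))"
          "\<bar>p z - p_inf\<bar> \<le> c / ln (exp 1 + norm z)" "norm (x - z) \<le> D * h" by auto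
        have K: "1 \<le> 1 + 1 / \<kappa>" using kap by simp
        have low: "1 / (exp 1 + norm x) ^ (DIM('a) + 2) \<le> s" using 3 by (simp add: decay_weight_def)
        have "\<bar>ln s\<bar> * \<bar>p x - p z\<bar> \<le> c * A"
          using log_hoelder_scale_bound[OF c z(2) x(2) z(3) h D z(4) K 3(1) sle low]
          unfolding A by (simp add: algebra_simps)
        then have cA: "\<bar>ln s\<bar> * \<bar>p x - p z\<bar> / (p_minus - 1)\<^sup>2 \<le> c * A / (p_minus - 1)\<^sup>2"
          by (intro divide_right_mono) auto
        have "(q x - q z) * ln s \<le> \<bar>q x - q z\<bar> * \<bar>ln s\<bar>" by (metis abs_ge_self abs_mult)
        also have "\<dots> \<le> \<bar>p x - p z\<bar> / (p_minus - 1)\<^sup>2 * \<bar>ln s\<bar>"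
          unfolding q_def using conj_exponent_diff_le[of p_minus p x z, OF pm x(1) z(1)] by (intro mult_right_mono) auto
        also have "\<dots> \<le> c * A / (p_minus - 1)\<^sup>2" using cA by (simp add: mult.commute)
        finally have "s powr (q x - q z) \<le> exp (c * A / (p_minus - 1)\<^sup>2)"
          using 3 by (simp add: powr_def)
        then show "1 \<le> q z \<and> s powr (q x - q z) \<le> exp (c * A / (p_minus - 1)\<^sup>2)"
          using z pm by (simp add: q_def conj_exponent_ge_1)
      qed
    qed
    from half_mean_powr_le[OF M m0 u0 u uq s 3(1) this]
    show ?thesis using decay_weight_bounds[of x] by linarith
  qed
qed

section \<open>The Luxemburg norm\<close>

text \<open>The quantity that is compared with one in the definition of the Luxemburg norm.\<close>

definition modular :: "('a::euclidean_space \<Rightarrow> real) \<Rightarrow> 'a set \<Rightarrow> ('a \<Rightarrow> real) \<Rightarrow> ennreal" where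
  "modular q M v = (\<integral>\<^sup>+x\<in>M. ennreal (\<bar>v x\<bar> powr q x) \<partial>lebesgue)"

text \<open>By homogeneity, a norm inequality follows from an implication between modulars bounded by one. It also
  covers the case of an infinite right-hand side.\<close>

lemma luxemburg_norm_le_cmult:
  assumes A: "0 < A"
    and le: "\<And>t. 0 < t \<Longrightarrow> modular q M (\<lambda>x. v x / t) \<le> 1 \<Longrightarrow> modular q N (\<lambda>x. u x / (A * t)) \<le> 1"
  shows "luxemburg_norm q N u \<le> ennreal A * luxemburg_norm q M v"
proof -
  let ?S = "{t::real. 0 < t \<and> modular q M (\<lambda>x. v x / t) \<le> 1}"
  have "ennreal (1 / A) * luxemburg_norm q N u \<le> (INF t\<in>?S. ennreal t)"
  proof (rule INF_greatest)
    fix t assume t: "t \<in> ?S"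
    then have "luxemburg_norm q N u \<le> ennreal (A * t)"
      unfolding luxemburg_norm_def using A le[of t] by (intro INF_lower) (auto simp: modular_def)
    then have "ennreal (1 / A) * luxemburg_norm q N u \<le> ennreal (1 / A) * ennreal (A * t)"
      by (intro mult_left_mono) auto
    also have "\<dots> = ennreal t" using A t by (simp add: ennreal_mult[symmetric])
    finally show "ennreal (1 / A) * luxemburg_norm q N u \<le> ennreal t" .
  qed
  also have "(INF t\<in>?S. ennreal t) = luxemburg_norm q M v"
    by (simp add: luxemburg_norm_def modular_def)
  finally have "ennreal A * (ennreal (1 / A) * luxemburg_norm q N u) \<le> ennreal A * luxemburg_norm q M v"
    by (intro mult_left_mono) auto
  moreover have "ennreal A * (ennreal (1 / A) * luxemburg_norm q N u) = luxemburg_norm q N u"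
    using A by (simp add: mult.assoc[symmetric] ennreal_mult[symmetric])
  ultimately show ?thesis by simp
qed

lemma luxemburg_norm_finiteE:
  assumes "luxemburg_norm q M v < \<infinity>"
  obtains t where "0 < t" "modular q M (\<lambda>x. v x / t) \<le> 1"
proof -
  have "{t::real. 0 < t \<and> modular q M (\<lambda>x. v x / t) \<le> 1} \<noteq> {}" (is "?S \<noteq> {}")
  proof
    assume e: "?S = {}"
    have "luxemburg_norm q M v = (INF t\<in>?S. ennreal t)" by (simp add: luxemburg_norm_def modular_def)
    also have "\<dots> = top" unfolding e by simp
    finally show False using assms by simp
  qed
  then show ?thesis using that by blast
qed

lemma luxemburg_norm_finiteI:
  assumes "0 < t" "modular q M (\<lambda>x. v x / t) \<le> 1"
  shows "luxemburg_norm q M v < \<infinity>"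
proof -
  have "luxemburg_norm q M v \<le> ennreal t"
    unfolding luxemburg_norm_def using assms by (intro INF_lower) (auto simp: modular_def)
  then show ?thesis by (simp add: le_less_trans)
qed

text \<open>Since \<open>q \<ge> 1\<close>, dividing a function by \<open>L\<close> divides its modular by at least \<open>L\<close>. This turns any bound for the
  modular into the bound one.\<close>

lemma powr_divide_le:
  fixes a L q :: real
  assumes "0 \<le> a" "1 \<le> L" "1 \<le> q"
  shows "(a / L) powr q \<le> a powr q / L"
proof -
  have "L powr 1 \<le> L powr q" using assms by (intro powr_mono) auto
  then have "a powr q / L powr q \<le> a powr q / L" using assms by (intro divide_left_mono) auto
  then show ?thesis using assms by (simp add: powr_divide)
qed

lemma powr_max_divide_le:
  fixes a b L q :: real
  assumes "0 \<le> a" "0 \<le> b" "1 \<le> L" "1 \<le> q"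
  shows "(max a b / L) powr q \<le> (a powr q + b powr q) / L"
proof -
  have "(max a b / L) powr q \<le> max a b powr q / L" using assms by (intro powr_divide_le) auto
  also have "\<dots> \<le> (a powr q + b powr q) / L"
    using assms by (intro divide_right_mono) (auto simp: max_def)
  finally show ?thesis .
qed

text \<open>On a set of finite measure the constants belong to the Lebesgue space; the sum is handled by the maximum
  of the two terms.\<close>

lemma Lp_var_diff_const:
  fixes z :: "'a::euclidean_space \<Rightarrow> real"
  assumes Om: "\<Omega> \<in> lmeasurable" and q: "AE x in lebesgue_on \<Omega>. 1 \<le> q x"
    and qm: "q \<in> borel_measurable (lebesgue_on \<Omega>)" and z: "z \<in> Lp_var q \<Omega>"
  shows "(\<lambda>x. z x - m) \<in> Lp_var q \<Omega>"
proof -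
  have Os: "\<Omega> \<in> sets lebesgue" using Om by (simp add: fmeasurableD)
  have zm[measurable]: "z \<in> borel_measurable (lebesgue_on \<Omega>)" using z by (simp add: Lp_var_def)
  note qm[measurable]
  obtain t where t: "0 < t" "modular q \<Omega> (\<lambda>x. z x / t) \<le> 1"
    using z luxemburg_norm_finiteE by (force simp: Lp_var_def)
  \<comment> \<open>Divided by \<open>\<tau>\<close>, the function \<open>z\<close> has modular at most one and \<open>m\<close> has modular at most \<open>measure lebesgue \<Omega>\<close>; the choice of \<open>L\<close> compensates for the sum of these bounds.\<close>
  define \<tau> where "\<tau> = max t \<bar>m\<bar>"
  have tau: "t \<le> \<tau>" "\<bar>m\<bar> \<le> \<tau>" "0 < \<tau>" using t by (auto simp: \<tau>_def)
  define L where "L = 1 + measure lebesgue \<Omega>"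
  have L: "1 \<le> L" by (simp add: L_def)
  have pt: "\<bar>(z x - m) / (2 * L * \<tau>)\<bar> powr q x \<le> (1 / L) * (\<bar>z x / t\<bar> powr q x + 1)" if q1: "1 \<le> q x" for x
  proof -
    have "\<bar>z x - m\<bar> \<le> \<bar>z x\<bar> + \<bar>m\<bar>" by linarith
    also have "\<dots> \<le> 2 * (\<tau> * max (\<bar>z x\<bar> / t) 1)"
    proof -
      have "\<bar>z x\<bar> = t * (\<bar>z x\<bar> / t)" using t by simp
      also have "\<dots> \<le> \<tau> * max (\<bar>z x\<bar> / t) 1" using tau t by (intro mult_mono) auto
      finally have "\<bar>z x\<bar> \<le> \<tau> * max (\<bar>z x\<bar> / t) 1" .
      moreover have "\<bar>m\<bar> \<le> \<tau> * max (\<bar>z x\<bar> / t) 1"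
        using tau mult_mono[of "\<bar>m\<bar>" \<tau> 1 "max (\<bar>z x\<bar> / t) 1"] by simp
      ultimately show ?thesis by simp
    qed
    finally have "\<bar>(z x - m) / (2 * L * \<tau>)\<bar> \<le> max \<bar>z x / t\<bar> 1 / L"
      using L tau t by (simp add: abs_mult field_simps)
    then have "\<bar>(z x - m) / (2 * L * \<tau>)\<bar> powr q x \<le> (max \<bar>z x / t\<bar> 1 / L) powr q x"
      using q1 by (intro powr_mono2) auto
    also have "\<dots> \<le> (\<bar>z x / t\<bar> powr q x + 1 powr q x) / L" using q1 L by (intro powr_max_divide_le) auto
    finally show ?thesis by simp
  qed
  have "modular q \<Omega> (\<lambda>x. (z x - m) / (2 * L * \<tau>))
     = (\<integral>\<^sup>+x. ennreal (\<bar>(z x - m) / (2 * L * \<tau>)\<bar> powr q x) \<partial>lebesgue_on \<Omega>)"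
    unfolding modular_def using Os by (subst nn_integral_restrict_space) auto
  also have "\<dots> \<le> (\<integral>\<^sup>+x. ennreal (1 / L) * (ennreal (\<bar>z x / t\<bar> powr q x) + 1) \<partial>lebesgue_on \<Omega>)"
  proof (rule nn_integral_mono_AE)
    show "AE x in lebesgue_on \<Omega>. ennreal (\<bar>(z x - m) / (2 * L * \<tau>)\<bar> powr q x)
       \<le> ennreal (1 / L) * (ennreal (\<bar>z x / t\<bar> powr q x) + 1)"
      using q
    proof eventually_elim
      case (elim x)
      have "ennreal (\<bar>(z x - m) / (2 * L * \<tau>)\<bar> powr q x) \<le> ennreal ((1 / L) * (\<bar>z x / t\<bar> powr q x + 1))"
        using pt[OF elim] by (rule ennreal_leI)
      also have "\<dots> = ennreal (1 / L) * (ennreal (\<bar>z x / t\<bar> powr q x) + 1)"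
        using L by (subst ennreal_mult) auto
      finally show ?case .
    qed
  qed
  also have "\<dots> = ennreal (1 / L) * ((\<integral>\<^sup>+x. ennreal (\<bar>z x / t\<bar> powr q x) \<partial>lebesgue_on \<Omega>) + emeasure (lebesgue_on \<Omega>) \<Omega>)"
    by (simp add: nn_integral_cmult nn_integral_add)
  also have "(\<integral>\<^sup>+x. ennreal (\<bar>z x / t\<bar> powr q x) \<partial>lebesgue_on \<Omega>) = modular q \<Omega> (\<lambda>x. z x / t)"
    unfolding modular_def using Os by (subst nn_integral_restrict_space) auto
  also have "emeasure (lebesgue_on \<Omega>) \<Omega> = ennreal (measure lebesgue \<Omega>)"
    using Om by (simp add: emeasure_restrict_space fmeasurableD emeasure_eq_measure2)
  also have "ennreal (1 / L) * (modular q \<Omega> (\<lambda>x. z x / t) + ennreal (measure lebesgue \<Omega>)) \<le> ennreal (1 / L) * (1 + ennreal (measure lebesgue \<Omega>))"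
    using t by (intro mult_left_mono add_right_mono) auto
  also have "\<dots> = ennreal ((1 / L) * L)" using L unfolding L_def by (subst ennreal_mult) auto
  also have "\<dots> = 1" using L by simp
  finally have "luxemburg_norm q \<Omega> (\<lambda>x. z x - m) < \<infinity>"
    using luxemburg_norm_finiteI[of "2 * L * \<tau>" q \<Omega> "\<lambda>x. z x - m"] tau L by simp
  then show ?thesis by (simp add: Lp_var_def)
qed

lemma Lp_var_zero: "(\<lambda>x. 0) \<in> Lp_var q \<Omega>"
  using luxemburg_norm_finiteI[of 1 q \<Omega> "\<lambda>x. 0"] by (simp add: Lp_var_def modular_def)

section \<open>Patch means on a mesh with variable exponent\<close>

lemma AE_notin_negligible: "negligible N \<Longrightarrow> AE x in lebesgue. x \<notin> N"
  by (simp add: negligible_iff_null_sets AE_not_in)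

text \<open>The closed elements reach beyond the domain, where functions have arbitrary values; since Lebesgue measure
  is complete, these values on a null set do not affect measurability.\<close>

lemma borel_measurable_extend_negligible:
  fixes f :: "'a::euclidean_space \<Rightarrow> real"
  assumes f: "f \<in> borel_measurable (lebesgue_on \<Omega>)" and sets: "\<Omega> \<in> sets lebesgue" "M \<in> sets lebesgue"
    and N: "negligible (M - \<Omega>)"
  shows "(\<lambda>x. indicator M x * f x) \<in> borel_measurable lebesgue"
proof (rule borel_measurable_AE)
  have "(\<lambda>x. indicator \<Omega> x *\<^sub>R f x) \<in> borel_measurable lebesgue"
    using f sets borel_measurable_restrict_space_iff[of \<Omega> lebesgue f] by simp
  then show "(\<lambda>x. indicator M x * (indicator \<Omega> x *\<^sub>R f x)) \<in> borel_measurable lebesgue"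
    using sets by (intro borel_measurable_times borel_measurable_indicator)
  show "AE x in lebesgue. indicator M x * (indicator \<Omega> x *\<^sub>R f x) = indicator M x * f x"
    using AE_notin_negligible[OF N] by eventually_elim (auto simp: indicator_def)
qed

locale variable_exponent_mesh = shape_regular_mesh \<Omega> \<T> w
  for \<Omega> :: "'a::euclidean_space set" and \<T> w +
  fixes p :: "'a \<Rightarrow> real" and c_log p_minus :: real
  assumes plog: "Plog \<Omega> p c_log" and p_minus_gt_1: "1 < p_minus"
    and p_minus_le: "AE x in lebesgue_on \<Omega>. p_minus \<le> p x"
    and bounded_domain: "bounded \<Omega>" and diameter_le_1: "\<And>T. T \<in> \<T> \<Longrightarrow> diameter T \<le> 1"
begin

abbreviation q :: "'a \<Rightarrow> real" where "q \<equiv> conj_exponent p"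

lemma domain_sets: "\<Omega> \<in> sets lebesgue" and domain_lmeasurable: "\<Omega> \<in> lmeasurable"
proof -
  have op: "open \<Omega>" using domain by (simp add: lipschitz_domain_def)
  then show "\<Omega> \<in> lmeasurable" using bounded_domain by (simp add: lmeasurable_open)
  then show "\<Omega> \<in> sets lebesgue" by (simp add: fmeasurableD)
qed

lemma patch_sets: "patch \<T> T \<in> sets lebesgue" and patch_lmeasurable: "patch \<T> T \<in> lmeasurable"
  using lmeasurable_compact[OF compact_patch] by (auto simp: fmeasurableD)

lemma AE_element_in_domain: "T \<in> \<T> \<Longrightarrow> AE x in lebesgue. x \<in> T \<longrightarrow> x \<in> \<Omega>"
  using AE_notin_negligible[OF negligible_element_diff] by fastforce

lemma AE_patch_in_domain: "AE x in lebesgue. x \<in> patch \<T> T \<longrightarrow> x \<in> \<Omega>"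
  using AE_notin_negligible[OF negligible_patch_diff] by fastforce

lemma AE_p_minus_le: "AE x in lebesgue. x \<in> \<Omega> \<longrightarrow> p_minus \<le> p x"
  using p_minus_le domain_sets by (simp add: AE_restrict_space_iff)

lemma AE_q_ge_1: "AE x in lebesgue. x \<in> \<Omega> \<longrightarrow> 1 \<le> q x"
  using AE_p_minus_le by eventually_elim (use p_minus_gt_1 in \<open>auto intro: conj_exponent_ge_1\<close>)

lemma AE_on_q_ge_1: "AE x in lebesgue_on \<Omega>. 1 \<le> q x"
  using AE_q_ge_1 domain_sets by (simp add: AE_restrict_space_iff)

lemma q_measurable: "q \<in> borel_measurable (lebesgue_on \<Omega>)"
proof -
  have [measurable]: "p \<in> borel_measurable (lebesgue_on \<Omega>)" using plog by (simp add: Plog_def)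
  show ?thesis unfolding conj_exponent_def[abs_def] by measurable
qed

lemma log_hoelder_bounds:
  obtains p_inf where "0 \<le> c_log"
    "\<And>x y. x \<in> \<Omega> \<Longrightarrow> y \<in> \<Omega> \<Longrightarrow> \<bar>p x - p y\<bar> \<le> c_log / ln (exp 1 + 1 / norm (x - y))"
    "\<And>x. x \<in> \<Omega> \<Longrightarrow> \<bar>p x - p_inf\<bar> \<le> c_log / ln (exp 1 + norm x)"
proof -
  obtain c1 c2 p_inf where c: "0 < c1" "0 < c2" "c_log = max c1 c2"
    and loc: "\<forall>x\<in>\<Omega>. \<forall>y\<in>\<Omega>. \<bar>p x - p y\<bar> \<le> c1 / ln (exp 1 + 1 / norm (x - y))"
    and dec: "\<forall>x\<in>\<Omega>. \<bar>p x - p_inf\<bar> \<le> c2 / ln (exp 1 + norm x)"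
    using plog unfolding Plog_def by blast
  have mono: "a / ln (exp 1 + t) \<le> c_log / ln (exp 1 + t)" if "a \<le> c_log" "0 \<le> t" for a t :: real
    using that one_le_ln_exp_add[of t] by (intro divide_right_mono) auto
  show ?thesis
  proof (rule that[of p_inf])
    show "0 \<le> c_log" using c by simp
    show "\<bar>p x - p y\<bar> \<le> c_log / ln (exp 1 + 1 / norm (x - y))" if "x \<in> \<Omega>" "y \<in> \<Omega>" for x y
      using loc that mono[of c1 "1 / norm (x - y)"] c by fastforce
    show "\<bar>p x - p_inf\<bar> \<le> c_log / ln (exp 1 + norm x)" if "x \<in> \<Omega>" for x
      using dec that mono[of c2 "norm x"] c by fastforce
  qed
qed

lemma patch_integrable:
  assumes u: "u \<in> borel_measurable (lebesgue_on \<Omega>)" and mod: "modular q (patch \<T> T) u \<le> 1"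
  shows "set_integrable lebesgue (patch \<T> T) (\<lambda>x. \<bar>u x\<bar> powr q x)"
    and "set_integrable lebesgue (patch \<T> T) (\<lambda>x. \<bar>u x\<bar>)"
    and "ennreal (LINT x:patch \<T> T|lebesgue. \<bar>u x\<bar> powr q x) = modular q (patch \<T> T) u"
proof -
  let ?M = "patch \<T> T"
  note [measurable] = u q_measurable
  have m1: "(\<lambda>x. indicator ?M x * (\<bar>u x\<bar> powr q x)) \<in> borel_measurable lebesgue"
    using domain_sets patch_sets negligible_patch_diff
    by (intro borel_measurable_extend_negligible[of _ \<Omega>]) measurable
  have m2: "(\<lambda>x. indicator ?M x * \<bar>u x\<bar>) \<in> borel_measurable lebesgue"
    using domain_sets patch_sets negligible_patch_diff
    by (intro borel_measurable_extend_negligible[of _ \<Omega>]) measurable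
  have nn: "(\<integral>\<^sup>+x. ennreal (indicator ?M x * (\<bar>u x\<bar> powr q x)) \<partial>lebesgue) = modular q ?M u"
    unfolding modular_def by (intro nn_integral_cong) (auto simp: indicator_def)
  have i1: "integrable lebesgue (\<lambda>x. indicator ?M x * (\<bar>u x\<bar> powr q x))"
  proof (rule integrableI_nonneg[OF m1])
    show "(\<integral>\<^sup>+x. ennreal (indicator ?M x * (\<bar>u x\<bar> powr q x)) \<partial>lebesgue) < \<infinity>"
      unfolding nn using mod by (simp add: le_less_trans)
  qed auto
  then show "set_integrable lebesgue ?M (\<lambda>x. \<bar>u x\<bar> powr q x)" by (simp add: set_integrable_def)
  show "ennreal (LINT x:?M|lebesgue. \<bar>u x\<bar> powr q x) = modular q ?M u"
    unfolding nn[symmetric] set_lebesgue_integral_def using i1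
    by (subst nn_integral_eq_integral) auto
  have "integrable lebesgue (\<lambda>x. indicator ?M x * \<bar>u x\<bar>)"
  proof (rule Bochner_Integration.integrable_bound[OF _ m2])
    show "integrable lebesgue (\<lambda>x. indicator ?M x + indicator ?M x * (\<bar>u x\<bar> powr q x))"
      using i1 patch_lmeasurable by (intro Bochner_Integration.integrable_add) (auto simp: lmeasurable_iff_integrable)
    show "AE x in lebesgue. norm (indicator ?M x * \<bar>u x\<bar>) \<le> norm (indicator ?M x + indicator ?M x * (\<bar>u x\<bar> powr q x))"
      using AE_q_ge_1 AE_patch_in_domain[of T]
    proof eventually_elim
      case (elim x)
      show ?case
      proof (cases "x \<in> ?M")
        case True
        then have "1 \<le> q x" using elim by simp
        then have "\<bar>u x\<bar> \<le> 1 + \<bar>u x\<bar> powr q x"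
          using powr_mono[of 1 "q x" "\<bar>u x\<bar>"] powr_ge_zero[of "\<bar>u x\<bar>" "q x"]
          by (cases "\<bar>u x\<bar> \<le> 1") (linarith, simp)
        then show ?thesis using True by simp
      qed simp
    qed
  qed
  then show "set_integrable lebesgue ?M (\<lambda>x. \<bar>u x\<bar>)" by (simp add: set_integrable_def)
qed

text \<open>The constant of \<open>half_mean_powr_log_hoelder\<close> for a patch: \<open>3 * patch_ratio\<close> bounds the diameter of the patch
  relative to that of the element, and \<open>unit_ball_vol d / (4 * w) ^ d\<close> its volume from below.\<close>

definition jensen_const :: real where
  "jensen_const = exp (c_log * (ln (1 + (4 * w) ^ DIM('a) / unit_ball_vol (real DIM('a)))
      + DIM('a) * (1 + ln (3 * patch_ratio)) + (DIM('a) + 2) * (2 + ln (1 + 3 * patch_ratio))) / (p_minus - 1)\<^sup>2)"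

lemma modular_patch_le_domain: "modular q (patch \<T> T) u \<le> modular q \<Omega> u"
  unfolding modular_def using AE_patch_in_domain[of T]
  by (intro nn_integral_mono_AE) (auto elim!: eventually_mono simp: indicator_def)

text \<open>Jensen's inequality for patch means, up to an error term whose sum over all elements is finite.\<close>

lemma half_patch_mean_modular_le:
  assumes T: "T \<in> \<T>" and u: "u \<in> borel_measurable (lebesgue_on \<Omega>)" and mod: "modular q (patch \<T> T) u \<le> 1"
    and s: "s = (LINT x:patch \<T> T|lebesgue. \<bar>u x\<bar>) / measure lebesgue (patch \<T> T) / 2"
  shows "(\<integral>\<^sup>+x\<in>T. ennreal (s powr q x) \<partial>lebesgue)
    \<le> ennreal jensen_const * modular q (patch \<T> T) u + (\<integral>\<^sup>+x\<in>T. ennreal (decay_weight x) \<partial>lebesgue)"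
proof -
  let ?M = "patch \<T> T" and ?I = "LINT x:patch \<T> T|lebesgue. \<bar>u x\<bar> powr q x"
  let ?m = "measure lebesgue (patch \<T> T)"
  define \<kappa> where "\<kappa> = unit_ball_vol (real DIM('a)) / (4 * w) ^ DIM('a)"
  note pint = patch_integrable[OF u mod]
  have kap: "0 < \<kappa>" using w_ge_1 by (simp add: \<kappa>_def)
  have TM: "measure lebesgue T \<le> ?m" by (rule element_measure_le_patch[OF T])
  have kapM: "\<kappa> * diameter T ^ DIM('a) \<le> ?m"
    using element_measure_ge[OF T] TM by (simp add: \<kappa>_def power_divide)
  have m0: "0 < ?m" using element_measure_pos[OF T] TM by linarith
  have I0: "0 \<le> ?I" unfolding set_lebesgue_integral_def by (intro integral_nonneg_AE) auto
  have "ennreal ?I \<le> 1" using pint(3) mod by simp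
  then have I1: "?I \<le> 1" using I0 by simp
  have J0: "0 \<le> jensen_const" by (simp add: jensen_const_def)
  obtain p_inf where c0: "0 \<le> c_log"
    and loc: "\<And>x y. x \<in> \<Omega> \<Longrightarrow> y \<in> \<Omega> \<Longrightarrow> \<bar>p x - p y\<bar> \<le> c_log / ln (exp 1 + 1 / norm (x - y))"
    and dec: "\<And>x. x \<in> \<Omega> \<Longrightarrow> \<bar>p x - p_inf\<bar> \<le> c_log / ln (exp 1 + norm x)"
    using log_hoelder_bounds by blast
  have "AE x in lebesgue. x \<in> T \<longrightarrow> s powr q x \<le> jensen_const * (?I / ?m) + decay_weight x"
    using AE_element_in_domain[OF T] AE_p_minus_le
  proof eventually_elim
    case (elim x)
    show ?case
    proof
      assume xT: "x \<in> T"
      with elim have x: "x \<in> \<Omega>" "p_minus \<le> p x" by auto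
      have y: "AE y in lebesgue. y \<in> ?M \<longrightarrow> p_minus \<le> p y \<and> \<bar>p x - p y\<bar> \<le> c_log / ln (exp 1 + 1 / norm (x - y))
         \<and> \<bar>p y - p_inf\<bar> \<le> c_log / ln (exp 1 + norm y) \<and> norm (x - y) \<le> 3 * patch_ratio * diameter T"
        using AE_patch_in_domain[of T] AE_p_minus_le
      proof eventually_elim
        case (elim y)
        show ?case
        proof
          assume "y \<in> ?M"
          moreover have "x \<in> ?M" using xT subset_patch[OF T] by blast
          ultimately show "p_minus \<le> p y \<and> \<bar>p x - p y\<bar> \<le> c_log / ln (exp 1 + 1 / norm (x - y))
             \<and> \<bar>p y - p_inf\<bar> \<le> c_log / ln (exp 1 + norm y) \<and> norm (x - y) \<le> 3 * patch_ratio * diameter T"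
            using elim x loc[of x y] dec[of y] patch_dist_le[OF T, of x y] by (simp add: dist_norm)
        qed
      qed
      have D: "1 \<le> 3 * patch_ratio" using patch_ratio_ge_1 by simp
      have "s powr q x \<le> exp (c_log * (ln (1 + 1 / \<kappa>) + DIM('a) * (1 + ln (3 * patch_ratio))
          + (DIM('a) + 2) * (2 + ln (1 + 3 * patch_ratio))) / (p_minus - 1)\<^sup>2) * (?I / ?m) + decay_weight x"
        by (rule half_mean_powr_log_hoelder[OF patch_lmeasurable kap kapM element_diameter_pos[OF T]
           diameter_le_1[OF T] D c0 p_minus_gt_1 x(2) dec[OF x(1)] y _ pint(2) pint(1) I1 s refl]) simp
      then show "s powr q x \<le> jensen_const * (?I / ?m) + decay_weight x"
        by (simp add: jensen_const_def \<kappa>_def)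
    qed
  qed
  then have "(\<integral>\<^sup>+x\<in>T. ennreal (s powr q x) \<partial>lebesgue)
     \<le> (\<integral>\<^sup>+x. ennreal (jensen_const * (?I / ?m)) * indicator T x + ennreal (decay_weight x) * indicator T x \<partial>lebesgue)"
    using J0 I0 m0 decay_weight_bounds[where 'a = 'a]
    by (intro nn_integral_mono_AE)
      (auto simp: indicator_def ennreal_plus[symmetric] less_imp_le intro!: ennreal_leI elim!: eventually_mono simp del: ennreal_plus)
  also have "\<dots> = ennreal (jensen_const * (?I / ?m)) * emeasure lebesgue T + (\<integral>\<^sup>+x\<in>T. ennreal (decay_weight x) \<partial>lebesgue)"
  proof -
    have Ts: "T \<in> sets lebesgue" using lmeasurable_element[OF T] by (simp add: fmeasurableD)
    have "decay_weight \<in> borel_measurable (lborel :: 'a measure)"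
      unfolding decay_weight_def[abs_def] by measurable
    then have dm: "decay_weight \<in> borel_measurable (lebesgue :: 'a measure)"
      by (rule measurable_completion)
    show ?thesis
      using Ts dm by (subst nn_integral_add) (auto simp: nn_integral_cmult_indicator)
  qed
  also have "ennreal (jensen_const * (?I / ?m)) * emeasure lebesgue T \<le> ennreal jensen_const * ennreal ?I"
  proof -
    have "emeasure lebesgue T = ennreal (measure lebesgue T)"
      using lmeasurable_element[OF T] by (simp add: emeasure_eq_measure2)
    then have "ennreal (jensen_const * (?I / ?m)) * emeasure lebesgue T = ennreal (jensen_const * (?I / ?m) * measure lebesgue T)"
      using J0 I0 m0 by (simp only:) (rule ennreal_mult[symmetric], auto)
    also have "\<dots> \<le> ennreal (jensen_const * (?I / ?m) * ?m)"
      using TM J0 I0 m0 by (intro ennreal_leI mult_left_mono) auto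
    also have "\<dots> = ennreal jensen_const * ennreal ?I" using m0 J0 I0 by (simp add: ennreal_mult)
    finally show ?thesis .
  qed
  finally show ?thesis using pint(3) by (simp add: add_right_mono)
qed

end

section \<open>The pointwise projection error\<close>

context variable_exponent_mesh
begin

definition patch_mean_abs :: "'a set \<Rightarrow> ('a \<Rightarrow> real) \<Rightarrow> real" where
  "patch_mean_abs T v = integral_mean (patch \<T> T) (\<lambda>x. \<bar>v x\<bar>)"

lemma patch_measure_pos: "T \<in> \<T> \<Longrightarrow> 0 < measure lebesgue (patch \<T> T)"
  using element_measure_pos element_measure_le_patch by (meson less_le_trans)

lemma Lp_var_patch_integrable:
  assumes "v \<in> Lp_var q \<Omega>"
  shows "set_integrable lebesgue (patch \<T> T) (\<lambda>x. \<bar>v x\<bar>)"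
proof -
  have v[measurable]: "v \<in> borel_measurable (lebesgue_on \<Omega>)" using assms by (simp add: Lp_var_def)
  obtain t where t: "0 < t" "modular q \<Omega> (\<lambda>x. v x / t) \<le> 1"
    using assms luxemburg_norm_finiteE by (force simp: Lp_var_def)
  have "modular q (patch \<T> T) (\<lambda>x. v x / t) \<le> 1"
    using modular_patch_le_domain t(2) by (rule order_trans)
  then have "set_integrable lebesgue (patch \<T> T) (\<lambda>x. \<bar>v x / t\<bar>)"
    by (intro patch_integrable(2)) measurable
  then have "set_integrable lebesgue (patch \<T> T) (\<lambda>x. t * \<bar>v x / t\<bar>)"
    by (intro set_integrable_mult_right)
  moreover have "(\<lambda>x. t * \<bar>v x / t\<bar>) = (\<lambda>x. \<bar>v x\<bar>)" using t by auto
  ultimately show ?thesis by simp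
qed

text \<open>A function that exceeds its mean almost everywhere would have a strictly larger integral.\<close>

lemma exists_point_le_patch_mean:
  assumes T: "T \<in> \<T>" and v: "set_integrable lebesgue (patch \<T> T) (\<lambda>x. \<bar>v x\<bar>)"
    and P: "AE x in lebesgue. x \<in> \<Omega> \<longrightarrow> P x"
  obtains y where "y \<in> patch \<T> T" "y \<in> \<Omega>" "P y" "\<bar>v y\<bar> \<le> patch_mean_abs T v"
proof -
  let ?M = "patch \<T> T" and ?a = "patch_mean_abs T v"
  note m0 = patch_measure_pos[OF T]
  have "\<exists>y. y \<in> ?M \<and> y \<in> \<Omega> \<and> P y \<and> \<bar>v y\<bar> \<le> ?a"
  proof (rule ccontr)
    assume none: "\<not> ?thesis"
    let ?f = "\<lambda>x. indicator ?M x * (\<bar>v x\<bar> - ?a)"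
    have gt: "AE x in lebesgue. x \<in> ?M \<longrightarrow> ?a < \<bar>v x\<bar>"
      using P AE_patch_in_domain[of T] by eventually_elim (use none in force)
    have i1: "integrable lebesgue (\<lambda>x. indicator ?M x * \<bar>v x\<bar>)" using v by (simp add: set_integrable_def)
    have i2: "integrable lebesgue (\<lambda>x. indicator ?M x * ?a)"
      using patch_lmeasurable by (simp add: lmeasurable_iff_integrable)
    have fint: "integrable lebesgue ?f"
      using Bochner_Integration.integrable_diff[OF i1 i2] by (simp add: right_diff_distrib)
    have "integral\<^sup>L lebesgue ?f = (LINT x|lebesgue. indicator ?M x * \<bar>v x\<bar>) - (LINT x|lebesgue. indicator ?M x * ?a)"
      using Bochner_Integration.integral_diff[OF i1 i2] by (simp add: right_diff_distrib)
    also have "(LINT x|lebesgue. indicator ?M x * ?a) = measure lebesgue ?M * ?a"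
      using patch_lmeasurable by (simp add: lmeasurable_iff_integrable fmeasurableD)
    also have "(LINT x|lebesgue. indicator ?M x * \<bar>v x\<bar>) = measure lebesgue ?M * ?a"
      using m0 by (simp add: patch_mean_abs_def integral_mean_def set_lebesgue_integral_def)
    finally have "integral\<^sup>L lebesgue ?f = 0" by simp
    moreover have "AE x in lebesgue. 0 \<le> ?f x" using gt by eventually_elim (auto simp: indicator_def)
    ultimately have "AE x in lebesgue. ?f x = 0" using integral_nonneg_eq_0_iff_AE[OF fint] by simp
    then have "AE x in lebesgue. x \<notin> ?M" using gt by eventually_elim (auto simp: indicator_def)
    then have "?M \<in> null_sets lebesgue" using patch_sets by (simp add: AE_iff_null_sets)
    then show False using m0 by (simp add: measure_eq_0_null_sets)
  qed
  then show ?thesis using that by blast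
qed

text \<open>The constant is the value of \<open>z\<close> at a point of the patch at which \<open>g\<close> is at most its mean and for which the
  Hajlasz inequality holds with almost every second point.\<close>

lemma hajlasz_patch_oscillation:
  assumes T: "T \<in> \<T>" and \<gamma>: "0 < \<gamma>" "\<gamma> \<le> 1" and g: "g \<in> hajlasz_gradients \<gamma> q \<Omega> z"
  obtains m where "AE y in lebesgue. y \<in> patch \<T> T \<longrightarrow>
    \<bar>z y - m\<bar> \<le> 3 * patch_ratio * diameter T powr \<gamma> * (\<bar>g y\<bar> + patch_mean_abs T g)"
proof -
  let ?M = "patch \<T> T" and ?a = "patch_mean_abs T g" and ?D = "3 * patch_ratio"
  have D1: "1 \<le> ?D" using patch_ratio_ge_1 by simp
  have h0: "0 < diameter T" using element_diameter_pos[OF T] .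
  have gL: "g \<in> Lp_var q \<Omega>" and g0: "\<And>x. x \<in> \<Omega> \<Longrightarrow> 0 \<le> g x"
    and haj: "AE x in lebesgue_on \<Omega>. AE y in lebesgue_on \<Omega>. \<bar>z x - z y\<bar> \<le> (g x + g y) * norm (x - y) powr \<gamma>"
    using g by (auto simp: hajlasz_gradients_def)
  have haj': "AE x in lebesgue. x \<in> \<Omega> \<longrightarrow> (AE y in lebesgue. y \<in> \<Omega> \<longrightarrow> \<bar>z x - z y\<bar> \<le> (g x + g y) * norm (x - y) powr \<gamma>)"
    using haj domain_sets by (simp add: AE_restrict_space_iff)
  obtain y0 where y0: "y0 \<in> ?M" "y0 \<in> \<Omega>" "\<bar>g y0\<bar> \<le> ?a"
    and ae: "AE y in lebesgue. y \<in> \<Omega> \<longrightarrow> \<bar>z y0 - z y\<bar> \<le> (g y0 + g y) * norm (y0 - y) powr \<gamma>"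
    by (rule exists_point_le_patch_mean[OF T Lp_var_patch_integrable[OF gL] haj']) blast
  have "AE y in lebesgue. y \<in> ?M \<longrightarrow> \<bar>z y - z y0\<bar> \<le> ?D * diameter T powr \<gamma> * (\<bar>g y\<bar> + ?a)"
    using ae AE_patch_in_domain[of T]
  proof eventually_elim
    case (elim y)
    show ?case
    proof
      assume yM: "y \<in> ?M"
      have "norm (y0 - y) powr \<gamma> \<le> (?D * diameter T) powr \<gamma>"
        using patch_dist_le[OF T y0(1) yM] \<gamma> by (intro powr_mono2) (auto simp: dist_norm)
      also have "\<dots> = ?D powr \<gamma> * diameter T powr \<gamma>" using D1 h0 by (simp add: powr_mult)
      also have "\<dots> \<le> ?D powr 1 * diameter T powr \<gamma>"
        using D1 \<gamma> by (intro mult_right_mono powr_mono) auto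
      finally have le: "norm (y0 - y) powr \<gamma> \<le> ?D * diameter T powr \<gamma>" using D1 by simp
      have "\<bar>z y - z y0\<bar> \<le> (g y0 + g y) * norm (y0 - y) powr \<gamma>" using elim yM by (simp add: abs_minus_commute)
      also have "\<dots> \<le> (\<bar>g y\<bar> + ?a) * (?D * diameter T powr \<gamma>)"
        using le y0 g0[of y0] g0[of y] elim yM by (intro mult_mono) auto
      finally show "\<bar>z y - z y0\<bar> \<le> ?D * diameter T powr \<gamma> * (\<bar>g y\<bar> + ?a)" by (simp add: mult_ac)
    qed
  qed
  then show ?thesis by (rule that)
qed

lemma patch_mean_abs_nonneg: "0 \<le> patch_mean_abs T v"
  unfolding patch_mean_abs_def integral_mean_def set_lebesgue_integral_def
  by (intro divide_nonneg_nonneg integral_nonneg_AE) auto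

lemma element_measure_le:
  assumes T: "T \<in> \<T>"
  shows "measure lebesgue T \<le> unit_ball_vol (real DIM('a)) * diameter T ^ DIM('a)"
proof -
  obtain v where v: "v \<in> T" using element_nonempty[OF T] by blast
  have d0: "0 \<le> diameter T" using element_diameter_pos[OF T] by simp
  have "T \<subseteq> cball v (diameter T)"
    using v element_bounded[OF T] diameter_bounded_bound by auto
  then have "measure lebesgue T \<le> measure lebesgue (cball v (diameter T))"
    using lmeasurable_element[OF T] by (intro measure_mono_fmeasurable) (auto simp: fmeasurableD)
  also have "\<dots> = unit_ball_vol (real DIM('a)) * diameter T ^ DIM('a)"
    using content_cball[OF d0, of v] by simp
  finally show ?thesis .
qed

end

text \<open>The projection maps the constant \<open>m\<close> to itself, so the error equals \<open>(z - m) - P (z - m)\<close> almost everywhere.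
  The first term is bounded by the oscillation estimate. The second one is a polynomial on \<open>T\<close>, bounded by its mean
  over \<open>T\<close>, hence by stability through the mean of \<open>z - m\<close> over the patch.\<close>

lemma projection_error_pointwise:
  fixes \<Omega> :: "(real ^ 'n) set"
  assumes mesh: "variable_exponent_mesh \<Omega> \<T> w p c_log p_minus"
    and V: "fe_space l \<T> V" and lin: "linear_projection \<Omega> (Lp_var (conj_exponent p) \<Omega>) V P"
    and stab: "locally_L1_stable \<T> (Lp_var (conj_exponent p) \<Omega>) P c" and c: "0 \<le> c"
    and \<gamma>: "0 < \<gamma>" "\<gamma> \<le> 1" and z: "z \<in> Lp_var (conj_exponent p) \<Omega>"
    and g: "g \<in> hajlasz_gradients \<gamma> (conj_exponent p) \<Omega> z" and T: "T \<in> \<T>"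
    and K: "K = 3 * W * (1 + 2 * (2 ^ (l + 1) * real (l + 1) ^ CARD('n) * (4 * w) ^ CARD('n) * c))"
    and W: "W = w ^ nat \<lceil>(8 * w) ^ CARD('n)\<rceil>"
  shows "AE x in lebesgue. x \<in> T \<longrightarrow> \<bar>z x - P z x\<bar> \<le>
    K * diameter T powr \<gamma> * (\<bar>g x\<bar> + integral_mean (patch \<T> T) (\<lambda>y. \<bar>g y\<bar>))"
proof -
  interpret variable_exponent_mesh \<Omega> \<T> w p c_log p_minus by (rule mesh)
  let ?M = "patch \<T> T"
  define a where "a = patch_mean_abs T g"
  define R where "R = 3 * patch_ratio * diameter T powr \<gamma>"
  define B where "B = 2 ^ (l + 1) * real (l + 1) ^ CARD('n) * (4 * w) ^ CARD('n)"
  have W': "patch_ratio = W" by (simp add: W patch_ratio_def)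
  have a0: "0 \<le> a" unfolding a_def by (rule patch_mean_abs_nonneg)
  have R0: "0 \<le> R" using patch_ratio_ge_1 by (simp add: R_def)
  have B0: "0 \<le> B" using w_ge_1 by (simp add: B_def)
  obtain m where osc: "AE y in lebesgue. y \<in> ?M \<longrightarrow> \<bar>z y - m\<bar> \<le> R * (\<bar>g y\<bar> + a)"
    using hajlasz_patch_oscillation[OF T \<gamma> g] unfolding R_def a_def by blast
  define v where "v = (\<lambda>x. z x - m)"
  have diffL: "(\<lambda>x. f x - b) \<in> Lp_var q \<Omega>" if "f \<in> Lp_var q \<Omega>" for f b
    using Lp_var_diff_const[OF domain_lmeasurable AE_on_q_ge_1 q_measurable that] .
  have vL: "v \<in> Lp_var q \<Omega>" unfolding v_def using z by (rule diffL)
  have oneL: "(\<lambda>x. 1) \<in> Lp_var q \<Omega>" using diffL[OF Lp_var_zero, of "-1"] by simp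
  have oneV: "(\<lambda>x. 1) \<in> V" using V by (simp add: fe_space_def)
  have Pv: "AE x in lebesgue. x \<in> \<Omega> \<longrightarrow> P v x = P z x - m"
  proof -
    have "AE x in lebesgue_on \<Omega>. P (\<lambda>y. 1 * z y + (- m) * 1) x = 1 * P z x + (- m) * P (\<lambda>y. 1) x"
      by (rule lin[unfolded linear_projection_def, THEN conjunct2, THEN conjunct2, THEN conjunct1,
            rule_format, OF z oneL])
    moreover have "AE x in lebesgue_on \<Omega>. P (\<lambda>x. 1) x = 1"
      using lin oneV unfolding linear_projection_def by blast
    ultimately have "AE x in lebesgue_on \<Omega>. P v x = P z x - m"
      by eventually_elim (simp add: v_def)
    then show ?thesis using domain_sets by (simp add: AE_restrict_space_iff)
  qed
  have gL: "g \<in> Lp_var q \<Omega>" using g by (simp add: hajlasz_gradients_def)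
  have m0: "0 < measure lebesgue ?M" by (rule patch_measure_pos[OF T])
  have Tm0: "0 < measure lebesgue T" by (rule element_measure_pos[OF T])
  have Tsets: "T \<in> sets lebesgue" using lmeasurable_element[OF T] by (simp add: fmeasurableD)
  have mean_v: "integral_mean ?M (\<lambda>x. \<bar>v x\<bar>) \<le> 2 * a * R"
  proof -
    have i1: "integrable lebesgue (\<lambda>x. indicator ?M x * \<bar>g x\<bar>)"
      using Lp_var_patch_integrable[OF gL, of T] by (simp add: set_integrable_def)
    have i2: "integrable lebesgue (\<lambda>x. indicator ?M x * a)"
      using patch_lmeasurable by (simp add: lmeasurable_iff_integrable)
    have i: "integrable lebesgue (\<lambda>x. R * (indicator ?M x * \<bar>g x\<bar> + indicator ?M x * a))"
      using i1 i2 by (intro integrable_mult_right Bochner_Integration.integrable_add)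
    have "(LINT x:?M|lebesgue. \<bar>v x\<bar>) \<le> (LINT x|lebesgue. R * (indicator ?M x * \<bar>g x\<bar> + indicator ?M x * a))"
      unfolding set_lebesgue_integral_def
    proof (rule integral_mono_AE'[OF i])
      show "AE x in lebesgue. indicator ?M x *\<^sub>R \<bar>v x\<bar> \<le> R * (indicator ?M x * \<bar>g x\<bar> + indicator ?M x * a)"
        using osc by eventually_elim (auto simp: indicator_def v_def)
      show "AE x in lebesgue. 0 \<le> R * (indicator ?M x * \<bar>g x\<bar> + indicator ?M x * a)"
        using R0 a0 by (intro AE_I2) (auto intro!: mult_nonneg_nonneg add_nonneg_nonneg)
    qed
    also have "\<dots> = R * ((LINT x|lebesgue. indicator ?M x * \<bar>g x\<bar>) + (LINT x|lebesgue. indicator ?M x * a))"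
      by (simp only: integral_mult_right_zero Bochner_Integration.integral_add[OF i1 i2])
    also have "(LINT x|lebesgue. indicator ?M x * a) = measure lebesgue ?M * a"
      using patch_lmeasurable by (simp add: lmeasurable_iff_integrable fmeasurableD)
    also have "(LINT x|lebesgue. indicator ?M x * \<bar>g x\<bar>) = measure lebesgue ?M * a"
      using m0 by (simp add: a_def patch_mean_abs_def integral_mean_def set_lebesgue_integral_def)
    finally show ?thesis using m0 by (simp add: integral_mean_def field_simps)
  qed
  obtain r where r: "r \<in> polynomials_upto l" and Pr: "AE x in lebesgue. x \<in> T \<longrightarrow> P v x = r x"
  proof -
    have "P v \<in> V" using lin vL unfolding linear_projection_def by blast
    then have "P v \<in> piecewise_polynomials l \<T>" using V by (auto simp: fe_space_def)
    then obtain r where "r \<in> polynomials_upto l" "AE x in lebesgue_on T. P v x = r x"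
      using T unfolding piecewise_polynomials_def by blast
    then show ?thesis using that Tsets by (simp add: AE_restrict_space_iff)
  qed
  have mean_r: "integral_mean T (\<lambda>x. \<bar>r x\<bar>) \<le> c * (2 * a * R)"
  proof -
    have rm: "r \<in> borel_measurable lborel"
      using borel_measurable_continuous_onI[OF continuous_on_polynomials_upto[OF r]] by simp
    have m1: "(\<lambda>x. indicator T x * \<bar>r x\<bar>) \<in> borel_measurable lebesgue"
      using Tsets measurable_completion[OF rm] by simp
    have ae: "AE x in lebesgue. indicator T x * \<bar>r x\<bar> = indicator T x * \<bar>P v x\<bar>"
      using Pr by eventually_elim (auto simp: indicator_def)
    have "(LINT x|lebesgue. indicator T x * \<bar>r x\<bar>) = (LINT x|lebesgue. indicator T x * \<bar>P v x\<bar>)"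
      by (rule Bochner_Integration.integral_cong_AE[OF m1 borel_measurable_AE[OF m1 ae] ae])
    then have "integral_mean T (\<lambda>x. \<bar>r x\<bar>) = integral_mean T (\<lambda>x. \<bar>P v x\<bar>)"
      by (simp add: integral_mean_def set_lebesgue_integral_def)
    also have "\<dots> \<le> c * integral_mean ?M (\<lambda>x. \<bar>v x\<bar>)"
      using stab vL T unfolding locally_L1_stable_def by blast
    also have "\<dots> \<le> c * (2 * a * R)" using mean_v c by (intro mult_left_mono)
    finally show ?thesis .
  qed
  have sup_r: "\<bar>r x\<bar> \<le> B * (c * (2 * a * R))" if x: "x \<in> T" for x
  proof -
    let ?I = "LINT y:T|lebesgue. \<bar>r y\<bar>" and ?ub = "unit_ball_vol (real CARD('n))"
    \<comment> \<open>\<open>T\<close> lies in a ball of radius \<open>diameter T\<close>, so its volume is at most \<open>(4 * w) ^ CARD('n)\<close> times that of the inscribed ball.\<close>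
    obtain b s where bs: "0 < s" "ball b s \<subseteq> T" "diameter T \<le> 4 * w * s"
      using element_contains_ball[OF T] by blast
    have I0: "0 \<le> integral_mean T (\<lambda>x. \<bar>r x\<bar>)"
      unfolding integral_mean_def set_lebesgue_integral_def
      by (intro divide_nonneg_nonneg integral_nonneg_AE) auto
    have ball_vol: "measure lebesgue (ball b s) = ?ub * s ^ CARD('n)"
      using content_ball[of s b] bs by simp
    have ball0: "0 < measure lebesgue (ball b s)" using bs unfolding ball_vol by simp
    have "measure lebesgue T \<le> ?ub * diameter T ^ CARD('n)" using element_measure_le[OF T] by simp
    also have "\<dots> \<le> ?ub * (4 * w * s) ^ CARD('n)"
      using bs element_diameter_pos[OF T] by (intro mult_left_mono power_mono) auto
    also have "\<dots> = (4 * w) ^ CARD('n) * measure lebesgue (ball b s)"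
      unfolding ball_vol by (simp add: power_mult_distrib)
    finally have vol: "measure lebesgue T \<le> (4 * w) ^ CARD('n) * measure lebesgue (ball b s)" .
    have "\<bar>r x\<bar> * measure lebesgue (ball b s) \<le> 2 ^ (l + 1) * real (l + 1) ^ CARD('n) * ?I"
      by (rule polynomial_inverse_estimate[OF r element_compact[OF T] element_convex[OF T] x bs(2,1)])
    also have "?I = integral_mean T (\<lambda>x. \<bar>r x\<bar>) * measure lebesgue T"
      using Tm0 by (simp add: integral_mean_def)
    also have "2 ^ (l + 1) * real (l + 1) ^ CARD('n) * (integral_mean T (\<lambda>x. \<bar>r x\<bar>) * measure lebesgue T)
        \<le> 2 ^ (l + 1) * real (l + 1) ^ CARD('n) * (integral_mean T (\<lambda>x. \<bar>r x\<bar>) * ((4 * w) ^ CARD('n) * measure lebesgue (ball b s)))"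
      using vol I0 by (intro mult_left_mono) auto
    also have "\<dots> = B * integral_mean T (\<lambda>x. \<bar>r x\<bar>) * measure lebesgue (ball b s)"
      by (simp add: B_def mult_ac)
    finally have "\<bar>r x\<bar> \<le> B * integral_mean T (\<lambda>x. \<bar>r x\<bar>)" using ball0 by simp
    also have "\<dots> \<le> B * (c * (2 * a * R))" using mean_r B0 by (rule mult_left_mono)
    finally show ?thesis .
  qed
  have KR: "K * diameter T powr \<gamma> = R * (1 + 2 * (B * c))" by (simp add: K R_def W' B_def mult_ac)
  show ?thesis
    using osc Pr Pv AE_element_in_domain[OF T]
  proof eventually_elim
    case (elim x)
    show ?case
    proof
      assume x: "x \<in> T"
      then have xM: "x \<in> ?M" using subset_patch[OF T] by blast
      have "z x - P z x = (z x - m) - r x" using elim x by auto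
      then have "\<bar>z x - P z x\<bar> \<le> \<bar>z x - m\<bar> + \<bar>r x\<bar>" by linarith
      also have "\<dots> \<le> R * (\<bar>g x\<bar> + a) + B * (c * (2 * a * R))"
        using elim xM sup_r[OF x] by (intro add_mono) auto
      also have "\<dots> \<le> R * (\<bar>g x\<bar> + a) + B * (c * (2 * (\<bar>g x\<bar> + a) * R))"
        using B0 c R0 by (intro add_left_mono mult_left_mono mult_right_mono) auto
      also have "\<dots> = K * diameter T powr \<gamma> * (\<bar>g x\<bar> + a)" unfolding KR by (simp add: algebra_simps)
      finally show "\<bar>z x - P z x\<bar> \<le> K * diameter T powr \<gamma> * (\<bar>g x\<bar> + integral_mean ?M (\<lambda>y. \<bar>g y\<bar>))"
        by (simp add: a_def patch_mean_abs_def)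
    qed
  qed
qed

section \<open>From pointwise bounds to Luxemburg norms\<close>

context variable_exponent_mesh
begin

definition patch_overlap :: real where
  "patch_overlap = (8 * w) ^ DIM('a) * (16 * w * patch_ratio ^ 2) ^ DIM('a)"

definition decay_mass :: real where
  "decay_mass = enn2real (\<integral>\<^sup>+x. ennreal (decay_weight (x :: 'a)) \<partial>lebesgue)"

text \<open>The divisor that brings the sum of all contributions to the modular below one: the terms from \<open>g\<close> and from the
  Jensen-type estimate, counted once for each patch over a point, and the mass of the decay weight, counted once for
  each element over a point.\<close>

definition modular_const :: real where
  "modular_const = 1 + patch_overlap * (1 + jensen_const) + (8 * w) ^ DIM('a) * decay_mass"

lemma patch_overlap_ge_1: "1 \<le> patch_overlap"
proof -
  have "1 \<le> patch_ratio ^ 2" using patch_ratio_ge_1 by (rule one_le_power)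
  then have "1 * 1 \<le> (16 * w) * patch_ratio ^ 2" using w_ge_1 by (intro mult_mono) auto
  then have "1 \<le> (16 * w * patch_ratio ^ 2) ^ DIM('a)" by (intro one_le_power) simp
  moreover have "1 \<le> (8 * w) ^ DIM('a)" using w_ge_1 by (intro one_le_power) simp
  ultimately have "1 * 1 \<le> patch_overlap" unfolding patch_overlap_def by (intro mult_mono) auto
  then show ?thesis by simp
qed

lemma jensen_const_nonneg: "0 \<le> jensen_const"
  by (simp add: jensen_const_def)

lemma decay_mass_nonneg: "0 \<le> decay_mass"
  by (simp add: decay_mass_def)

lemma nn_integral_decay_weight: "(\<integral>\<^sup>+x. ennreal (decay_weight (x :: 'a)) \<partial>lebesgue) = ennreal decay_mass"
  unfolding decay_mass_def using nn_integral_decay_weight_finite[where 'a = 'a] by (simp add: less_top)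

lemma modular_const_ge_1: "1 \<le> modular_const"
proof -
  have "0 \<le> patch_overlap * (1 + jensen_const)" "0 \<le> (8 * w) ^ DIM('a) * decay_mass"
    using patch_overlap_ge_1 jensen_const_nonneg decay_mass_nonneg w_ge_1
    by (auto intro!: mult_nonneg_nonneg zero_le_power)
  then show ?thesis unfolding modular_const_def by linarith
qed

lemma card_patches_at_point_le:
  "real (card {T \<in> \<T>. x \<in> patch \<T> T}) \<le> patch_overlap"
proof -
  let ?A = "{T \<in> \<T>. x \<in> T}" and ?b = "(16 * w * patch_ratio ^ 2) ^ DIM('a)"
  have b0: "0 \<le> ?b" using w_ge_1 by simp
  have fin: "finite ?A" using finite_mesh by simp
  have "{T \<in> \<T>. x \<in> patch \<T> T} \<subseteq> (\<Union>T'\<in>?A. {T \<in> \<T>. T \<inter> T' \<noteq> {}})"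
    by (auto simp: patch_def)
  then have "card {T \<in> \<T>. x \<in> patch \<T> T} \<le> card (\<Union>T'\<in>?A. {T \<in> \<T>. T \<inter> T' \<noteq> {}})"
    using finite_mesh by (intro card_mono) auto
  also have "\<dots> \<le> (\<Sum>T'\<in>?A. card {T \<in> \<T>. T \<inter> T' \<noteq> {}})" by (rule card_UN_le[OF fin])
  finally have "real (card {T \<in> \<T>. x \<in> patch \<T> T}) \<le> (\<Sum>T'\<in>?A. real (card {T \<in> \<T>. T \<inter> T' \<noteq> {}}))"
    by (simp only: of_nat_sum[symmetric] of_nat_le_iff)
  also have "\<dots> \<le> (\<Sum>T'\<in>?A. ?b)" using card_patch_le by (intro sum_mono) auto
  also have "\<dots> = real (card ?A) * ?b" by simp
  also have "\<dots> \<le> patch_overlap"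
    unfolding patch_overlap_def using card_elements_at_point_le b0 by (rule mult_right_mono)
  finally show ?thesis .
qed

lemma decay_weight_measurable: "(\<lambda>x. ennreal (decay_weight x)) \<in> borel_measurable (lebesgue :: 'a measure)"
proof -
  have "(\<lambda>x. ennreal (decay_weight x)) \<in> borel_measurable (lborel :: 'a measure)"
    unfolding decay_weight_def[abs_def] by measurable
  then show ?thesis by (rule measurable_completion)
qed

lemma modular_integrand_measurable:
  assumes u: "u \<in> borel_measurable (lebesgue_on \<Omega>)"
    and M: "M \<in> sets lebesgue" "negligible (M - \<Omega>)"
  shows "(\<lambda>x. ennreal (\<bar>u x\<bar> powr q x) * indicator M x) \<in> borel_measurable lebesgue"
proof -
  note [measurable] = u q_measurable
  have "(\<lambda>x. indicator M x * (\<bar>u x\<bar> powr q x)) \<in> borel_measurable lebesgue"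
    using domain_sets M by (intro borel_measurable_extend_negligible[of _ \<Omega>]) measurable
  then have "(\<lambda>x. ennreal (indicator M x * (\<bar>u x\<bar> powr q x))) \<in> borel_measurable lebesgue" by measurable
  also have "(\<lambda>x. ennreal (indicator M x * (\<bar>u x\<bar> powr q x))) = (\<lambda>x. ennreal (\<bar>u x\<bar> powr q x) * indicator M x)"
    by (auto simp: indicator_def)
  finally show ?thesis .
qed

lemma sum_modular_patches_le:
  assumes u: "u \<in> borel_measurable (lebesgue_on \<Omega>)"
  shows "(\<Sum>T\<in>\<T>. modular q (patch \<T> T) u) \<le> ennreal patch_overlap * modular q \<Omega> u"
proof -
  let ?\<phi> = "\<lambda>x. ennreal (\<bar>u x\<bar> powr q x)"
  have "(\<Sum>T\<in>\<T>. modular q (patch \<T> T) u) = (\<integral>\<^sup>+x. (\<Sum>T\<in>\<T>. ?\<phi> x * indicator (patch \<T> T) x) \<partial>lebesgue)"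
    unfolding modular_def
    using modular_integrand_measurable[OF u patch_sets negligible_patch_diff] by (subst nn_integral_sum) auto
  also have "\<dots> \<le> (\<integral>\<^sup>+x. ennreal patch_overlap * (?\<phi> x * indicator \<Omega> x) \<partial>lebesgue)"
  proof (rule nn_integral_mono_AE)
    have "AE x in lebesgue. \<forall>T\<in>\<T>. x \<in> patch \<T> T \<longrightarrow> x \<in> \<Omega>"
      by (rule AE_finite_allI[OF finite_mesh AE_patch_in_domain])
    then show "AE x in lebesgue. (\<Sum>T\<in>\<T>. ?\<phi> x * indicator (patch \<T> T) x) \<le> ennreal patch_overlap * (?\<phi> x * indicator \<Omega> x)"
    proof eventually_elim
      case (elim x)
      have "(\<Sum>T\<in>\<T>. ?\<phi> x * indicator (patch \<T> T) x) = ?\<phi> x * (\<Sum>T\<in>\<T>. indicator (patch \<T> T) x)"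
        by (simp add: sum_distrib_left)
      also have "(\<Sum>T\<in>\<T>. indicator (patch \<T> T) x :: ennreal) = of_nat (card {T \<in> \<T>. x \<in> patch \<T> T})"
        using finite_mesh by (simp add: indicator_def if_distrib sum.If_cases Int_def)
      also have "?\<phi> x * \<dots> \<le> ennreal patch_overlap * (?\<phi> x * indicator \<Omega> x)"
      proof (cases "x \<in> \<Omega>")
        case True
        have "(of_nat (card {T \<in> \<T>. x \<in> patch \<T> T}) :: ennreal) \<le> ennreal patch_overlap"
          using card_patches_at_point_le[of x] by (auto simp: ennreal_of_nat_eq_real_of_nat intro!: ennreal_leI)
        then have "?\<phi> x * of_nat (card {T \<in> \<T>. x \<in> patch \<T> T}) \<le> ?\<phi> x * ennreal patch_overlap"
          by (rule mult_left_mono) simp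
        then show ?thesis using True by (simp add: mult.commute)
      next
        case False
        then have "{T \<in> \<T>. x \<in> patch \<T> T} = {}" using elim by blast
        then show ?thesis by (simp only: card.empty) simp
      qed
      finally show ?case .
    qed
  qed
  also have "\<dots> = ennreal patch_overlap * modular q \<Omega> u"
    unfolding modular_def
    using modular_integrand_measurable[OF u domain_sets] by (intro nn_integral_cmult) simp
  finally show ?thesis .
qed

lemma sum_decay_elements_le:
  "(\<Sum>T\<in>\<T>. \<integral>\<^sup>+x\<in>T. ennreal (decay_weight x) \<partial>lebesgue) \<le> ennreal ((8 * w) ^ DIM('a) * decay_mass)"
proof -
  have Ts: "T \<in> sets lebesgue" if "T \<in> \<T>" for T using lmeasurable_element[OF that] by (simp add: fmeasurableD)
  have "(\<Sum>T\<in>\<T>. \<integral>\<^sup>+x\<in>T. ennreal (decay_weight x) \<partial>lebesgue)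
      = (\<integral>\<^sup>+x. (\<Sum>T\<in>\<T>. ennreal (decay_weight x) * indicator T x) \<partial>lebesgue)"
    using Ts decay_weight_measurable by (subst nn_integral_sum) auto
  also have "\<dots> \<le> (\<integral>\<^sup>+x. ennreal ((8 * w) ^ DIM('a)) * ennreal (decay_weight (x :: 'a)) \<partial>lebesgue)"
  proof (rule nn_integral_mono)
    fix x
    have "(\<Sum>T\<in>\<T>. ennreal (decay_weight x) * indicator T x) = ennreal (decay_weight x) * (\<Sum>T\<in>\<T>. indicator T x)"
      by (simp add: sum_distrib_left)
    also have "(\<Sum>T\<in>\<T>. indicator T x :: ennreal) = of_nat (card {T \<in> \<T>. x \<in> T})"
      using finite_mesh by (simp add: indicator_def if_distrib sum.If_cases Int_def)
    also have "ennreal (decay_weight x) * \<dots> \<le> ennreal (decay_weight x) * ennreal ((8 * w) ^ DIM('a))"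
      using card_elements_at_point_le[of x]
      by (intro mult_left_mono) (auto simp: ennreal_of_nat_eq_real_of_nat intro!: ennreal_leI)
    finally show "(\<Sum>T\<in>\<T>. ennreal (decay_weight x) * indicator T x) \<le> ennreal ((8 * w) ^ DIM('a)) * ennreal (decay_weight x)"
      by (simp only: mult.commute)
  qed
  also have "\<dots> = ennreal ((8 * w) ^ DIM('a)) * ennreal decay_mass"
    using decay_weight_measurable by (simp add: nn_integral_cmult nn_integral_decay_weight)
  also have "\<dots> = ennreal ((8 * w) ^ DIM('a) * decay_mass)"
    using w_ge_1 decay_mass_nonneg by (simp add: ennreal_mult)
  finally show ?thesis .
qed

text \<open>The pointwise bound and convexity of the power bound the scaled error by the powers of \<open>g / t\<close> and of its
  half mean \<open>s\<close>. The statement asks for a measurable majorant because \<open>f\<close> may fail to be measurable, and only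
  measurable functions can be integrated termwise in the sum over the elements. The scale \<open>\<kappa>\<close> is
  \<open>diameter T powr \<gamma>\<close> for the estimate on one element and \<open>h powr \<gamma>\<close> for the one on the domain.\<close>

lemma scaled_error_majorant:
  fixes L :: real
  assumes T: "T \<in> \<T>" and g: "g \<in> borel_measurable (lebesgue_on \<Omega>)" and L: "1 \<le> L" and K: "0 < K"
    and f: "AE x in lebesgue. x \<in> T \<longrightarrow> \<bar>f x\<bar> \<le> K * diameter T powr \<gamma> * (\<bar>g x\<bar> + patch_mean_abs T g)"
    and \<kappa>: "diameter T powr \<gamma> \<le> \<kappa>" and t: "0 < t"
    and mod: "modular q (patch \<T> T) (\<lambda>x. g x / t) \<le> 1"
  obtains B where "B \<in> borel_measurable lebesgue"
    "AE x in lebesgue. x \<in> T \<longrightarrow> ennreal (\<bar>f x / (3 * K * L * \<kappa> * t)\<bar> powr q x) \<le> B x"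
    "(\<integral>\<^sup>+x. B x \<partial>lebesgue) \<le> ennreal (1 / L) * (ennreal (1 + jensen_const) * modular q (patch \<T> T) (\<lambda>x. g x / t)
        + (\<integral>\<^sup>+x\<in>T. ennreal (decay_weight x) \<partial>lebesgue))"
proof -
  let ?M = "patch \<T> T"
  define u where "u = (\<lambda>x. g x / t)"
  define s where "s = (LINT x:?M|lebesgue. \<bar>u x\<bar>) / measure lebesgue ?M / 2"
  note [measurable] = g
  have u: "u \<in> borel_measurable (lebesgue_on \<Omega>)" unfolding u_def by measurable
  have modu: "modular q ?M u \<le> 1" using mod by (simp add: u_def)
  have h0: "0 < diameter T" by (rule element_diameter_pos[OF T])
  have kap0: "0 < \<kappa>" 
  proof -
    have "0 < diameter T powr \<gamma>" using h0 by simp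
    then show ?thesis using \<kappa> by linarith
  qed
  have Ts: "T \<in> sets lebesgue" using lmeasurable_element[OF T] by (simp add: fmeasurableD)
  have mean: "patch_mean_abs T g = 2 * t * s"
    using t patch_measure_pos[OF T] by (simp add: patch_mean_abs_def integral_mean_def s_def u_def)
  have s0: "0 \<le> s" using patch_mean_abs_nonneg[of T g] t unfolding mean by (simp add: zero_le_mult_iff)
  define B where "B = (\<lambda>x. ennreal (1 / L) * (ennreal (\<bar>u x\<bar> powr q x) * indicator T x + ennreal (s powr q x) * indicator T x))"
  have m1: "(\<lambda>x. ennreal (\<bar>u x\<bar> powr q x) * indicator T x) \<in> borel_measurable lebesgue"
    using modular_integrand_measurable[OF u Ts negligible_element_diff[OF T]] .
  have m2: "(\<lambda>x. ennreal (s powr q x) * indicator T x) \<in> borel_measurable lebesgue"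
    using modular_integrand_measurable[of "\<lambda>_. s", OF _ Ts negligible_element_diff[OF T]] s0 by simp
  show ?thesis
  proof (rule that[of B])
    show "B \<in> borel_measurable lebesgue" unfolding B_def using m1 m2 by measurable
    show "AE x in lebesgue. x \<in> T \<longrightarrow> ennreal (\<bar>f x / (3 * K * L * \<kappa> * t)\<bar> powr q x) \<le> B x"
      using f AE_q_ge_1 AE_element_in_domain[OF T]
    proof eventually_elim
      case (elim x)
      show ?case
      proof
        assume x: "x \<in> T"
        then have q1: "1 \<le> q x" using elim by simp
        have gu: "\<bar>g x\<bar> = t * \<bar>u x\<bar>" using t by (simp add: u_def)
        have "\<bar>f x\<bar> \<le> K * diameter T powr \<gamma> * (\<bar>g x\<bar> + patch_mean_abs T g)" using elim x by simp
        also have "\<dots> \<le> K * \<kappa> * (t * \<bar>u x\<bar> + 2 * t * s)"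
          unfolding mean gu using \<kappa> kap0 K t s0 by (intro mult_mono mult_left_mono) auto
        also have "\<dots> \<le> K * \<kappa> * (3 * t * max \<bar>u x\<bar> s)"
        proof (intro mult_left_mono)
          have "t * \<bar>u x\<bar> \<le> t * max \<bar>u x\<bar> s" "t * s \<le> t * max \<bar>u x\<bar> s"
            by (intro mult_left_mono; use t in simp)+
          then show "t * \<bar>u x\<bar> + 2 * t * s \<le> 3 * t * max \<bar>u x\<bar> s" by linarith
        qed (use K kap0 in auto)
        also have "\<dots> = (3 * K * L * \<kappa> * t) * (max \<bar>u x\<bar> s / L)" using L by simp
        finally have "\<bar>f x\<bar> / (3 * K * L * \<kappa> * t) \<le> max \<bar>u x\<bar> s / L"
          using K L kap0 t by (subst divide_le_eq) (auto simp: mult_ac)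
        then have "\<bar>f x / (3 * K * L * \<kappa> * t)\<bar> \<le> max \<bar>u x\<bar> s / L"
          using K L kap0 t by (simp add: abs_mult)
        then have "\<bar>f x / (3 * K * L * \<kappa> * t)\<bar> powr q x \<le> (max \<bar>u x\<bar> s / L) powr q x"
          using q1 by (intro powr_mono2) auto
        also have "\<dots> \<le> (\<bar>u x\<bar> powr q x + s powr q x) / L"
          using q1 L s0 by (intro powr_max_divide_le) auto
        finally have "ennreal (\<bar>f x / (3 * K * L * \<kappa> * t)\<bar> powr q x) \<le> ennreal (1 / L * (\<bar>u x\<bar> powr q x + s powr q x))"
          by (intro ennreal_leI) simp
        also have "\<dots> = B x" unfolding B_def using x L by (subst ennreal_mult) auto
        finally show "ennreal (\<bar>f x / (3 * K * L * \<kappa> * t)\<bar> powr q x) \<le> B x" .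
      qed
    qed
    have "(\<integral>\<^sup>+x. B x \<partial>lebesgue) = ennreal (1 / L) * (modular q T u + (\<integral>\<^sup>+x\<in>T. ennreal (s powr q x) \<partial>lebesgue))"
      unfolding B_def modular_def using m1 m2 by (subst nn_integral_cmult) (auto simp: nn_integral_add)
    also have "\<dots> \<le> ennreal (1 / L) * (modular q ?M u + (ennreal jensen_const * modular q ?M u
        + (\<integral>\<^sup>+x\<in>T. ennreal (decay_weight x) \<partial>lebesgue)))"
    proof (intro mult_left_mono add_mono)
      show "modular q T u \<le> modular q ?M u" unfolding modular_def
        using subset_patch[OF T] by (intro nn_integral_mono) (auto simp: indicator_def)
      show "(\<integral>\<^sup>+x\<in>T. ennreal (s powr q x) \<partial>lebesgue) \<le> ennreal jensen_const * modular q ?M u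
        + (\<integral>\<^sup>+x\<in>T. ennreal (decay_weight x) \<partial>lebesgue)"
        by (rule half_patch_mean_modular_le[OF T u modu s_def])
    qed auto
    also have "\<dots> = ennreal (1 / L) * (ennreal (1 + jensen_const) * modular q ?M u
        + (\<integral>\<^sup>+x\<in>T. ennreal (decay_weight x) \<partial>lebesgue))"
      using jensen_const_nonneg by (simp add: distrib_right add.assoc)
    finally show "(\<integral>\<^sup>+x. B x \<partial>lebesgue) \<le> ennreal (1 / L) * (ennreal (1 + jensen_const) * modular q ?M (\<lambda>x. g x / t)
        + (\<integral>\<^sup>+x\<in>T. ennreal (decay_weight x) \<partial>lebesgue))" unfolding u_def .
  qed
qed

lemma luxemburg_norm_element_le:
  assumes T: "T \<in> \<T>" and g: "g \<in> borel_measurable (lebesgue_on \<Omega>)" and K: "0 < K"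
    and f: "AE x in lebesgue. x \<in> T \<longrightarrow> \<bar>f x\<bar> \<le> K * diameter T powr \<gamma> * (\<bar>g x\<bar> + patch_mean_abs T g)"
  shows "luxemburg_norm q T f \<le> ennreal (3 * K * modular_const * diameter T powr \<gamma>) * luxemburg_norm q (patch \<T> T) g"
proof (rule luxemburg_norm_le_cmult)
  let ?L = modular_const
  show "0 < 3 * K * ?L * diameter T powr \<gamma>" using K modular_const_ge_1 element_diameter_pos[OF T] by simp
  fix t :: real assume t: "0 < t" and mod: "modular q (patch \<T> T) (\<lambda>x. g x / t) \<le> 1"
  obtain B where "B \<in> borel_measurable lebesgue"
    and B: "AE x in lebesgue. x \<in> T \<longrightarrow> ennreal (\<bar>f x / (3 * K * ?L * diameter T powr \<gamma> * t)\<bar> powr q x) \<le> B x"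
    "(\<integral>\<^sup>+x. B x \<partial>lebesgue) \<le> ennreal (1 / ?L) * (ennreal (1 + jensen_const) * modular q (patch \<T> T) (\<lambda>x. g x / t)
        + (\<integral>\<^sup>+x\<in>T. ennreal (decay_weight x) \<partial>lebesgue))"
    by (rule scaled_error_majorant[OF T g modular_const_ge_1 K f order_refl t mod])
  have "modular q T (\<lambda>x. f x / (3 * K * ?L * diameter T powr \<gamma> * t)) \<le> (\<integral>\<^sup>+x. B x \<partial>lebesgue)"
    unfolding modular_def using B(1)
    by (intro nn_integral_mono_AE) (auto elim!: eventually_mono simp: indicator_def)
  also note B(2)
  also have "ennreal (1 / ?L) * (ennreal (1 + jensen_const) * modular q (patch \<T> T) (\<lambda>x. g x / t)
        + (\<integral>\<^sup>+x\<in>T. ennreal (decay_weight x) \<partial>lebesgue)) \<le> ennreal (1 / ?L) * (ennreal (1 + jensen_const) * 1 + ennreal decay_mass)"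
  proof (intro mult_left_mono add_mono mod)
    show "(\<integral>\<^sup>+x\<in>T. ennreal (decay_weight x) \<partial>lebesgue) \<le> ennreal decay_mass"
      unfolding nn_integral_decay_weight[symmetric] by (intro nn_integral_mono) (auto simp: indicator_def)
  qed auto
  also have "\<dots> = ennreal ((1 / ?L) * (1 + jensen_const + decay_mass))"
    using modular_const_ge_1 jensen_const_nonneg decay_mass_nonneg
    by (subst ennreal_mult) auto
  also have "\<dots> \<le> ennreal 1"
  proof (rule ennreal_leI)
    have "1 * (1 + jensen_const) \<le> patch_overlap * (1 + jensen_const)"
      using patch_overlap_ge_1 jensen_const_nonneg by (intro mult_right_mono) auto
    moreover have "1 * decay_mass \<le> (8 * w) ^ DIM('a) * decay_mass"
      using w_ge_1 decay_mass_nonneg by (intro mult_right_mono one_le_power) auto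
    ultimately have "1 + jensen_const + decay_mass \<le> ?L" by (simp add: modular_const_def)
    then show "(1 / ?L) * (1 + jensen_const + decay_mass) \<le> 1" using modular_const_ge_1 by simp
  qed
  finally show "modular q T (\<lambda>x. f x / (3 * K * ?L * diameter T powr \<gamma> * t)) \<le> 1" by simp
qed

text \<open>The norm cannot be summed over the elements, but the modular can: if the modular of \<open>g / t\<close> on the domain is at
  most one, so it is on every patch with the same \<open>t\<close>, and the resulting bounds add up with the finite overlap of
  the patches.\<close>

lemma luxemburg_norm_domain_le:
  assumes g: "g \<in> borel_measurable (lebesgue_on \<Omega>)" and K: "0 < K"
    and f: "\<And>T. T \<in> \<T> \<Longrightarrow> AE x in lebesgue. x \<in> T \<longrightarrow> \<bar>f x\<bar> \<le> K * diameter T powr \<gamma> * (\<bar>g x\<bar> + patch_mean_abs T g)"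
    and h: "0 < h" "\<And>T. T \<in> \<T> \<Longrightarrow> diameter T \<le> h" and \<gamma>: "0 < \<gamma>"
  shows "luxemburg_norm q \<Omega> f \<le> ennreal (3 * K * modular_const * h powr \<gamma>) * luxemburg_norm q \<Omega> g"
proof (rule luxemburg_norm_le_cmult)
  let ?L = modular_const
  show "0 < 3 * K * ?L * h powr \<gamma>" using K modular_const_ge_1 h by simp
  fix t :: real assume t: "0 < t" and mod: "modular q \<Omega> (\<lambda>x. g x / t) \<le> 1"
  note [measurable] = g
  let ?F = "\<lambda>x. ennreal (\<bar>f x / (3 * K * ?L * h powr \<gamma> * t)\<bar> powr q x)"
  let ?u = "\<lambda>x. g x / t"
  let ?R = "\<lambda>T. ennreal (1 / ?L) * (ennreal (1 + jensen_const) * modular q (patch \<T> T) ?u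
        + (\<integral>\<^sup>+x\<in>T. ennreal (decay_weight x) \<partial>lebesgue))"
  have "\<forall>T\<in>\<T>. \<exists>B. B \<in> borel_measurable lebesgue \<and> (AE x in lebesgue. x \<in> T \<longrightarrow> ?F x \<le> B x) \<and> (\<integral>\<^sup>+x. B x \<partial>lebesgue) \<le> ?R T"
  proof
    fix T assume T: "T \<in> \<T>"
    have hT: "diameter T powr \<gamma> \<le> h powr \<gamma>"
      using h(2)[OF T] element_diameter_pos[OF T] \<gamma> by (intro powr_mono2) auto
    have modT: "modular q (patch \<T> T) ?u \<le> 1"
      using modular_patch_le_domain mod by (rule order_trans)
    show "\<exists>B. B \<in> borel_measurable lebesgue \<and> (AE x in lebesgue. x \<in> T \<longrightarrow> ?F x \<le> B x) \<and> (\<integral>\<^sup>+x. B x \<partial>lebesgue) \<le> ?R T"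
      by (rule scaled_error_majorant[OF T g modular_const_ge_1 K f[OF T] hT t modT]) blast
  qed
  then obtain B where B: "\<forall>T\<in>\<T>. B T \<in> borel_measurable lebesgue \<and> (AE x in lebesgue. x \<in> T \<longrightarrow> ?F x \<le> B T x) \<and> (\<integral>\<^sup>+x. B T x \<partial>lebesgue) \<le> ?R T"
    by (rule bchoice[THEN exE])
  then have Bm: "\<And>T. T \<in> \<T> \<Longrightarrow> B T \<in> borel_measurable lebesgue"
    and FB: "\<And>T. T \<in> \<T> \<Longrightarrow> AE x in lebesgue. x \<in> T \<longrightarrow> ?F x \<le> B T x"
    and BR: "\<And>T. T \<in> \<T> \<Longrightarrow> (\<integral>\<^sup>+x. B T x \<partial>lebesgue) \<le> ?R T"
    by blast+
  have "modular q \<Omega> (\<lambda>x. f x / (3 * K * ?L * h powr \<gamma> * t)) \<le> (\<integral>\<^sup>+x. (\<Sum>T\<in>\<T>. B T x) \<partial>lebesgue)"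
    unfolding modular_def
  proof (rule nn_integral_mono_AE)
    have "AE x in lebesgue. \<forall>T\<in>\<T>. x \<in> T \<longrightarrow> ?F x \<le> B T x"
      by (rule AE_finite_allI[OF finite_mesh FB])
    then show "AE x in lebesgue. ?F x * indicator \<Omega> x \<le> (\<Sum>T\<in>\<T>. B T x)"
    proof eventually_elim
      case (elim x)
      show ?case
      proof (cases "x \<in> \<Omega>")
        case True
        then obtain T where T: "T \<in> \<T>" "x \<in> T" using Union_mesh closure_subset by blast
        then have "?F x \<le> B T x" using elim by blast
        also have "\<dots> \<le> (\<Sum>T\<in>\<T>. B T x)" using T finite_mesh by (intro member_le_sum) auto
        finally show ?thesis using True by simp
      qed simp
    qed
  qed
  also have "\<dots> = (\<Sum>T\<in>\<T>. \<integral>\<^sup>+x. B T x \<partial>lebesgue)" using Bm by (intro nn_integral_sum)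
  also have "\<dots> \<le> (\<Sum>T\<in>\<T>. ?R T)" using BR by (rule sum_mono)
  also have "\<dots> = ennreal (1 / ?L) * (ennreal (1 + jensen_const) * (\<Sum>T\<in>\<T>. modular q (patch \<T> T) ?u)
        + (\<Sum>T\<in>\<T>. \<integral>\<^sup>+x\<in>T. ennreal (decay_weight x) \<partial>lebesgue))"
    by (simp add: sum_distrib_left sum.distrib distrib_left)
  also have "\<dots> \<le> ennreal (1 / ?L) * (ennreal (1 + jensen_const) * (ennreal patch_overlap * 1)
        + ennreal ((8 * w) ^ DIM('a) * decay_mass))"
  proof (intro mult_left_mono add_mono sum_decay_elements_le)
    have "(\<Sum>T\<in>\<T>. modular q (patch \<T> T) ?u) \<le> ennreal patch_overlap * modular q \<Omega> ?u"
      by (intro sum_modular_patches_le) measurable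
    also have "\<dots> \<le> ennreal patch_overlap * 1" using mod by (intro mult_left_mono) auto
    finally show "(\<Sum>T\<in>\<T>. modular q (patch \<T> T) ?u) \<le> ennreal patch_overlap * 1" .
  qed auto
  also have "\<dots> = ennreal ((1 / ?L) * ((1 + jensen_const) * patch_overlap + (8 * w) ^ DIM('a) * decay_mass))"
  proof -
    have nn: "0 \<le> 1 + jensen_const" "0 \<le> patch_overlap" "0 \<le> (8 * w) ^ DIM('a) * decay_mass" "0 \<le> 1 / ?L"
      using modular_const_ge_1 jensen_const_nonneg decay_mass_nonneg patch_overlap_ge_1 w_ge_1 by auto
    show ?thesis using nn by (simp only: ennreal_mult ennreal_plus mult_nonneg_nonneg add_nonneg_nonneg mult_1_right)
  qed
  also have "\<dots> \<le> ennreal 1"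
  proof (rule ennreal_leI)
    have "(1 + jensen_const) * patch_overlap + (8 * w) ^ DIM('a) * decay_mass \<le> ?L"
      by (simp add: modular_const_def mult.commute)
    then show "(1 / ?L) * ((1 + jensen_const) * patch_overlap + (8 * w) ^ DIM('a) * decay_mass) \<le> 1"
      using modular_const_ge_1 by simp
  qed
  finally show "modular q \<Omega> (\<lambda>x. f x / (3 * K * ?L * h powr \<gamma> * t)) \<le> 1" by simp
qed

end

section \<open>The projection error estimate\<close>

lemma variable_exponent_meshI:
  fixes \<Omega> :: "'a::euclidean_space set"
  assumes Om: "simplicial_lipschitz_domain \<Omega>" and fam: "triangulation_family \<Omega> H \<T>"
    and chunk: "is_chunkiness H \<T> \<omega>" and p: "Plog \<Omega> p c_log" "exponent_inf \<Omega> p = ereal p_minus" "1 < p_minus"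
    and dim: "2 \<le> DIM('a)" and h: "h \<in> H"
  shows "variable_exponent_mesh \<Omega> (\<T> h) (max 1 \<omega>) p c_log p_minus"
proof
  have tri: "conforming_triangulation \<Omega> (\<T> h)" and hmax: "h = Max (diameter ` \<T> h)" and h1: "h \<le> 1"
    using fam h unfolding triangulation_family_def by auto
  have fin: "finite (\<T> h)" using tri by (simp add: conforming_triangulation_def triangulation_def)
  show "lipschitz_domain \<Omega>" "bounded \<Omega>" using Om by (auto simp: simplicial_lipschitz_domain_def)
  show "2 \<le> DIM('a)" "conforming_triangulation \<Omega> (\<T> h)" "Plog \<Omega> p c_log" "1 < p_minus" "1 \<le> max 1 \<omega>"
    by (fact dim tri p)+ simp
  show "diameter T / inball_diameter T \<le> max 1 \<omega>" if "T \<in> \<T> h" for T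
    using chunk h that unfolding is_chunkiness_def by (meson max.coboundedI2)
  show "diameter T \<le> 1" if "T \<in> \<T> h" for T
  proof -
    have "diameter T \<le> Max (diameter ` \<T> h)" using fin that by simp
    then show ?thesis using hmax h1 by linarith
  qed
  have "esssup (lebesgue_on \<Omega>) (\<lambda>x. - ereal (p x)) = - ereal p_minus"
    using p(2) unfolding exponent_inf_def by (metis ereal_uminus_uminus)
  then show "AE x in lebesgue_on \<Omega>. p_minus \<le> p x"
    using esssup_AE[of "\<lambda>x. - ereal (p x)" "lebesgue_on \<Omega>"] by auto
qed

theorem lemma5p13:
  fixes l :: nat and p_minus p_plus c_log \<omega>0 c_stab :: real
  assumes "CARD('n::finite) \<in> {2, 3}" and "1 < p_minus" and "0 < c_stab"
  shows "\<exists>C>0. \<forall>(\<Omega> :: (real ^ 'n) set) H \<T> p Qh P \<gamma> z g.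
    simplicial_lipschitz_domain \<Omega> \<longrightarrow>
    triangulation_family \<Omega> H \<T> \<longrightarrow>
    is_chunkiness H \<T> \<omega>0 \<longrightarrow>
    Plog \<Omega> p c_log \<longrightarrow>
    exponent_inf \<Omega> p = ereal p_minus \<longrightarrow>
    exponent_sup \<Omega> p = ereal p_plus \<longrightarrow>
    (\<forall>h\<in>H. fe_space l (\<T> h) (Qh h) \<and>
       linear_projection \<Omega> (Lp_var (conj_exponent p) \<Omega>) (Qh h) (P h) \<and>
       locally_L1_stable (\<T> h) (Lp_var (conj_exponent p) \<Omega>) (P h) c_stab) \<longrightarrow>
    0 < \<gamma> \<and> \<gamma> \<le> 1 \<longrightarrow>
    z \<in> hajlasz_space \<gamma> (conj_exponent p) \<Omega> \<longrightarrow>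
    is_minimal_hajlasz_gradient \<gamma> (conj_exponent p) \<Omega> z g \<longrightarrow>
    (\<forall>h\<in>H.
       (\<forall>T\<in>\<T> h. luxemburg_norm (conj_exponent p) T (\<lambda>x. z x - P h z x)
          \<le> ennreal (C * diameter T powr \<gamma>) * luxemburg_norm (conj_exponent p) (patch (\<T> h) T) g) \<and>
       luxemburg_norm (conj_exponent p) \<Omega> (\<lambda>x. z x - P h z x)
          \<le> ennreal (C * h powr \<gamma>) * luxemburg_norm (conj_exponent p) \<Omega> g)"
proof -
  \<comment> \<open>The constants of the mesh written out: they must be fixed before the domain and the mesh are.\<close>
  define w where "w = max 1 \<omega>0"
  define d where "d = CARD('n)"
  define W where "W = w ^ nat \<lceil>(8 * w) ^ d\<rceil>"
  define K where "K = 3 * W * (1 + 2 * (2 ^ (l + 1) * real (l + 1) ^ d * (4 * w) ^ d * c_stab))"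
  define J where "J = exp (c_log * (ln (1 + (4 * w) ^ d / unit_ball_vol (real d))
      + d * (1 + ln (3 * W)) + (d + 2) * (2 + ln (1 + 3 * W))) / (p_minus - 1)\<^sup>2)"
  define L where "L = 1 + (8 * w) ^ d * (16 * w * W ^ 2) ^ d * (1 + J)
      + (8 * w) ^ d * enn2real (\<integral>\<^sup>+x. ennreal (decay_weight (x :: real ^ 'n)) \<partial>lebesgue)"
  have w1: "1 \<le> w" by (simp add: w_def)
  have W1: "1 \<le> W" unfolding W_def using w1 by (rule one_le_power)
  have K0: "0 < K"
    unfolding K_def using W1 w1 \<open>0 < c_stab\<close>
    by (intro mult_pos_pos add_pos_nonneg mult_nonneg_nonneg zero_le_power) auto
  have L0: "0 < L"
    unfolding L_def J_def using W1 w1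
    by (intro add_pos_nonneg mult_nonneg_nonneg zero_le_power add_nonneg_nonneg) auto
  show ?thesis
  proof (intro exI[of _ "3 * K * L"] conjI allI impI ballI)
    show "0 < 3 * K * L" using K0 L0 by simp
  next
    fix \<Omega> :: "(real ^ 'n) set" and H \<T> p Qh P \<gamma> z g h
    assume Om: "simplicial_lipschitz_domain \<Omega>" and fam: "triangulation_family \<Omega> H \<T>"
      and chunk: "is_chunkiness H \<T> \<omega>0" and plog: "Plog \<Omega> p c_log"
      and pinf: "exponent_inf \<Omega> p = ereal p_minus"
      and fe: "\<forall>h\<in>H. fe_space l (\<T> h) (Qh h) \<and>
       linear_projection \<Omega> (Lp_var (conj_exponent p) \<Omega>) (Qh h) (P h) \<and>
       locally_L1_stable (\<T> h) (Lp_var (conj_exponent p) \<Omega>) (P h) c_stab"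
      and \<gamma>: "0 < \<gamma> \<and> \<gamma> \<le> 1" and z: "z \<in> hajlasz_space \<gamma> (conj_exponent p) \<Omega>"
      and g: "is_minimal_hajlasz_gradient \<gamma> (conj_exponent p) \<Omega> z g" and h: "h \<in> H"
    have dim: "2 \<le> DIM(real ^ 'n)" using assms(1) by auto
    interpret variable_exponent_mesh \<Omega> "\<T> h" w p c_log p_minus
      unfolding w_def using variable_exponent_meshI[OF Om fam chunk plog pinf \<open>1 < p_minus\<close> dim h] .
    have W: "patch_ratio = W" by (simp add: patch_ratio_def W_def d_def)
    have L: "modular_const = L"
      by (simp add: modular_const_def patch_overlap_def jensen_const_def decay_mass_def W L_def J_def d_def)
    have gG: "g \<in> hajlasz_gradients \<gamma> (conj_exponent p) \<Omega> z"
      using g by (simp add: is_minimal_hajlasz_gradient_def is_arg_min_def)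
    then have gm: "g \<in> borel_measurable (lebesgue_on \<Omega>)" by (simp add: hajlasz_gradients_def Lp_var_def)
    have zL: "z \<in> Lp_var (conj_exponent p) \<Omega>" using z by (simp add: hajlasz_space_def)
    have err: "AE x in lebesgue. x \<in> T \<longrightarrow> \<bar>z x - P h z x\<bar> \<le>
       K * diameter T powr \<gamma> * (\<bar>g x\<bar> + patch_mean_abs T g)" if "T \<in> \<T> h" for T
      unfolding patch_mean_abs_def
      using fe h \<gamma> \<open>0 < c_stab\<close> zL gG that variable_exponent_mesh_axioms
      by (intro projection_error_pointwise[where l = l and V = "Qh h" and c = c_stab and W = W])
        (auto simp: K_def W_def d_def)
    have h0: "0 < h" and hmax: "\<And>T. T \<in> \<T> h \<Longrightarrow> diameter T \<le> h"
    proof -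
      show "0 < h" using fam h by (auto simp: triangulation_family_def)
      have "h = Max (diameter ` \<T> h)" using fam h by (auto simp: triangulation_family_def)
      then show "\<And>T. T \<in> \<T> h \<Longrightarrow> diameter T \<le> h" using finite_mesh by (metis Max_ge finite_imageI imageI)
    qed
    show "luxemburg_norm (conj_exponent p) T (\<lambda>x. z x - P h z x)
       \<le> ennreal (3 * K * L * diameter T powr \<gamma>) * luxemburg_norm (conj_exponent p) (patch (\<T> h) T) g"
      if "T \<in> \<T> h" for T
      using luxemburg_norm_element_le[OF that gm K0 err[OF that]] unfolding L .
    show "luxemburg_norm (conj_exponent p) \<Omega> (\<lambda>x. z x - P h z x)
       \<le> ennreal (3 * K * L * h powr \<gamma>) * luxemburg_norm (conj_exponent p) \<Omega> g"
      using luxemburg_norm_domain_le[OF gm K0 err h0 hmax] \<gamma> unfolding L by blast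
  qed
qed

end
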